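(* Let $n>1$. Consider a semi-coherent system with $n$ components, structure function $\Phi$ and structural signature $\mathbf s=(s_1,\dots,s_n)$, whose components' lifetimes are iid exponentially distributed with rate $\mu>0$. Let $r\in\{1,\dots,n\}$ and assume that the system operates under the $r$-out-of-$n$:R repair policy, with costs $c_{cmp}(j)$ ($1\le j\le n$) and $c_{sys}$. Then: 1. The probability that the first repair is due to a system failure is $p^{(r)}=\sum_{k=1}^r s_k$. 2. The expected cost and the expected time until the first repair, when starting with all components working, are $$\mathbb E\,C[0,T_{rep}^{(r)}]=\sum_{k=1}^r s_k\,(c_{sys}+c_{cmp}(k))+\Big(\sum_{k=r+1}^n s_k\Big)c_{cmp}(r),$$ $$\mathbb E\,T_{rep}^{(r)}=\frac1\mu\left[\sum_{k=1}^r s_k\Big(\sum_{i=n-k+1}^n\frac1i\Big)+\Big(\sum_{k=r+1}^n s_k\Big)\Big(\sum_{i=n-r+1}^n\frac1i\Big)\right].$$ Also, $\mathbb E\,C[0,T_{fail}^{(r)}]=\mathbb E\,C[0,T_{rep}^{(r)}]/p^{(r)}$ and $\mathbb E\,T_{fail}^{(r)}=\mathbb E\,T_{rep}^{(r)}/p^{(r)}$ when $p^{(r)}>0$. 3. The long-term mean cost of the system operating under the $r$-out-of-$n$:R repair policy is, almost surely, $$\lim_{t\to\infty}\frac{C[0,t]}{t}=\mu\,\frac{\sum_{k=1}^r s_k\,(c_{sys}+c_{cmp}(k))+\big(\sum_{k=r+1}^n s_k\big)c_{cmp}(r)}{\sum_{k=1}^r s_k\big(\sum_{i=n-k+1}^n\frac1i\big)+\big(\sum_{k=r+1}^n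 s_k\big)\big(\sum_{i=n-r+1}^n\frac1i\big)}.$$
   Context: **System structure.** A state is $\mathbf x\in\{0,1\}^n$ ($x_i=1$ iff component $i$ works) and the system works in state $\mathbf x$ iff $\Phi(\mathbf x)=1$, where $\Phi:\{0,1\}^n\to\{0,1\}$. The system is semi-coherent iff $\Phi$ is monotone ($\mathbf x\le\mathbf y$ componentwise implies $\Phi(\mathbf x)\le\Phi(\mathbf y)$), $\Phi(\mathbf 0)=0$ and $\Phi(\mathbf 1)=1$. With $|\mathbf x|=\sum_ix_i$ and $\overline S_k:=\binom{n}{n-k}^{-1}\sum_{|\mathbf x|=n-k}\Phi(\mathbf x)$ for $k=0,\dots,n$, the structural signature is $s_k:=\overline S_{k-1}-\overline S_k$, $k=1,\dots,n$. **Repair policy and costs.** At time $0$ all components work. Under the $r$-out-of-$n$:R repair policy, all failed components (and the system, if failed) are repaired whenever $r$ or more components are failed or the system is failed. Failures are detected instantly; repairs are instantaneous and perfect: each repaired component is as good as new, with a fresh exponential lifetime of rate $\mu$ starting at the repair time, independent of everything before (components not failed keep working and keep their lifetimes). A repair of $j$ failed components costs $c_{cmp}(j)$, plus an additional $c_{sys}$ if the system is failed at that time just before the repair; costs are deterministic real numbers. $T_{rep}^{(r)}$ is the time of the first repair; $T_{fail}^{(r)}$ is the first time the system fails under this policy ($+\infty$ if never); $p^{(r)}:=\mathbb P(T_{rep}^{(r)}=T_{fail}^{(r)})$. $C[0,t]$ is the sum of the costs of all repairs made at times in $[0,t]$ (endpoints included). *)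

theory Defs
  imports "HOL-Probability.Probability"
begin

text \<open>
  The components are the elements of a finite type \<open>'c\<close>, so \<open>n\<close> is \<open>CARD('c)\<close>. A state in
  \<open>{0,1}^n\<close> is a predicate on components, with \<open>x i\<close> meaning that component \<open>i\<close> works; the
  order on functions into the booleans is the componentwise order on states.
\<close>

definition semi_coherent :: "(('c \<Rightarrow> bool) \<Rightarrow> bool) \<Rightarrow> bool" where
  "semi_coherent \<Phi> \<longleftrightarrow> mono \<Phi> \<and> \<not> \<Phi> (\<lambda>_. False) \<and> \<Phi> (\<lambda>_. True)"

definition num_working :: "('c::finite \<Rightarrow> bool) \<Rightarrow> nat" where
  "num_working x = (\<Sum>i\<in>UNIV. of_bool (x i))"

definition num_failed :: "('c::finite \<Rightarrow> bool) \<Rightarrow> nat" where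
  "num_failed x = card {i. \<not> x i}"

definition S_bar :: "(('c::finite \<Rightarrow> bool) \<Rightarrow> bool) \<Rightarrow> nat \<Rightarrow> real" where
  "S_bar \<Phi> k = (\<Sum>x | num_working x = CARD('c) - k. of_bool (\<Phi> x))
                 / real (CARD('c) choose (CARD('c) - k))"

text \<open>Meaningful for \<open>1 \<le> k \<le> CARD('c)\<close>.\<close>

definition struct_signature :: "(('c::finite \<Rightarrow> bool) \<Rightarrow> bool) \<Rightarrow> nat \<Rightarrow> real" where
  "struct_signature \<Phi> k = S_bar \<Phi> (k - 1) - S_bar \<Phi> k"

text \<open>
  One trajectory of the system is a deterministic function of an array of lifetimes \<open>L\<close>:
  \<open>L 0 i\<close> is the initial lifetime of component \<open>i\<close>, and \<open>L k i\<close> for \<open>k \<ge> 1\<close> is the fresh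
  lifetime which \<open>i\<close> receives at the \<open>k\<close>-th repair; it is not used if \<open>i\<close> is still working
  then.  In \<open>state_at d t\<close>, the number \<open>d i\<close> is the absolute time at which the current
  lifetime of component \<open>i\<close> ends; at that very instant \<open>i\<close> already counts as failed.
\<close>

definition state_at :: "('c \<Rightarrow> real) \<Rightarrow> real \<Rightarrow> 'c \<Rightarrow> bool" where
  "state_at d t = (\<lambda>i. t < d i)"

definition repair_due :: "(('c::finite \<Rightarrow> bool) \<Rightarrow> bool) \<Rightarrow> nat \<Rightarrow> ('c \<Rightarrow> bool) \<Rightarrow> bool" where
  "repair_due \<Phi> r x \<longleftrightarrow> r \<le> num_failed x \<or> \<not> \<Phi> x"

text \<open>
  States are right-continuous in time, so the infimum is attained, provided that the system does
  not work when all components are failed.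
\<close>

definition next_repair ::
  "(('c::finite \<Rightarrow> bool) \<Rightarrow> bool) \<Rightarrow> nat \<Rightarrow> real \<Rightarrow> ('c \<Rightarrow> real) \<Rightarrow> real" where
  "next_repair \<Phi> r T d = Inf {t. T \<le> t \<and> repair_due \<Phi> r (state_at d t)}"

text \<open>
  \<open>after_repair \<Phi> r L k\<close> consists of the time of the \<open>k\<close>-th repair (time \<open>0\<close> for \<open>k = 0\<close>, where
  nothing is repaired) and of the end points, just after it, of the current lifetimes.
\<close>

primrec after_repair ::
  "(('c::finite \<Rightarrow> bool) \<Rightarrow> bool) \<Rightarrow> nat \<Rightarrow> (nat \<Rightarrow> 'c \<Rightarrow> real) \<Rightarrow> nat \<Rightarrow> real \<times> ('c \<Rightarrow> real)" where
  "after_repair \<Phi> r L 0 = (0, L 0)"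
| "after_repair \<Phi> r L (Suc k) =
     (let (T, d) = after_repair \<Phi> r L k;
          T' = next_repair \<Phi> r T d
      in (T', \<lambda>i. if state_at d T' i then d i else T' + L (Suc k) i))"

definition repair_time ::
  "(('c::finite \<Rightarrow> bool) \<Rightarrow> bool) \<Rightarrow> nat \<Rightarrow> (nat \<Rightarrow> 'c \<Rightarrow> real) \<Rightarrow> nat \<Rightarrow> real" where
  "repair_time \<Phi> r L k = fst (after_repair \<Phi> r L k)"

definition life_end ::
  "(('c::finite \<Rightarrow> bool) \<Rightarrow> bool) \<Rightarrow> nat \<Rightarrow> (nat \<Rightarrow> 'c \<Rightarrow> real) \<Rightarrow> nat \<Rightarrow> 'c \<Rightarrow> real" where
  "life_end \<Phi> r L k = snd (after_repair \<Phi> r L k)"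

definition first_repair_time ::
  "(('c::finite \<Rightarrow> bool) \<Rightarrow> bool) \<Rightarrow> nat \<Rightarrow> (nat \<Rightarrow> 'c \<Rightarrow> real) \<Rightarrow> real" where
  "first_repair_time \<Phi> r L = repair_time \<Phi> r L 1"

text \<open>
  The system is failed at a time \<open>t\<close> between two consecutive repairs; \<open>t\<close> may be the time of the
  second one, in which case the state just before that repair is meant.
\<close>

definition system_failed_at ::
  "(('c::finite \<Rightarrow> bool) \<Rightarrow> bool) \<Rightarrow> nat \<Rightarrow> (nat \<Rightarrow> 'c \<Rightarrow> real) \<Rightarrow> real \<Rightarrow> bool" where
  "system_failed_at \<Phi> r L t \<longleftrightarrow>
     (\<exists>k. repair_time \<Phi> r L k \<le> t \<and> t \<le> repair_time \<Phi> r L (Suc k) \<and>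
          \<not> \<Phi> (state_at (life_end \<Phi> r L k) t))"

text \<open>The infimum of the empty set is \<open>\<infinity>\<close> in \<^typ>\<open>ennreal\<close>.\<close>

definition fail_time ::
  "(('c::finite \<Rightarrow> bool) \<Rightarrow> bool) \<Rightarrow> nat \<Rightarrow> (nat \<Rightarrow> 'c \<Rightarrow> real) \<Rightarrow> ennreal" where
  "fail_time \<Phi> r L = (INF t\<in>{t. system_failed_at \<Phi> r L t}. ennreal t)"

definition repair_cost ::
  "(('c::finite \<Rightarrow> bool) \<Rightarrow> bool) \<Rightarrow> (nat \<Rightarrow> real) \<Rightarrow> real \<Rightarrow> ('c \<Rightarrow> bool) \<Rightarrow> real" where
  "repair_cost \<Phi> c_cmp c_sys x = c_cmp (num_failed x) + (if \<Phi> x then 0 else c_sys)"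

text \<open>
  The cost \<open>C[0,t]\<close>, for \<open>t \<in> [0,\<infinity>]\<close>. The summand for \<open>k\<close> is the cost of repair number \<open>Suc k\<close>,
  determined by the state just before it. If infinitely many repairs occur in \<open>[0,t]\<close>, the sum is
  \<open>0\<close> by convention; for finite \<open>t\<close> this has probability \<open>0\<close>.
\<close>

definition total_cost ::
  "(('c::finite \<Rightarrow> bool) \<Rightarrow> bool) \<Rightarrow> nat \<Rightarrow> (nat \<Rightarrow> real) \<Rightarrow> real \<Rightarrow> (nat \<Rightarrow> 'c \<Rightarrow> real) \<Rightarrow> ennreal \<Rightarrow> real"
  where
  "total_cost \<Phi> r c_cmp c_sys L t =
     (\<Sum>k | ennreal (repair_time \<Phi> r L (Suc k)) \<le> t.
        repair_cost \<Phi> c_cmp c_sys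
          (state_at (life_end \<Phi> r L k) (repair_time \<Phi> r L (Suc k))))"

end

theory Submission
  imports Defs
begin

text \<open>
  By memorylessness, just after a repair the residual lifetimes are again iid exponential and
  independent of the past, so the cycles between repairs are iid. Wald's identity for the
  geometric number of cycles before a failure, and the strong law for cycle lengths and cycle
  costs together with the renewal-reward argument, reduce everything to one cycle. There, a state
  with \<open>a\<close> failed components is left through the failure of a given working component with
  probability \<open>\<integral> u^a (1 - u)^(n - a - 1) du = 1 / ((n - a) (n choose a))\<close>, and \<open>1 / \<mu>\<close> times
  this number is the expected time spent in that state. Counting transitions by the number of
  failed components produces the signature.
\<close>

section \<open>The strong law of large numbers and renewal-reward limits\<close>

text \<open>A repair leaves the working components alone, so a new cycle does not start from a fresh
  row of the array: what has to be proved is that the residual vector is independent, jointly, of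
  the length and the final state of the cycle just ended. The event that ends a cycle depends on all
  components at once; it is therefore split into the events \<open>passes (x, j)\<close>. Given the
  lifetime \<open>s\<close> of \<open>j\<close>, such an event is a product of conditions on the
  other components taken one by one, and memorylessness applies to each. Every resulting term
  carries the same factor, the fresh product law of a box, which comes out of the sum over
  transitions. Induction over cycles then shifts the array by one repair
  (\<open>next_array\<close>). The strong law is only needed with finite fourth moments: a cycle is
  no longer than the largest of n exponential lifetimes, and its cost takes finitely many values.
  The mean cycle length is not obtained from transitions but by Fubini, as the sum of the times
  spent in the states where no repair is due.\<close>

lemma abs_power_le_one_plus_power:
  fixes z :: real
  assumes "j \<le> m"
  shows "\<bar>z\<bar> ^ j \<le> 1 + \<bar>z\<bar> ^ m"
proof (cases "\<bar>z\<bar> \<le> 1")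
  case True
  then have "\<bar>z\<bar> ^ j \<le> 1" by (simp add: power_le_one)
  then show ?thesis by (smt (verit) abs_ge_zero zero_le_power)
next
  case False
  then have "\<bar>z\<bar> ^ j \<le> \<bar>z\<bar> ^ m" using assms by (intro power_increasing) auto
  then show ?thesis by simp
qed

lemma (in finite_measure) integrable_lower_power:
  fixes f :: "'a \<Rightarrow> real"
  assumes [measurable]: "f \<in> borel_measurable M" and "integrable M (\<lambda>x. \<bar>f x\<bar> ^ m)" and "j \<le> m"
  shows "integrable M (\<lambda>x. f x ^ j)"
proof (rule Bochner_Integration.integrable_bound)
  show "integrable M (\<lambda>x. 1 + \<bar>f x\<bar> ^ m)" using assms by simp
  show "AE x in M. norm (f x ^ j) \<le> norm (1 + \<bar>f x\<bar> ^ m)"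
    using abs_power_le_one_plus_power[OF \<open>j \<le> m\<close>] by (intro AE_I2) (auto simp: power_abs)
qed measurable

text \<open>The fourth moment of a centered sum grows only like m^2, because every term with a
  factor of power one has mean 0. Hence the fourth powers of the averages have summable means, their
  series converges almost surely, and its terms tend to 0.\<close>

lemma (in prob_space) strong_law_fourth_moment:
  fixes Z :: "nat \<Rightarrow> 'a \<Rightarrow> real"
  assumes indep: "indep_vars (\<lambda>_. borel) Z UNIV"
    and int4: "\<And>k. integrable M (\<lambda>\<omega>. Z k \<omega> ^ 4)"
    and mean: "\<And>k. expectation (Z k) = 0"
    and bound: "\<And>k. expectation (\<lambda>\<omega>. Z k \<omega> ^ 4) \<le> C"
  shows "AE \<omega> in M. (\<lambda>m. (\<Sum>k<m. Z k \<omega>) / real m) \<longlonglongrightarrow> 0"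
proof -
  define S where "S m \<omega> = (\<Sum>k<m. Z k \<omega>)" for m \<omega>
  \<comment> \<open>\<open>K\<close> bounds the second moments too, because z^2 \<le> 1 + z^4; being
    at least 1, it also satisfies K \<le> K^2 in the induction.\<close>
  define K where "K = 1 + C"
  have Zm[measurable]: "Z k \<in> borel_measurable M" for k
    using indep by (auto simp: indep_vars_def)
  have Sm[measurable]: "S m \<in> borel_measurable M" for m
    unfolding S_def[abs_def] by measurable
  have intZ: "integrable M (\<lambda>\<omega>. Z k \<omega> ^ j)" if "j \<le> 4" for k j
    by (rule integrable_lower_power[OF _ _ that]) (use int4[of k] in auto)
  have "0 \<le> expectation (\<lambda>\<omega>. Z 0 \<omega> ^ 4)" by simp
  then have "0 \<le> C" using bound[of 0] by (rule order_trans)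
  then have K1: "K \<ge> 1" by (simp add: K_def)
  have Z2: "expectation (\<lambda>\<omega>. Z k \<omega> ^ 2) \<le> K" for k
  proof -
    have "expectation (\<lambda>\<omega>. Z k \<omega> ^ 2) \<le> expectation (\<lambda>\<omega>. 1 + Z k \<omega> ^ 4)"
      using abs_power_le_one_plus_power[of 2 4] intZ[of 2 k] intZ[of 4 k]
      by (intro Bochner_Integration.integral_mono) auto
    also have "\<dots> \<le> K" using bound[of k] intZ[of 4 k] by (simp add: prob_space K_def)
    finally show ?thesis .
  qed
  have ind: "indep_var borel (\<lambda>\<omega>. Z m \<omega> ^ j) borel (\<lambda>\<omega>. S m \<omega> ^ i)" for m i j
  proof -
    have "indep_var borel (Z m) borel (S m)"
      unfolding S_def[abs_def] by (intro indep_vars_sum indep_vars_subset[OF indep]) auto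
    from indep_var_compose[OF this, of "\<lambda>x. x ^ j" borel "\<lambda>x. x ^ i" borel]
    show ?thesis by (simp add: comp_def)
  qed
  \<comment> \<open>The second moment is carried along because it appears in the recursion for the
    fourth.\<close>
  have moments: "integrable M (\<lambda>\<omega>. S m \<omega> ^ 4) \<and> expectation (S m) = 0 \<and>
      expectation (\<lambda>\<omega>. S m \<omega> ^ 2) \<le> real m * K \<and>
      expectation (\<lambda>\<omega>. S m \<omega> ^ 4) \<le> 3 * real m ^ 2 * K ^ 2" for m
  proof (induction m)
    case 0
    then show ?case by (simp add: S_def)
  next
    case (Suc m)
    then have IH: "integrable M (\<lambda>\<omega>. S m \<omega> ^ 4)" "expectation (S m) = 0"
      "expectation (\<lambda>\<omega>. S m \<omega> ^ 2) \<le> real m * K"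
      "expectation (\<lambda>\<omega>. S m \<omega> ^ 4) \<le> 3 * real m ^ 2 * K ^ 2" by auto
    have intS: "integrable M (\<lambda>\<omega>. S m \<omega> ^ j)" if "j \<le> 4" for j
      by (rule integrable_lower_power[OF _ _ that]) (use IH(1) in auto)
    \<comment> \<open>The monomials of the binomial expansion. \<open>Z m\<close> is independent of
      \<open>S m\<close>, so each expectation factorizes, and those with \<open>i = 1\<close> or
      \<open>j = 1\<close> vanish.\<close>
    define P where "P i j \<omega> = Z m \<omega> ^ j * S m \<omega> ^ i" for i j \<omega>
    have intP: "integrable M (P i j)" if "i \<le> 4" "j \<le> 4" for i j
      unfolding P_def[abs_def] by (rule indep_var_integrable[OF ind intZ[OF that(2)] intS[OF that(1)]])
    have eP: "expectation (P i j) = expectation (\<lambda>\<omega>. Z m \<omega> ^ j) * expectation (\<lambda>\<omega>. S m \<omega> ^ i)"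
      if "i \<le> 4" "j \<le> 4" for i j
      unfolding P_def[abs_def]
      by (rule indep_var_lebesgue_integral[OF ind intZ[OF that(2)] intS[OF that(1)]])
    have S': "S (Suc m) \<omega> = S m \<omega> + Z m \<omega>" for \<omega> by (simp add: S_def)
    have four: "S (Suc m) \<omega> ^ 4 = P 4 0 \<omega> + 4 * P 3 1 \<omega> + 6 * P 2 2 \<omega> + 4 * P 1 3 \<omega> + P 0 4 \<omega>" for \<omega>
      unfolding S' P_def by algebra
    have two: "S (Suc m) \<omega> ^ 2 = P 2 0 \<omega> + 2 * P 1 1 \<omega> + P 0 2 \<omega>" for \<omega>
      unfolding S' P_def by algebra
    have e4: "expectation (\<lambda>\<omega>. S (Suc m) \<omega> ^ 4) = expectation (\<lambda>\<omega>. S m \<omega> ^ 4)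
        + 6 * (expectation (\<lambda>\<omega>. S m \<omega> ^ 2) * expectation (\<lambda>\<omega>. Z m \<omega> ^ 2))
        + expectation (\<lambda>\<omega>. Z m \<omega> ^ 4)"
    proof -
      have "expectation (\<lambda>\<omega>. S (Suc m) \<omega> ^ 4) = expectation (P 4 0) + 4 * expectation (P 3 1)
          + 6 * expectation (P 2 2) + 4 * expectation (P 1 3) + expectation (P 0 4)"
        unfolding four by (simp add: intP)
      then show ?thesis by (simp add: eP IH mean prob_space)
    qed
    have e2: "expectation (\<lambda>\<omega>. S (Suc m) \<omega> ^ 2) = expectation (\<lambda>\<omega>. S m \<omega> ^ 2) + expectation (\<lambda>\<omega>. Z m \<omega> ^ 2)"
    proof -
      have "expectation (\<lambda>\<omega>. S (Suc m) \<omega> ^ 2) = expectation (P 2 0) + 2 * expectation (P 1 1) + expectation (P 0 2)"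
        unfolding two by (simp add: intP)
      then show ?thesis by (simp add: eP IH mean prob_space)
    qed
    have "expectation (\<lambda>\<omega>. S m \<omega> ^ 2) * expectation (\<lambda>\<omega>. Z m \<omega> ^ 2) \<le> real m * K * K"
      using IH(3) Z2[of m] K1 by (intro mult_mono) auto
    then have "expectation (\<lambda>\<omega>. S (Suc m) \<omega> ^ 4) \<le> 3 * real m ^ 2 * K ^ 2 + 6 * (real m * K * K) + K"
      unfolding e4 using IH(4) bound[of m] by (simp add: K_def)
    also have "\<dots> \<le> 3 * real (Suc m) ^ 2 * K ^ 2"
    proof -
      have "K * 1 \<le> K * K" using K1 by (intro mult_left_mono) auto
      then have "K \<le> 3 * (K * K)" using K1 by (smt (verit))
      then show ?thesis by (simp add: power2_eq_square algebra_simps)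
    qed
    finally have 4: "expectation (\<lambda>\<omega>. S (Suc m) \<omega> ^ 4) \<le> 3 * real (Suc m) ^ 2 * K ^ 2" .
    have "integrable M (\<lambda>\<omega>. S (Suc m) \<omega> ^ 4)"
      unfolding four by (simp add: intP)
    moreover have "expectation (S (Suc m)) = 0"
      using IH(2) mean[of m] intS[of 1] intZ[of 1 m] by (simp add: S'[abs_def])
    moreover have "expectation (\<lambda>\<omega>. S (Suc m) \<omega> ^ 2) \<le> real (Suc m) * K"
      unfolding e2 using IH(3) Z2[of m] by (simp add: algebra_simps)
    ultimately show ?case using 4 by blast
  qed
  define Q where "Q m \<omega> = (S m \<omega> / real m) ^ 4" for m \<omega>
  have Qm[measurable]: "Q m \<in> borel_measurable M" for m unfolding Q_def[abs_def] by measurable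
  have Qb: "(\<integral>\<^sup>+\<omega>. ennreal (Q m \<omega>) \<partial>M) \<le> ennreal (3 * K ^ 2 * (1 / real m ^ 2))" for m
  \<comment> \<open>For \<open>m = 0\<close> both sides are 0 by the convention on division.\<close>
  proof (cases "m = 0")
    case False
    have "(\<integral>\<^sup>+\<omega>. ennreal (Q m \<omega>) \<partial>M) = ennreal (expectation (Q m))"
      using moments[of m] by (intro nn_integral_eq_integral) (auto simp: Q_def[abs_def] power_divide)
    also have "expectation (Q m) \<le> 3 * real m ^ 2 * K ^ 2 / real m ^ 4"
      using moments[of m] by (auto simp: Q_def[abs_def] power_divide intro!: divide_right_mono)
    also have "\<dots> = 3 * K ^ 2 * (1 / real m ^ 2)"
      using False by (simp add: field_simps power_add[symmetric])
    finally show ?thesis using ennreal_leI by simp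
  qed (simp add: Q_def)
  have "(\<integral>\<^sup>+\<omega>. (\<Sum>m. ennreal (Q m \<omega>)) \<partial>M) = (\<Sum>m. \<integral>\<^sup>+\<omega>. ennreal (Q m \<omega>) \<partial>M)"
    by (intro nn_integral_suminf) measurable
  also have "\<dots> \<le> (\<Sum>m. ennreal (3 * K ^ 2 * (1 / real m ^ 2)))"
    by (intro suminf_le Qb) auto
  also have "\<dots> = ennreal (\<Sum>m. 3 * K ^ 2 * (1 / real m ^ 2))"
    by (intro suminf_ennreal2 summable_mult) (use inverse_power_summable[of 2, where 'a=real] in \<open>auto simp: divide_inverse\<close>)
  finally have "(\<integral>\<^sup>+\<omega>. (\<Sum>m. ennreal (Q m \<omega>)) \<partial>M) \<noteq> \<infinity>"
    by (auto simp: top_unique)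
  then have "AE \<omega> in M. (\<Sum>m. ennreal (Q m \<omega>)) \<noteq> \<infinity>"
    by (intro nn_integral_noteq_infinite) measurable
  then show ?thesis
  proof eventually_elim
    case (elim \<omega>)
    have "summable (\<lambda>m. Q m \<omega>)"
      using elim by (intro summable_suminf_not_top) (auto simp: Q_def)
    then have "(\<lambda>m. Q m \<omega>) \<longlonglongrightarrow> 0" by (rule summable_LIMSEQ_zero)
    then have "(\<lambda>m. root 4 (Q m \<omega>)) \<longlonglongrightarrow> root 4 0" by (intro tendsto_intros)
    then have "(\<lambda>m. \<bar>S m \<omega> / real m\<bar>) \<longlonglongrightarrow> 0"
    proof -
      have "root 4 (x ^ 4) = \<bar>x\<bar>" for x :: real
        using real_root_power_cancel[of 4 "\<bar>x\<bar>"] by simp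
      then show ?thesis using \<open>(\<lambda>m. root 4 (Q m \<omega>)) \<longlonglongrightarrow> root 4 0\<close> unfolding Q_def by simp
    qed
    then show ?case unfolding S_def tendsto_rabs_zero_iff .
  qed
qed

text \<open>Centering reduces this to mean 0; equality in distribution turns one fourth moment into
  a bound for all.\<close>

lemma (in prob_space) strong_law_fourth_moment_iid:
  fixes Z :: "nat \<Rightarrow> 'a \<Rightarrow> real"
  assumes indep: "indep_vars (\<lambda>_. borel) Z UNIV"
    and distr: "\<And>k. distr M borel (Z k) = distr M borel (Z 0)"
    and int4: "integrable M (\<lambda>\<omega>. Z 0 \<omega> ^ 4)"
  shows "AE \<omega> in M. (\<lambda>m. (\<Sum>k<m. Z k \<omega>) / real m) \<longlonglongrightarrow> expectation (Z 0)"
proof -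
  define e where "e = expectation (Z 0)"
  have Zm[measurable]: "Z k \<in> borel_measurable M" for k
    using indep by (auto simp: indep_vars_def)
  have transfer: "expectation (\<lambda>\<omega>. g (Z k \<omega>)) = expectation (\<lambda>\<omega>. g (Z 0 \<omega>))"
    "integrable M (\<lambda>\<omega>. g (Z k \<omega>)) \<longleftrightarrow> integrable M (\<lambda>\<omega>. g (Z 0 \<omega>))"
    if [measurable]: "g \<in> borel_measurable borel" for g :: "real \<Rightarrow> real" and k
  proof -
    have "expectation (\<lambda>\<omega>. g (Z k \<omega>)) = (\<integral>z. g z \<partial>distr M borel (Z k))" for k
      by (rule integral_distr[symmetric]) measurable
    from this[of k] this[of 0] show "expectation (\<lambda>\<omega>. g (Z k \<omega>)) = expectation (\<lambda>\<omega>. g (Z 0 \<omega>))"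
      by (simp only: distr[of k])
    have "integrable M (\<lambda>\<omega>. g (Z k \<omega>)) \<longleftrightarrow> integrable (distr M borel (Z k)) g" for k
      by (rule integrable_distr_eq[symmetric]) measurable
    from this[of k] this[of 0] show "integrable M (\<lambda>\<omega>. g (Z k \<omega>)) \<longleftrightarrow> integrable M (\<lambda>\<omega>. g (Z 0 \<omega>))"
      by (simp only: distr[of k])
  qed
  have pw: "integrable M (\<lambda>\<omega>. Z 0 \<omega> ^ j)" if "j \<le> 4" for j
    by (rule integrable_lower_power[OF _ _ that]) (use int4 in auto)
  have i4: "integrable M (\<lambda>\<omega>. (Z 0 \<omega> - e) ^ 4)"
  proof -
    have "(Z 0 \<omega> - e) ^ 4 = Z 0 \<omega> ^ 4 - 4 * e * Z 0 \<omega> ^ 3 + 6 * e ^ 2 * Z 0 \<omega> ^ 2 - 4 * e ^ 3 * Z 0 \<omega> ^ 1 + e ^ 4" for \<omega>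
      by algebra
    then show ?thesis using pw[of 1] pw[of 2] pw[of 3] pw[of 4] by simp
  qed
  have "AE \<omega> in M. (\<lambda>m. (\<Sum>k<m. Z k \<omega> - e) / real m) \<longlonglongrightarrow> 0"
  proof (rule strong_law_fourth_moment)
    show "indep_vars (\<lambda>_. borel) (\<lambda>k \<omega>. Z k \<omega> - e) UNIV"
      by (rule indep_vars_compose2[OF indep]) auto
    show "integrable M (\<lambda>\<omega>. (Z k \<omega> - e) ^ 4)" for k
      using i4 transfer(2)[of "\<lambda>z. (z - e) ^ 4" k] by simp
    show "expectation (\<lambda>\<omega>. Z k \<omega> - e) = 0" for k
      using pw[of 1] transfer(1)[of "\<lambda>z. z - e" k] by (simp add: e_def prob_space)
    show "expectation (\<lambda>\<omega>. (Z k \<omega> - e) ^ 4) \<le> expectation (\<lambda>\<omega>. (Z 0 \<omega> - e) ^ 4)" for k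
      using transfer(1)[of "\<lambda>z. (z - e) ^ 4" k] by simp
  qed
  then show ?thesis
  proof eventually_elim
    case (elim \<omega>)
    then have "(\<lambda>m. (\<Sum>k<m. Z k \<omega> - e) / real m + e) \<longlonglongrightarrow> 0 + e" by (intro tendsto_intros)
    moreover have "\<forall>\<^sub>F m in sequentially. (\<Sum>k<m. Z k \<omega> - e) / real m + e = (\<Sum>k<m. Z k \<omega>) / real m"
      using eventually_gt_at_top[of 0] by eventually_elim (simp add: sum_subtractf field_simps)
    ultimately show ?case unfolding e_def by (simp add: tendsto_cong)
  qed
qed

text \<open>A deterministic statement, applied to each trajectory: if \<open>N t\<close> cycles are
  complete by time \<open>t\<close>, then R (N t) \<le> t < R (Suc (N t)), so t / N t tends to
  \<open>a\<close>. The reward of a cycle is paid at its end, hence the sum over complete cycles is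
  exact and rewards of either sign are allowed.\<close>

lemma renewal_reward_limit:
  fixes R Y :: "nat \<Rightarrow> real"
  assumes mono: "incseq R"
    and R: "(\<lambda>m. R m / real m) \<longlonglongrightarrow> a" and "a > 0"
    and Y: "(\<lambda>m. (\<Sum>k<m. Y k) / real m) \<longlonglongrightarrow> b"
  shows "((\<lambda>t. (\<Sum>k | R (Suc k) \<le> t. Y k) / t) \<longlongrightarrow> b / a) at_top"
proof -
  have lim: "filterlim R at_top sequentially"
  proof -
    have "filterlim (\<lambda>m. R m / real m * real m) at_top sequentially"
      by (rule filterlim_tendsto_pos_mult_at_top[OF R \<open>a > 0\<close> filterlim_real_sequentially])
    moreover have "\<forall>\<^sub>F m in sequentially. R m / real m * real m = R m"
      using eventually_gt_at_top[of 0] by eventually_elim auto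
    ultimately show ?thesis using filterlim_cong[OF refl refl] by force
  qed
  define N where "N t = (LEAST k. t < R (Suc k))" for t
  have ex: "\<exists>k. t < R (Suc k)" for t
  proof -
    obtain m where "t + 1 \<le> R m" using lim by (auto simp: filterlim_at_top eventually_sequentially)
    also have "\<dots> \<le> R (Suc m)" using mono by (simp add: incseqD)
    finally show ?thesis by (intro exI[of _ m]) auto
  qed
  have N1: "t < R (Suc (N t))" for t unfolding N_def using LeastI_ex[OF ex] .
  have set: "{k. R (Suc k) \<le> t} = {..<N t}" for t
  proof (safe)
    fix k assume "R (Suc k) \<le> t"
    then show "k < N t"
      using N1[of t] incseqD[OF mono, of "Suc (N t)" "Suc k"] by (cases "k < N t") auto
  next
    fix k assume "k < N t"
    then show "R (Suc k) \<le> t" unfolding N_def by (auto dest: not_less_Least)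
  qed
  have N2: "R (N t) \<le> t" if "t \<ge> R 0" for t
  proof (cases "N t")
    case (Suc k)
    then have "k \<in> {k. R (Suc k) \<le> t}" unfolding set by simp
    then show ?thesis using Suc by simp
  qed (use that in simp)
  have Nlim: "filterlim N at_top at_top"
    unfolding filterlim_at_top
  proof
    fix Z :: nat
    show "\<forall>\<^sub>F t in at_top. Z \<le> N t"
      using eventually_ge_at_top[of "R Z"]
    proof eventually_elim
      case (elim t)
      then have "R Z < R (Suc (N t))" using N1[of t] by simp
      then show ?case using incseqD[OF mono, of "Suc (N t)" Z] by (cases "Z \<le> N t") auto
    qed
  qed
  have l1: "((\<lambda>t. R (N t) / real (N t)) \<longlongrightarrow> a) at_top"
    by (rule filterlim_compose[OF R Nlim])
  \<comment> \<open>The upper bound R (N t + 1) / N t, written with the correction factor (N t + 1)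
    / N t, which tends to 1.\<close>
  have l2: "((\<lambda>t. R (Suc (N t)) / real (Suc (N t)) * (real (Suc (N t)) / real (N t))) \<longlongrightarrow> a * 1) at_top"
  proof (intro tendsto_mult)
    show "((\<lambda>t. R (Suc (N t)) / real (Suc (N t))) \<longlongrightarrow> a) at_top"
      by (rule filterlim_compose[OF LIMSEQ_Suc[OF R] Nlim])
    show "((\<lambda>t. real (Suc (N t)) / real (N t)) \<longlongrightarrow> 1) at_top"
      using filterlim_compose[OF LIMSEQ_Suc_n_over_n Nlim] .
  qed
  have lim_t: "((\<lambda>t. t / real (N t)) \<longlongrightarrow> a) at_top"
  proof (rule tendsto_sandwich[OF _ _ l1 l2[simplified]])
    show "\<forall>\<^sub>F t in at_top. R (N t) / real (N t) \<le> t / real (N t)"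
      using eventually_ge_at_top[of "R 0"] by eventually_elim (auto intro!: divide_right_mono N2)
    show "\<forall>\<^sub>F t in at_top. t / real (N t) \<le> R (Suc (N t)) / real (N t)"
      using N1 by (intro always_eventually allI divide_right_mono) (auto intro: less_imp_le)
  qed
  have "((\<lambda>t. (\<Sum>k<N t. Y k) / real (N t) / (t / real (N t))) \<longlongrightarrow> b / a) at_top"
    using \<open>a > 0\<close> by (intro tendsto_divide filterlim_compose[OF Y Nlim] lim_t) auto
  moreover have "\<forall>\<^sub>F t in at_top. (\<Sum>k<N t. Y k) / real (N t) / (t / real (N t)) = (\<Sum>k | R (Suc k) \<le> t. Y k) / t"
    using filterlim_at_top[THEN iffD1, OF Nlim, rule_format, of 1]
    by eventually_elim (simp add: set)
  ultimately show ?thesis by (rule Lim_transform_eventually)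
qed

section \<open>Trajectories as sequences of cycles\<close>

definition cycle_length :: "(('c::finite \<Rightarrow> bool) \<Rightarrow> bool) \<Rightarrow> nat \<Rightarrow> ('c \<Rightarrow> real) \<Rightarrow> real" where
  "cycle_length \<Phi> r d = next_repair \<Phi> r 0 d"

definition final_state :: "(('c::finite \<Rightarrow> bool) \<Rightarrow> bool) \<Rightarrow> nat \<Rightarrow> ('c \<Rightarrow> real) \<Rightarrow> ('c \<Rightarrow> bool)" where
  "final_state \<Phi> r d = state_at d (cycle_length \<Phi> r d)"

definition renew :: "(('c::finite \<Rightarrow> bool) \<Rightarrow> bool) \<Rightarrow> nat \<Rightarrow> ('c \<Rightarrow> real) \<Rightarrow> ('c \<Rightarrow> real) \<Rightarrow> ('c \<Rightarrow> real)" where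
  "renew \<Phi> r d l = (\<lambda>i. if final_state \<Phi> r d i then d i - cycle_length \<Phi> r d else l i)"

text \<open>Residual lifetimes just after the \<open>k\<close>-th repair, so that every cycle starts at time \<open>0\<close>.\<close>

primrec residual :: "(('c::finite \<Rightarrow> bool) \<Rightarrow> bool) \<Rightarrow> nat \<Rightarrow> (nat \<Rightarrow> 'c \<Rightarrow> real) \<Rightarrow> nat \<Rightarrow> ('c \<Rightarrow> real)" where
  "residual \<Phi> r L 0 = L 0"
| "residual \<Phi> r L (Suc k) = renew \<Phi> r (residual \<Phi> r L k) (L (Suc k))"

text \<open>
  A cycle ends when the failure of some component \<open>j\<close> in a state \<open>x\<close> makes a repair due;
  \<open>passes (x, j) d\<close> is the event that \<open>x\<close> is the state just before \<open>j\<close> fails. For distinct positive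
  lifetimes exactly one such pair occurs, and the event factorizes over the other components given
  the lifetime of \<open>j\<close>.
\<close>

definition transitions :: "(('c::finite \<Rightarrow> bool) \<Rightarrow> bool) \<Rightarrow> nat \<Rightarrow> (('c \<Rightarrow> bool) \<times> 'c) set" where
  "transitions \<Phi> r = {(x, j). x j \<and> \<not> repair_due \<Phi> r x \<and> repair_due \<Phi> r (x(j := False))}"

definition passes :: "('c \<Rightarrow> bool) \<times> 'c \<Rightarrow> ('c \<Rightarrow> real) \<Rightarrow> bool" where
  "passes p d \<longleftrightarrow> (case p of (x, j) \<Rightarrow> \<forall>i. i \<noteq> j \<longrightarrow> (if x i then d j < d i else d i < d j))"

lemma state_at_antimono: "s \<le> t \<Longrightarrow> state_at d t \<le> state_at d s"
  by (auto simp: state_at_def le_fun_def)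

lemma state_at_shift: "state_at (\<lambda>i. T + d i) t = state_at d (t - T)"
  by (auto simp: state_at_def)

locale repair_policy =
  fixes \<Phi> :: "('c::finite \<Rightarrow> bool) \<Rightarrow> bool" and r :: nat
  assumes coherent: "semi_coherent \<Phi>" and r_ge_1: "1 \<le> r" and r_le_n: "r \<le> CARD('c)"
begin

abbreviation "due \<equiv> repair_due \<Phi> r"

lemma structure_mono: "x \<le> y \<Longrightarrow> \<Phi> x \<Longrightarrow> \<Phi> y"
  using coherent monoD[of \<Phi> x y] by (auto simp: semi_coherent_def le_bool_def)

lemma due_antimono:
  assumes "x \<le> y" "due y"
  shows "due x"
proof -
  have "num_failed y \<le> num_failed x"
    unfolding num_failed_def using assms(1) by (intro card_mono) (auto simp: le_fun_def)
  then show ?thesis using assms structure_mono[of x y] by (auto simp: repair_due_def)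
qed

lemma due_all_failed: "due (\<lambda>_. False)"
  using coherent by (simp add: repair_due_def semi_coherent_def)

lemma not_due_all_working: "\<not> due (\<lambda>_. True)"
  using coherent r_ge_1 by (simp add: repair_due_def semi_coherent_def num_failed_def)

text \<open>The infimum is over a nonempty set, since from \<open>Max (range d)\<close> on nothing
  works, and it is attained because the state is constant on a short interval to the right of
  it.\<close>

lemma next_repair_ge: "T \<le> next_repair \<Phi> r T d"
  and next_repair_due: "due (state_at d (next_repair \<Phi> r T d))"
proof -
  define A where "A = {t. T \<le> t \<and> due (state_at d t)}"
  define u where "u = Inf A"
  have u: "u = next_repair \<Phi> r T d" by (simp add: u_def A_def next_repair_def)
  have "state_at d (max T (Max (range d))) = (\<lambda>_. False)"
    by (auto simp: state_at_def not_less intro!: max.coboundedI2 Max_ge)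
  then have "max T (Max (range d)) \<in> A" using due_all_failed by (simp add: A_def)
  then have ne: "A \<noteq> {}" by auto
  have bdd: "bdd_below A" by (auto simp: A_def intro!: bdd_belowI)
  show "T \<le> next_repair \<Phi> r T d"
    unfolding u[symmetric] u_def using ne by (intro cInf_greatest) (auto simp: A_def)
  \<comment> \<open>No lifetime ends strictly between \<open>u\<close> and \<open>e\<close>; the
    entry \<open>u + 1\<close> covers the case that none ends after \<open>u\<close>.\<close>
  define e where "e = Min (insert (u + 1) {d i |i. u < d i})"
  have fin: "finite {d i |i. u < d i}" by simp
  have e: "u < e" "\<And>i. u < d i \<Longrightarrow> e \<le> d i"
    using fin by (auto simp: e_def intro!: Min_le)
  obtain t where t: "t \<in> A" "t < e"
    using cInf_lessD[OF ne, of e] e(1) by (auto simp: u_def)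
  have "u \<le> t" using t(1) bdd by (auto simp: u_def intro: cInf_lower)
  then have "state_at d t = state_at d u"
    using t(2) e(2) by (auto simp: state_at_def fun_eq_iff intro: less_le_trans)
  then show "due (state_at d (next_repair \<Phi> r T d))"
    using t(1) by (simp add: A_def u)
qed

text \<open>Since \<open>due\<close> persists until a repair, the infimum can be compared with
  \<open>t\<close> by a look at the state at \<open>t\<close> alone. Measurability of the cycle
  length rests on this too.\<close>

lemma next_repair_le_iff: "next_repair \<Phi> r T d \<le> t \<longleftrightarrow> T \<le> t \<and> due (state_at d t)"
proof
  assume "next_repair \<Phi> r T d \<le> t"
  then show "T \<le> t \<and> due (state_at d t)"
    using next_repair_ge[of T d] next_repair_due[of d T] due_antimono[OF state_at_antimono] by force
next
  assume "T \<le> t \<and> due (state_at d t)"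
  then show "next_repair \<Phi> r T d \<le> t"
    unfolding next_repair_def by (intro cInf_lower) (auto intro!: bdd_belowI)
qed

lemma next_repair_shift: "next_repair \<Phi> r T (\<lambda>i. T + d i) = T + cycle_length \<Phi> r d"
proof (rule antisym)
  show "next_repair \<Phi> r T (\<lambda>i. T + d i) \<le> T + cycle_length \<Phi> r d"
    using next_repair_ge[of 0 d] next_repair_due[of d 0]
    by (simp add: next_repair_le_iff state_at_shift cycle_length_def)
  have "cycle_length \<Phi> r d \<le> next_repair \<Phi> r T (\<lambda>i. T + d i) - T"
    using next_repair_ge[of T] next_repair_due[of "\<lambda>i. T + d i" T]
    by (simp add: cycle_length_def next_repair_le_iff state_at_shift)
  then show "T + cycle_length \<Phi> r d \<le> next_repair \<Phi> r T (\<lambda>i. T + d i)" by simp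
qed

lemma cycle_length_nonneg: "0 \<le> cycle_length \<Phi> r d"
  by (simp add: cycle_length_def next_repair_ge)

lemma cycle_length_le_iff: "cycle_length \<Phi> r d \<le> t \<longleftrightarrow> 0 \<le> t \<and> due (state_at d t)"
  by (simp add: cycle_length_def next_repair_le_iff)

lemma final_state_due: "due (final_state \<Phi> r d)"
  by (simp add: final_state_def cycle_length_def next_repair_due)

lemma cycle_length_pos:
  assumes "\<And>i. 0 < d i"
  shows "0 < cycle_length \<Phi> r d"
proof -
  have "state_at d 0 = (\<lambda>_. True)" using assms by (simp add: state_at_def)
  then show ?thesis using cycle_length_le_iff[of d 0] not_due_all_working by (simp add: not_le)
qed

text \<open>Repeated use of the shift rule takes the absolute clock out of the recursion: what
  evolves are the residual lifetimes, and the clock is a sum of cycle lengths.\<close>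

lemma after_repair_eq:
  "after_repair \<Phi> r L k =
    (\<Sum>j<k. cycle_length \<Phi> r (residual \<Phi> r L j),
     \<lambda>i. (\<Sum>j<k. cycle_length \<Phi> r (residual \<Phi> r L j)) + residual \<Phi> r L k i)"
proof (induction k)
  case (Suc k)
  then show ?case
    by (auto simp: Let_def next_repair_shift renew_def final_state_def state_at_def fun_eq_iff)
qed simp

lemma repair_time_eq: "repair_time \<Phi> r L k = (\<Sum>j<k. cycle_length \<Phi> r (residual \<Phi> r L j))"
  by (simp add: repair_time_def after_repair_eq)

lemma life_end_eq: "life_end \<Phi> r L k = (\<lambda>i. repair_time \<Phi> r L k + residual \<Phi> r L k i)"
  by (simp add: repair_time_def life_end_def after_repair_eq)

lemma repair_time_nonneg: "0 \<le> repair_time \<Phi> r L k"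
  by (simp add: repair_time_eq sum_nonneg cycle_length_nonneg)

lemma state_before_repair:
  "state_at (life_end \<Phi> r L k) (repair_time \<Phi> r L (Suc k)) = final_state \<Phi> r (residual \<Phi> r L k)"
  by (simp add: life_end_eq state_at_shift repair_time_eq final_state_def)

lemma incseq_repair_time: "incseq (repair_time \<Phi> r L)"
  by (intro incseq_SucI) (simp add: repair_time_eq cycle_length_nonneg)

lemma first_repair_time_eq: "first_repair_time \<Phi> r L = cycle_length \<Phi> r (L 0)"
  by (simp add: first_repair_time_def repair_time_eq)

text \<open>A failed system makes a repair due, so within a cycle it can be down only at the final
  instant.\<close>

lemma system_failed_at_iff:
  "system_failed_at \<Phi> r L t \<longleftrightarrow>
    (\<exists>k. t = repair_time \<Phi> r L (Suc k) \<and> \<not> \<Phi> (final_state \<Phi> r (residual \<Phi> r L k)))"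
proof
  assume "system_failed_at \<Phi> r L t"
  then obtain k where k: "repair_time \<Phi> r L k \<le> t" "t \<le> repair_time \<Phi> r L (Suc k)"
    "\<not> \<Phi> (state_at (life_end \<Phi> r L k) t)" by (auto simp: system_failed_at_def)
  have "due (state_at (residual \<Phi> r L k) (t - repair_time \<Phi> r L k))"
    using k(3) by (simp add: repair_due_def life_end_eq state_at_shift)
  then have "cycle_length \<Phi> r (residual \<Phi> r L k) \<le> t - repair_time \<Phi> r L k"
    using k(1) by (simp add: cycle_length_le_iff)
  then have "t = repair_time \<Phi> r L (Suc k)" using k(2) by (simp add: repair_time_eq)
  then show "\<exists>k. t = repair_time \<Phi> r L (Suc k) \<and> \<not> \<Phi> (final_state \<Phi> r (residual \<Phi> r L k))"
    using k(3) by (auto simp: state_before_repair)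
next
  assume "\<exists>k. t = repair_time \<Phi> r L (Suc k) \<and> \<not> \<Phi> (final_state \<Phi> r (residual \<Phi> r L k))"
  then show "system_failed_at \<Phi> r L t"
    using incseqD[OF incseq_repair_time] unfolding system_failed_at_def
    by (metis le_Suc_eq order_refl state_before_repair)
qed

lemma fail_time_eq:
  "fail_time \<Phi> r L =
    (INF k\<in>{k. \<not> \<Phi> (final_state \<Phi> r (residual \<Phi> r L k))}. ennreal (repair_time \<Phi> r L (Suc k)))"
  unfolding fail_time_def system_failed_at_iff by (rule arg_cong[where f=Inf]) auto

lemma residual_pos: "(\<And>k i. 0 < L k i) \<Longrightarrow> 0 < residual \<Phi> r L k i"
  by (induction k arbitrary: i) (auto simp: renew_def final_state_def state_at_def)

lemma strict_mono_repair_time: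
  assumes "\<And>k i. 0 < L k i"
  shows "strict_mono (repair_time \<Phi> r L)"
  using cycle_length_pos residual_pos[of L, OF assms]
  by (intro strict_mono_Suc_iff[THEN iffD2]) (simp add: repair_time_eq)

section \<open>The transition that ends a cycle\<close>

text \<open>Before \<open>d j\<close> every component that works in \<open>x\<close> still works, so
  the state dominates \<open>x\<close> and no repair is due; at \<open>d j\<close> exactly
  \<open>j\<close> is lost from \<open>x\<close>.\<close>

lemma passes_imp:
  assumes "(x, j) \<in> transitions \<Phi> r" "passes (x, j) d" "0 < d j"
  shows "cycle_length \<Phi> r d = d j" and "final_state \<Phi> r d = x(j := False)"
proof -
  have "state_at d (d j) = x(j := False)"
    using assms(2) by (auto simp: state_at_def passes_def fun_eq_iff split: if_splits)
  moreover have "d j \<le> t" if "due (state_at d t)" for t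
  proof (rule ccontr)
    assume "\<not> d j \<le> t"
    then have "x \<le> state_at d t"
      using assms(1,2) by (auto simp: state_at_def passes_def le_fun_def transitions_def) (smt (verit))
    then show False using that assms(1) due_antimono by (auto simp: transitions_def)
  qed
  ultimately show *: "cycle_length \<Phi> r d = d j"
    using assms(1,3) final_state_due[of d] cycle_length_le_iff[of d "d j"]
    by (intro antisym) (auto simp: transitions_def final_state_def)
  show "final_state \<Phi> r d = x(j := False)"
    unfolding final_state_def * by fact
qed

lemma passes_unique:
  assumes "(x, j) \<in> transitions \<Phi> r" "passes (x, j) d" "(y, k) \<in> transitions \<Phi> r" "passes (y, k) d"
    and "\<And>i. 0 < d i"
  shows "(x, j) = (y, k)"
proof -
  have "d j = d k" using passes_imp(1)[OF assms(1,2)] passes_imp(1)[OF assms(3,4)] assms(5) by simp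
  \<comment> \<open>\<open>passes\<close> compares every other component strictly with
    \<open>d j\<close>, so a tie forces equal indices.\<close>
  then have [simp]: "k = j" using assms(2) by (auto simp: passes_def split: if_splits)
  have "x i = y i" for i
  proof (cases "i = j")
    case False
    then have "x i \<longleftrightarrow> d j < d i" "y i \<longleftrightarrow> d j < d i"
      using assms(2,4) unfolding passes_def by (auto dest!: spec[of _ i] split: if_splits)
    then show ?thesis by simp
  qed (use assms(1,3) in \<open>auto simp: transitions_def\<close>)
  then show ?thesis by auto
qed

lemma passes_ex:
  assumes pos: "\<And>i. 0 < d i" and inj: "inj d"
  shows "\<exists>p\<in>transitions \<Phi> r. passes p d"
proof -
  define u where "u = cycle_length \<Phi> r d"
  have u: "0 < u" unfolding u_def using pos by (rule cycle_length_pos)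
  \<comment> \<open>\<open>x\<close> is the left limit of the state at the cycle end
    \<open>u\<close>: a component ending exactly at \<open>u\<close> still counts as
    working.\<close>
  define x where "x = (\<lambda>i. u \<le> d i)"
  \<comment> \<open>\<open>v\<close> is the last failure strictly before \<open>u\<close>, or 0; the
    state at \<open>v\<close> is already \<open>x\<close>, and \<open>v < u\<close> shows that
    \<open>x\<close> is not due.\<close>
  define v where "v = Max (insert 0 (d ` {i. d i < u}))"
  have v: "0 \<le> v" "v < u" "\<And>i. d i < u \<Longrightarrow> d i \<le> v" using u by (auto simp: v_def)
  have "state_at d v = x"
    using v by (auto simp: state_at_def x_def fun_eq_iff not_le not_less)
      (meson leD leI le_less_trans)+
  then have ndue: "\<not> due x"
    using v cycle_length_le_iff[of d v] by (auto simp: u_def not_le)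
  have due: "due (state_at d u)"
    using final_state_due[of d] by (simp add: final_state_def u_def)
  have "\<exists>j. d j = u"
  proof (rule ccontr)
    assume "\<not> (\<exists>j. d j = u)"
    then have "state_at d u = x" by (auto simp: state_at_def x_def fun_eq_iff order_le_less)
    then show False using due ndue by simp
  qed
  then obtain j where j: "d j = u" by auto
  have ne: "d i \<noteq> u" if "i \<noteq> j" for i using inj j that by (auto dest: injD)
  have "x(j := False) = state_at d u"
    using ne by (force simp: state_at_def x_def fun_eq_iff order_le_less j)
  then have "(x, j) \<in> transitions \<Phi> r"
    using due ndue j by (auto simp: transitions_def x_def)
  moreover have "passes (x, j) d"
    using ne by (force simp: passes_def x_def order_le_less j)
  ultimately show ?thesis by blast
qed

lemma finite_transitions[simp]: "finite (transitions \<Phi> r)"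
  by (rule finite_subset[OF subset_UNIV]) simp

text \<open>The indicators of the events \<open>passes p\<close> form a partition of unity for
  distinct positive lifetimes; this is how a quantity of the cycle is split into summands that
  factorize.\<close>

lemma sum_over_transitions:
  fixes f :: "('c \<Rightarrow> bool) \<times> 'c \<Rightarrow> 'b::comm_semiring_1"
  assumes pos: "\<And>i. 0 < d i" and inj: "inj d"
    and c: "\<And>x j. (x, j) \<in> transitions \<Phi> r \<Longrightarrow> passes (x, j) d \<Longrightarrow> f (x, j) = c"
  shows "(\<Sum>p\<in>transitions \<Phi> r. of_bool (passes p d) * f p) = c"
proof -
  obtain x j where p: "(x, j) \<in> transitions \<Phi> r" "passes (x, j) d"
    using passes_ex[OF pos inj] by auto
  have other: "\<not> passes q d" if "q \<in> transitions \<Phi> r" "q \<noteq> (x, j)" for q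
  proof
    obtain y k where q: "q = (y, k)" by (cases q)
    assume "passes q d"
    then show False using passes_unique[OF p _ _ pos, of y k] that unfolding q by blast
  qed
  have "(\<Sum>q\<in>transitions \<Phi> r. of_bool (passes q d) * f q) =
      (\<Sum>q\<in>transitions \<Phi> r. if q = (x, j) then f q else 0)"
    by (rule sum.cong) (use p(2) other in auto)
  also have "\<dots> = f (x, j)" by (simp only: sum.delta finite_transitions p(1) if_True)
  also have "\<dots> = c" by (rule c[OF p])
  finally show ?thesis .
qed

section \<open>The cycles up to the first system failure\<close>

text \<open>The comparison is strict: cycle \<open>k\<close> itself may end in failure. So this is
  the event that cycle \<open>k\<close> counts up to the failure time, and it depends only on cycles
  earlier than \<open>k\<close>.\<close>

definition before_failure :: "(nat \<Rightarrow> 'c \<Rightarrow> real) \<Rightarrow> nat \<Rightarrow> bool" where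
  "before_failure L k \<longleftrightarrow> (\<forall>j<k. \<Phi> (final_state \<Phi> r (residual \<Phi> r L j)))"

context
  fixes L :: "nat \<Rightarrow> 'c \<Rightarrow> real"
  assumes L_pos: "\<And>k i. 0 < L k i"
begin

text \<open>The first failing cycle has index \<open>K\<close> and ends with repair number
  \<open>Suc K\<close>, which explains both the successor and the non-strict bound.\<close>

lemma fail_time_Least:
  assumes ex: "\<exists>k. \<not> \<Phi> (final_state \<Phi> r (residual \<Phi> r L k))"
  defines "K \<equiv> LEAST k. \<not> \<Phi> (final_state \<Phi> r (residual \<Phi> r L k))"
  shows "fail_time \<Phi> r L = ennreal (repair_time \<Phi> r L (Suc K))"
    and "before_failure L k \<longleftrightarrow> k \<le> K"
proof -
  have K: "\<not> \<Phi> (final_state \<Phi> r (residual \<Phi> r L K))" unfolding K_def using LeastI_ex[OF ex] .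
  have le: "K \<le> k" if "\<not> \<Phi> (final_state \<Phi> r (residual \<Phi> r L k))" for k
    unfolding K_def using that by (rule Least_le)
  show "fail_time \<Phi> r L = ennreal (repair_time \<Phi> r L (Suc K))"
    unfolding fail_time_eq
    using K le incseqD[OF incseq_repair_time]
    by (intro antisym INF_lower INF_greatest ennreal_leI) auto
  show "before_failure L k \<longleftrightarrow> k \<le> K"
    unfolding before_failure_def using K le by (meson leI less_le_trans not_le)
qed

text \<open>Strictly increasing repair times exclude that a later failing repair falls on the first
  one; without any failure the right-hand time is infinite.\<close>

lemma first_repair_eq_fail_time_iff:
  "ennreal (first_repair_time \<Phi> r L) = fail_time \<Phi> r L \<longleftrightarrow> \<not> \<Phi> (final_state \<Phi> r (L 0))"
proof (cases "\<exists>k. \<not> \<Phi> (final_state \<Phi> r (residual \<Phi> r L k))")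
  case True
  define K where "K = (LEAST k. \<not> \<Phi> (final_state \<Phi> r (residual \<Phi> r L k)))"
  have "ennreal (first_repair_time \<Phi> r L) = fail_time \<Phi> r L \<longleftrightarrow>
      repair_time \<Phi> r L 1 = repair_time \<Phi> r L (Suc K)"
    using fail_time_Least(1)[OF True] by (simp add: K_def first_repair_time_def repair_time_nonneg)
  also have "\<dots> \<longleftrightarrow> K = 0"
    using strict_mono_eq[OF strict_mono_repair_time[of L, OF L_pos]] by simp
  also have "\<dots> \<longleftrightarrow> \<not> \<Phi> (final_state \<Phi> r (L 0))"
    using fail_time_Least(2)[OF True, of 1] by (auto simp: K_def before_failure_def)
  finally show ?thesis .
next
  case False
  then have "fail_time \<Phi> r L = \<infinity>" by (simp add: fail_time_eq)
  moreover have "\<Phi> (final_state \<Phi> r (L 0))" using False by (metis residual.simps(1))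
  ultimately show ?thesis by simp
qed

text \<open>Strictness of the repair times makes the repairs up to the \<open>m\<close>-th one
  exactly \<open>m\<close> in number.\<close>

lemma total_cost_repair_time:
  "total_cost \<Phi> r c_cmp c_sys L (ennreal (repair_time \<Phi> r L m)) =
    (\<Sum>k<m. repair_cost \<Phi> c_cmp c_sys (final_state \<Phi> r (residual \<Phi> r L k)))"
proof -
  have "{k. ennreal (repair_time \<Phi> r L (Suc k)) \<le> ennreal (repair_time \<Phi> r L m)} = {..<m}"
    using strict_mono_less_eq[OF strict_mono_repair_time[of L, OF L_pos]]
    by (auto simp: repair_time_nonneg ennreal_le_iff Suc_le_eq)
  then show ?thesis by (simp add: total_cost_def state_before_repair)
qed

lemma total_cost_first_repair:
  "total_cost \<Phi> r c_cmp c_sys L (ennreal (first_repair_time \<Phi> r L)) =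
    repair_cost \<Phi> c_cmp c_sys (final_state \<Phi> r (L 0))"
  unfolding first_repair_time_def total_cost_repair_time by simp

text \<open>The random number of summands is traded for indicators in an infinite series, the form
  in which expectations can be taken termwise. Only finitely many terms are nonzero, whence absolute
  summability.\<close>

lemma total_cost_fail_time:
  fixes c_cmp c_sys
  assumes ex: "\<exists>k. \<not> \<Phi> (final_state \<Phi> r (residual \<Phi> r L k))"
  defines "f \<equiv> \<lambda>k. of_bool (before_failure L k) *
      repair_cost \<Phi> c_cmp c_sys (final_state \<Phi> r (residual \<Phi> r L k))"
  shows "total_cost \<Phi> r c_cmp c_sys L (fail_time \<Phi> r L) = (\<Sum>k. f k)"
    and "summable (\<lambda>k. norm (f k))"
proof -
  define K where "K = (LEAST k. \<not> \<Phi> (final_state \<Phi> r (residual \<Phi> r L k)))"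
  note K = fail_time_Least[OF ex, folded K_def]
  have f0: "f k = 0" if "k \<notin> {..<Suc K}" for k using that by (simp add: f_def K(2))
  have "(\<Sum>k. f k) = (\<Sum>k<Suc K. f k)"
    using f0 by (intro suminf_finite) auto
  then show "total_cost \<Phi> r c_cmp c_sys L (fail_time \<Phi> r L) = (\<Sum>k. f k)"
    unfolding K(1) total_cost_repair_time by (simp add: f_def K(2) lessThan_Suc_atMost)
  show "summable (\<lambda>k. norm (f k))"
    using f0 by (intro summable_finite[of "{..<Suc K}"]) auto
qed

text \<open>The nonnegative counterpart in \<open>ennreal\<close>, suited to monotone
  convergence.\<close>

lemma fail_time_suminf:
  assumes ex: "\<exists>k. \<not> \<Phi> (final_state \<Phi> r (residual \<Phi> r L k))"
  shows "fail_time \<Phi> r L =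
    (\<Sum>k. of_bool (before_failure L k) * ennreal (cycle_length \<Phi> r (residual \<Phi> r L k)))"
proof -
  define K where "K = (LEAST k. \<not> \<Phi> (final_state \<Phi> r (residual \<Phi> r L k)))"
  note K = fail_time_Least[OF ex, folded K_def]
  have "(\<Sum>k. of_bool (before_failure L k) * ennreal (cycle_length \<Phi> r (residual \<Phi> r L k))) =
      (\<Sum>k<Suc K. of_bool (before_failure L k) * ennreal (cycle_length \<Phi> r (residual \<Phi> r L k)))"
    by (intro suminf_finite) (auto simp: K(2))
  also have "\<dots> = fail_time \<Phi> r L"
    unfolding K(1) repair_time_eq
    by (subst sum_ennreal[symmetric]) (auto simp: cycle_length_nonneg K(2) lessThan_Suc_atMost intro!: sum.cong)
  finally show ?thesis by simp
qed

end

end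

section \<open>The signature and counts of transitions\<close>

text \<open>
  \<open>occupancy n a / \<mu>\<close> is the expected time that \<open>n\<close> unrepaired components spend in a given state
  with \<open>a\<close> failed components.
\<close>

definition occupancy :: "nat \<Rightarrow> nat \<Rightarrow> real" where
  "occupancy n a = 1 / (real (n - a) * real (n choose a))"

lemma num_failed_le: "num_failed (x :: 'c::finite \<Rightarrow> bool) \<le> CARD('c)"
  unfolding num_failed_def by (rule card_mono) auto

lemma card_working: "card {j. x j} = CARD('c) - num_failed (x :: 'c::finite \<Rightarrow> bool)"
proof -
  have "{j. x j} = UNIV - {j. \<not> x j}" by auto
  then show ?thesis by (simp add: card_Diff_subset num_failed_def)
qed

lemma num_failed_less:
  assumes "x j"
  shows "num_failed (x :: 'c::finite \<Rightarrow> bool) < CARD('c)"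
proof -
  have "0 < card {j. x j}" using assms by (subst card_gt_0_iff) auto
  then show ?thesis by (simp only: card_working zero_less_diff)
qed

lemma num_failed_upd: "x j \<Longrightarrow> num_failed (x(j := False)) = Suc (num_failed x)"
proof -
  assume "x j"
  then have "{i. \<not> (x(j := False)) i} = insert j {i. \<not> x i}" by auto
  then show ?thesis using \<open>x j\<close> by (simp add: num_failed_def)
qed

lemma S_bar_eq:
  assumes "k \<le> CARD('c)"
  shows "S_bar \<Phi> k = real (card {x :: 'c::finite \<Rightarrow> bool. num_failed x = k \<and> \<Phi> x}) / real (CARD('c) choose k)"
proof -
  have "num_working x = CARD('c) - num_failed x" for x :: "'c \<Rightarrow> bool"
    unfolding num_working_def card_working[symmetric] by (simp add: sum.If_cases of_bool_def)
  then have "num_working x = CARD('c) - k \<longleftrightarrow> num_failed x = k" for x :: "'c \<Rightarrow> bool"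
    using num_failed_le[of x] assms by auto
  then have "(\<Sum>x | num_working x = CARD('c) - k. of_bool (\<Phi> x)) = real (card {x :: 'c \<Rightarrow> bool. num_failed x = k \<and> \<Phi> x})"
    by (simp add: of_bool_def sum.If_cases Collect_conj_eq)
  then show ?thesis using binomial_symmetric[OF assms] by (simp add: S_bar_def)
qed

text \<open>Both sides are the probability that \<open>n\<close> unrepaired components pass through
  a given state with \<open>Suc a\<close> failures: it has \<open>Suc a\<close> predecessors, and
  all sets of that size are equally likely.\<close>

lemma occupancy_Suc:
  assumes "a < n"
  shows "occupancy n a * real (Suc a) = 1 / real (n choose Suc a)"
proof -
  have "Suc a * (n choose Suc a) = (n - a) * (n choose a)"
    using binomial_absorb_comp[of n a] binomial_absorption[of a n] by simp
  then have "real (Suc a) * real (n choose Suc a) = real (n - a) * real (n choose a)"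
    by (metis of_nat_mult)
  moreover have "n choose Suc a > 0" "n choose a > 0" using assms by auto
  ultimately show ?thesis using assms by (simp add: occupancy_def field_simps)
qed

context repair_policy
begin

definition working_states :: "nat \<Rightarrow> ('c \<Rightarrow> bool) set" where
  "working_states a = {x. num_failed x = a \<and> \<Phi> x}"

lemma occupancy_working_states:
  assumes "a < CARD('c)"
  shows "occupancy CARD('c) a * real (card (working_states a)) = S_bar \<Phi> a / real (CARD('c) - a)"
  unfolding occupancy_def S_bar_eq[OF less_imp_le[OF assms]] working_states_def by simp

lemma sum_not_due: "(\<Sum>x | \<not> due x. f (num_failed x)) = (\<Sum>a<r. real (card (working_states a)) * f a)"
proof -
  have "{x. \<not> due x} = (\<Union>a<r. working_states a)" by (auto simp: repair_due_def working_states_def)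
  then have "(\<Sum>x | \<not> due x. f (num_failed x)) = (\<Sum>a<r. \<Sum>x\<in>working_states a. f (num_failed x))"
    by (simp only:) (rule sum.UNION_disjoint, auto simp: working_states_def)
  also have "\<dots> = (\<Sum>a<r. real (card (working_states a)) * f a)"
    by (rule sum.cong) (simp_all add: working_states_def)
  finally show ?thesis .
qed

definition failing :: "nat \<Rightarrow> (('c \<Rightarrow> bool) \<times> 'c) set" where
  "failing a = {(x, j). x j \<and> num_failed x = a \<and> \<Phi> x \<and> \<not> \<Phi> (x(j := False))}"

text \<open>Only the target is required to work; monotonicity then makes the source a working state,
  and counting by targets becomes possible.\<close>

definition surviving :: "nat \<Rightarrow> (('c \<Rightarrow> bool) \<times> 'c) set" where
  "surviving a = {(x, j). x j \<and> num_failed x = a \<and> \<Phi> (x(j := False))}"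

lemma structure_upd: "\<Phi> (x(j := False)) \<Longrightarrow> \<Phi> x"
  by (rule structure_mono[of "x(j := False)"]) (auto simp: le_fun_def)

lemma num_failed_upd_True: "\<not> y j \<Longrightarrow> num_failed y = Suc (num_failed (y(j := True)))" for y :: "'c \<Rightarrow> bool"
proof -
  assume "\<not> y j"
  then have "y(j := False) = y" by (simp add: fun_eq_iff)
  then show ?thesis using num_failed_upd[of "y(j := True)" j] by simp
qed

text \<open>Counted from the target: it is a working state with \<open>Suc a\<close> failed
  components, any of which may have been the last to fail.\<close>

lemma card_surviving: "card (surviving a) = Suc a * card (working_states (Suc a))"
proof -
  have "bij_betw (\<lambda>(x, j). (x(j := False), j)) (surviving a) (SIGMA y : working_states (Suc a). {j. \<not> y j})"
    by (rule bij_betw_byWitness[where f' = "\<lambda>(y, j). (y(j := True), j)"])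
      (auto simp: surviving_def working_states_def num_failed_upd num_failed_upd_True fun_upd_idem)
  then have "card (surviving a) = (\<Sum>y\<in>working_states (Suc a). card {j. \<not> y j})"
    by (simp add: bij_betw_same_card)
  also have "\<dots> = (\<Sum>y\<in>working_states (Suc a). Suc a)"
    by (rule sum.cong) (simp_all add: working_states_def num_failed_def)
  finally show ?thesis by simp
qed

text \<open>Counted from the source: each of its \<open>CARD('c) - a\<close> working components may
  fail next.\<close>

lemma card_failing_surviving: "card (failing a) + card (surviving a) = (CARD('c) - a) * card (working_states a)"
proof -
  have "failing a \<union> surviving a = (SIGMA x : working_states a. {j. x j})"
    by (auto simp: failing_def surviving_def working_states_def dest: structure_upd)
  moreover have "failing a \<inter> surviving a = {}" by (auto simp: failing_def surviving_def)
  moreover have "finite (failing a)" "finite (surviving a)"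
    by (auto intro: finite_subset[OF subset_UNIV])
  ultimately have "card (failing a) + card (surviving a) = (\<Sum>x\<in>working_states a. card {j. x j})"
    by (simp add: card_Un_disjoint[symmetric])
  also have "\<dots> = (\<Sum>x\<in>working_states a. CARD('c) - a)"
    by (rule sum.cong) (simp_all add: working_states_def card_working)
  finally show ?thesis by simp
qed

text \<open>Without repairs, \<open>S_bar\<close> is the probability that the system survives the
  first \<open>Suc a\<close> component failures, all sets of failed components being equally
  likely.\<close>

lemma occupancy_surviving:
  assumes "a < CARD('c)"
  shows "occupancy CARD('c) a * real (card (surviving a)) = S_bar \<Phi> (Suc a)"
proof -
  have "occupancy CARD('c) a * real (card (surviving a)) =
      occupancy CARD('c) a * real (Suc a) * real (card (working_states (Suc a)))"
    by (simp only: card_surviving of_nat_mult mult.assoc)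
  also have "\<dots> = S_bar \<Phi> (Suc a)"
    unfolding occupancy_Suc[OF assms] using assms by (simp add: S_bar_eq working_states_def)
  finally show ?thesis .
qed

text \<open>The probabilistic meaning of the signature: component failure number
  \<open>Suc a\<close> is the one that stops the system. Its probability is the difference between
  surviving \<open>a\<close> and \<open>Suc a\<close> failures.\<close>

lemma occupancy_failing:
  assumes "a < CARD('c)"
  shows "occupancy CARD('c) a * real (card (failing a)) = struct_signature \<Phi> (Suc a)"
proof -
  have "real (card (failing a) + card (surviving a)) = real (CARD('c) - a) * real (card (working_states a))"
    unfolding card_failing_surviving by (rule of_nat_mult)
  then have *: "real (card (failing a)) = real (CARD('c) - a) * real (card (working_states a)) - real (card (surviving a))"
    by simp
  have "occupancy CARD('c) a * real (card (failing a)) =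
      real (CARD('c) - a) * (occupancy CARD('c) a * real (card (working_states a))) - occupancy CARD('c) a * real (card (surviving a))"
    by (simp only: * right_diff_distrib mult.left_commute)
  then show ?thesis
    using assms by (simp add: occupancy_working_states occupancy_surviving struct_signature_def)
qed

lemma S_bar_n: "S_bar \<Phi> CARD('c) = 0"
proof -
  have "\<not> \<Phi> x" if "num_failed x = CARD('c)" for x
  proof -
    have "card {j. x j} = 0" using card_working[of x] that by simp
    then have "x = (\<lambda>_. False)" by auto
    then show ?thesis using coherent by (simp add: semi_coherent_def)
  qed
  then have "{x. num_failed x = CARD('c) \<and> \<Phi> x} = {}" by auto
  then show ?thesis by (simp add: S_bar_eq)
qed

text \<open>The sum telescopes, and the last \<open>S_bar\<close> vanishes because the system is
  down when all components are.\<close>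

lemma sum_signature_tail: "(\<Sum>k=r+1..CARD('c). struct_signature \<Phi> k) = S_bar \<Phi> r"
proof -
  have "(\<Sum>k=r+1..CARD('c). struct_signature \<Phi> k) = (\<Sum>k=r..<CARD('c). S_bar \<Phi> k - S_bar \<Phi> (Suc k))"
    by (simp add: struct_signature_def atLeastLessThanSuc_atLeastAtMost[symmetric] sum.shift_bounds_Suc_ivl del: sum.op_ivl_Suc)
  also have "\<dots> = S_bar \<Phi> r - S_bar \<Phi> CARD('c)"
    using sum_Suc_diff'[OF r_le_n, of "\<lambda>k. - S_bar \<Phi> k"] by simp
  finally show ?thesis by (simp add: S_bar_n)
qed

lemma sum_transitions:
  "(\<Sum>(x, j)\<in>transitions \<Phi> r. repair_cost \<Phi> c_cmp c_sys (x(j := False)) * occupancy CARD('c) (num_failed x)) =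
    (\<Sum>k=1..r. struct_signature \<Phi> k * (c_sys + c_cmp k)) + (\<Sum>k=r+1..CARD('c). struct_signature \<Phi> k) * c_cmp r"
proof -
  define f where "f = (\<lambda>(x, j::'c). repair_cost \<Phi> c_cmp c_sys (x(j := False)) * occupancy CARD('c) (num_failed x))"
  have fin: "finite A" for A :: "(('c \<Rightarrow> bool) \<times> 'c) set" by (rule finite_subset[OF subset_UNIV]) simp
  \<comment> \<open>A cycle ends with a system failure at any of the first \<open>r\<close>
    component failures, or with a preventive repair at the \<open>r\<close>-th one.\<close>
  have "transitions \<Phi> r = (\<Union>a<r. failing a) \<union> surviving (r - 1)"
    using r_ge_1 by (auto simp: transitions_def failing_def surviving_def repair_due_def num_failed_upd dest: structure_upd)
  moreover have "(\<Union>a<r. failing a) \<inter> surviving (r - 1) = {}"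
    by (auto simp: failing_def surviving_def)
  ultimately have "sum f (transitions \<Phi> r) = sum f (\<Union>a<r. failing a) + sum f (surviving (r - 1))"
    by (simp add: sum.union_disjoint fin)
  also have "sum f (\<Union>a<r. failing a) = (\<Sum>a<r. sum f (failing a))"
    by (rule sum.UNION_disjoint) (auto simp: fin failing_def)
  also have "\<dots> = (\<Sum>a<r. struct_signature \<Phi> (Suc a) * (c_sys + c_cmp (Suc a)))"
  proof (rule sum.cong[OF refl])
    fix a assume a: "a \<in> {..<r}"
    have "sum f (failing a) = (\<Sum>p\<in>failing a. occupancy CARD('c) a * (c_sys + c_cmp (Suc a)))"
      by (rule sum.cong) (auto simp: f_def failing_def repair_cost_def num_failed_upd)
    also have "\<dots> = occupancy CARD('c) a * real (card (failing a)) * (c_sys + c_cmp (Suc a))" by simp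
    finally show "sum f (failing a) = struct_signature \<Phi> (Suc a) * (c_sys + c_cmp (Suc a))"
      using a r_le_n by (simp add: occupancy_failing)
  qed
  also have "\<dots> = (\<Sum>k=1..r. struct_signature \<Phi> k * (c_sys + c_cmp k))"
    by (simp add: sum.atLeast1_atMost_eq lessThan_Suc_atMost)
  also have "sum f (surviving (r - 1)) = (\<Sum>p\<in>surviving (r - 1). occupancy CARD('c) (r - 1) * c_cmp r)"
    using r_ge_1 by (intro sum.cong) (auto simp: f_def surviving_def repair_cost_def num_failed_upd)
  also have "\<dots> = occupancy CARD('c) (r - 1) * real (card (surviving (r - 1))) * c_cmp r" by simp
  also have "\<dots> = S_bar \<Phi> r * c_cmp r"
    using r_ge_1 r_le_n by (simp add: occupancy_surviving)
  finally show ?thesis unfolding f_def sum_signature_tail .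
qed

text \<open>Summation by parts. The summand on the left is \<open>\<mu>\<close> times the mean time
  from the \<open>a\<close>-th to the next component failure, restricted to survival so far;
  \<open>H k\<close> below is \<open>\<mu>\<close> times the mean of the \<open>k\<close>-th
  smallest of all the exponential lifetimes.\<close>

lemma sum_S_bar:
  "(\<Sum>a<r. S_bar \<Phi> a / real (CARD('c) - a)) =
    (\<Sum>k=1..r. struct_signature \<Phi> k * (\<Sum>i=CARD('c)-k+1..CARD('c). 1 / real i))
    + (\<Sum>k=r+1..CARD('c). struct_signature \<Phi> k) * (\<Sum>i=CARD('c)-r+1..CARD('c). 1 / real i)"
proof -
  define H where "H k = (\<Sum>i=CARD('c)-k+1..CARD('c). 1 / real i)" for k
  have H: "H (Suc k) = H k + 1 / real (CARD('c) - k)" if "k < CARD('c)" for k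
  proof -
    have "{CARD('c) - Suc k + 1..CARD('c)} = insert (CARD('c) - k) {CARD('c) - k + 1..CARD('c)}" using that by auto
    then show ?thesis by (simp add: H_def)
  qed
  \<comment> \<open>The boundary term \<open>S_bar \<Phi> m * H m\<close> completes the partial sum;
    for \<open>m = r\<close> it is the contribution of the tail of the signature.\<close>
  have "m \<le> CARD('c) \<Longrightarrow> (\<Sum>k=1..m. struct_signature \<Phi> k * H k) + S_bar \<Phi> m * H m = (\<Sum>a<m. S_bar \<Phi> a / real (CARD('c) - a))" for m
  proof (induction m)
    case 0
    then show ?case by (simp add: H_def)
  next
    case (Suc m)
    then show ?case by (simp add: H struct_signature_def algebra_simps add_divide_distrib)
  qed
  from this[OF r_le_n] show ?thesis unfolding sum_signature_tail H_def by simp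
qed

end

section \<open>One cycle with exponential lifetimes\<close>

text \<open>The limit is the Beta integral B(b, a + 1). Induction on \<open>a\<close> by parts
  trades one power of \<open>1 - exp (- \<mu> * s)\<close> for one more power of
  \<open>exp (- \<mu> * s)\<close>, so \<open>b\<close> has to be general.\<close>

lemma exp_beta_antiderivative:
  fixes \<mu> :: real
  assumes "0 < \<mu>" and "1 \<le> b"
  shows "\<exists>F. (\<forall>s. (F has_real_derivative \<mu> * exp (- \<mu> * s) ^ b * (1 - exp (- \<mu> * s)) ^ a) (at s)) \<and>
    F 0 = 0 \<and> (F \<longlongrightarrow> 1 / (real b * real ((a + b) choose a))) at_top"
  using assms(2)
proof (induction a arbitrary: b)
  have e0: "((\<lambda>s. exp (- \<mu> * s)) \<longlongrightarrow> 0) at_top"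
    using assms(1)
    by (intro filterlim_compose[OF exp_at_bot] filterlim_tendsto_neg_mult_at_bot[OF tendsto_const] filterlim_ident) simp
  {
    case 0
    have "((\<lambda>s. (1 - exp (- \<mu> * s) ^ b) / real b) \<longlongrightarrow> (1 - 0 ^ b) / real b) at_top"
      by (intro tendsto_intros e0) (use 0 in auto)
    moreover have "((\<lambda>s. (1 - exp (- \<mu> * s) ^ b) / real b) has_real_derivative \<mu> * exp (- \<mu> * s) ^ b) (at s)" for s
    proof -
      have "((\<lambda>s. (1 - exp (real b * (- \<mu> * s))) / real b) has_real_derivative \<mu> * exp (real b * (- \<mu> * s))) (at s)"
        using 0 by (auto intro!: derivative_eq_intros)
      then show ?thesis by (simp only: exp_of_nat_mult)
    qed
    ultimately show ?case
      using 0 by (intro exI[of _ "\<lambda>s. (1 - exp (- \<mu> * s) ^ b) / real b"]) (auto simp: power_0_left)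
  next
    case (Suc a)
    define e where "e s = exp (- \<mu> * s)" for s
    have e': "(e has_real_derivative - \<mu> * e s) (at s)" for s
      unfolding e_def[abs_def] by (auto intro!: derivative_eq_intros)
    obtain F where F: "\<And>s. (F has_real_derivative \<mu> * e s ^ Suc b * (1 - e s) ^ a) (at s)"
      "F 0 = 0" "(F \<longlongrightarrow> 1 / (real (Suc b) * real ((a + Suc b) choose a))) at_top"
      using Suc.IH[of "Suc b"] by (auto simp: e_def)
    \<comment> \<open>Integration by parts; the boundary term, the product of the two powers,
      vanishes at 0 and at infinity.\<close>
    define G where "G s = (real (Suc a) * F s - (1 - e s) ^ Suc a * e s ^ b) / real b" for s
    obtain b' where b: "b = Suc b'" using Suc.prems by (cases b) auto
    have "(G has_real_derivative (real (Suc a) * (\<mu> * e s ^ Suc b * (1 - e s) ^ a) -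
        ((real (Suc a) * (1 - e s) ^ a * (\<mu> * e s)) * e s ^ b + (1 - e s) ^ Suc a * (real b * e s ^ b' * (- \<mu> * e s)))) / real b) (at s)" for s
    proof -
      have "((\<lambda>s. (1 - e s) ^ Suc a) has_real_derivative real (Suc a) * ((0 - - \<mu> * e s) * (1 - e s) ^ (Suc a - Suc 0))) (at s)"
        by (intro DERIV_power DERIV_diff DERIV_const e')
      moreover have "((\<lambda>s. e s ^ b) has_real_derivative real b * (- \<mu> * e s * e s ^ (b - Suc 0))) (at s)"
        by (intro DERIV_power e')
      ultimately have "((\<lambda>s. (1 - e s) ^ Suc a * e s ^ b) has_real_derivative
          ((real (Suc a) * (1 - e s) ^ a * (\<mu> * e s)) * e s ^ b + (1 - e s) ^ Suc a * (real b * e s ^ b' * (- \<mu> * e s)))) (at s)"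
        by (rule DERIV_cong[OF DERIV_mult]) (simp add: b algebra_simps)
      then show ?thesis
        unfolding G_def[abs_def] by (intro DERIV_cdivide DERIV_diff DERIV_cmult F(1))
    qed
    also have "(real (Suc a) * (\<mu> * e s ^ Suc b * (1 - e s) ^ a) -
        ((real (Suc a) * (1 - e s) ^ a * (\<mu> * e s)) * e s ^ b + (1 - e s) ^ Suc a * (real b * e s ^ b' * (- \<mu> * e s)))) / real b
        = \<mu> * e s ^ b * (1 - e s) ^ Suc a" for s
      by (simp add: b field_simps)
    finally have "(G has_real_derivative \<mu> * e s ^ b * (1 - e s) ^ Suc a) (at s)" for s .
    moreover have "G 0 = 0" by (simp add: G_def F(2) e_def)
    moreover have "(G \<longlongrightarrow> (real (Suc a) * (1 / (real (Suc b) * real ((a + Suc b) choose a))) - (1 - 0) ^ Suc a * 0 ^ b) / real b) at_top"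
      unfolding G_def[abs_def] by (intro tendsto_intros F(3) e0[folded e_def]) (use Suc.prems in auto)
    moreover have "(real (Suc a) * (1 / (real (Suc b) * real ((a + Suc b) choose a))) - (1 - 0) ^ Suc a * 0 ^ b) / real b
        = 1 / (real b * real ((Suc a + b) choose Suc a))"
    \<comment> \<open>The constants agree because (a + 1) C(a + b + 1, a + 1) = (b + 1) C(a + b + 1,
      a).\<close>
    proof -
      have "Suc a * ((Suc a + b) choose Suc a) = Suc b * ((a + Suc b) choose a)"
        using binomial_absorb_comp[of "Suc a + b" a] binomial_absorption[of a "Suc a + b"] by simp
      then have "real (Suc a) * real ((Suc a + b) choose Suc a) = real (Suc b) * real ((a + Suc b) choose a)"
        by (metis of_nat_mult)
      then have "real (Suc a) * (1 / (real (Suc b) * real ((a + Suc b) choose a))) =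
          real (Suc a) * (1 / (real (Suc a) * real ((Suc a + b) choose Suc a)))"
        by (simp only:)
      also have "\<dots> = 1 / real ((Suc a + b) choose Suc a)"
        by (simp only: times_divide_eq_right mult_1_right) (rule nonzero_divide_mult_cancel_left, simp)
      finally show ?thesis using b by (simp only:) simp
    qed
    ultimately show ?case unfolding e_def by (intro exI[of _ G]) simp
  }
qed

lemma nn_integral_exp_beta:
  fixes \<mu> :: real
  assumes "0 < \<mu>" and "1 \<le> b"
  shows "(\<integral>\<^sup>+s. ennreal (\<mu> * exp (- \<mu> * s) ^ b * (1 - exp (- \<mu> * s)) ^ a) * indicator {0..} s \<partial>lborel) =
    ennreal (1 / (real b * real ((a + b) choose a)))"
proof -
  obtain F where F: "\<And>s. (F has_real_derivative \<mu> * exp (- \<mu> * s) ^ b * (1 - exp (- \<mu> * s)) ^ a) (at s)"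
      "F 0 = 0" "(F \<longlongrightarrow> 1 / (real b * real ((a + b) choose a))) at_top"
    using exp_beta_antiderivative[OF assms] by blast
  have "(\<integral>\<^sup>+s. ennreal (\<mu> * exp (- \<mu> * s) ^ b * (1 - exp (- \<mu> * s)) ^ a) * indicator {0..} s \<partial>lborel) =
     ennreal (1 / (real b * real ((a + b) choose a)) - F 0)"
    using assms(1) by (intro nn_integral_FTC_atLeast F) auto
  then show ?thesis using F(2) by simp
qed

locale exponential_repair = repair_policy \<Phi> r for \<Phi> :: "('c::finite \<Rightarrow> bool) \<Rightarrow> bool" and r +
  fixes \<mu> :: real
  assumes mu_pos: "0 < \<mu>"
begin

section \<open>The exponential law of one lifetime\<close>

definition expo :: "real measure" where
  "expo = density lborel (\<lambda>x. ennreal (exponential_density \<mu> x))"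

definition lifetimes :: "('c \<Rightarrow> real) measure" where
  "lifetimes = PiM UNIV (\<lambda>_. expo)"

lemma sets_expo[measurable_cong, simp]: "sets expo = sets borel"
  and space_expo[simp]: "space expo = UNIV"
  by (auto simp: expo_def)

lemma prob_space_expo: "prob_space expo"
  unfolding expo_def using mu_pos by (rule prob_space_exponential_density)

sublocale expo: prob_space expo by (rule prob_space_expo)

sublocale lifetime_product: product_prob_space "\<lambda>_::'c. expo" UNIV by standard

lemma sets_lifetimes[measurable_cong]: "sets lifetimes = sets (PiM UNIV (\<lambda>_. borel))"
  unfolding lifetimes_def by (intro sets_PiM_cong) auto

lemma space_lifetimes[simp]: "space lifetimes = UNIV"
  by (simp add: lifetimes_def space_PiM)

sublocale lifetimes: prob_space lifetimes
  unfolding lifetimes_def by (rule lifetime_product.prob_space_axioms)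

lemma expo_gt: "0 \<le> s \<Longrightarrow> emeasure expo {y. s < y} = ennreal (exp (- \<mu> * s))"
proof -
  assume s: "0 \<le> s"
  have "distributed expo lborel (\<lambda>x. x) (exponential_density \<mu>)"
    unfolding distributed_def by (auto simp: expo_def[symmetric] distr_id2)
  from expo.exponential_distributedD_gt[OF this s mu_pos] show ?thesis
    by (simp add: expo.emeasure_eq_measure mult.commute)
qed

lemma expo_singleton: "emeasure expo {s} = 0"
proof -
  have "AE x in lborel. x \<noteq> s" by (rule AE_lborel_singleton)
  then show ?thesis
    unfolding expo_def by (subst emeasure_density) (auto simp: nn_integral_0_iff_AE split: split_indicator)
qed

lemma expo_le: "0 \<le> s \<Longrightarrow> emeasure expo {y. y \<le> s} = ennreal (1 - exp (- \<mu> * s))"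
proof -
  assume s: "0 \<le> s"
  have "{y. y \<le> s} = space expo - {y. s < y}" by auto
  also have "emeasure expo \<dots> = 1 - ennreal (exp (- \<mu> * s))"
    by (subst emeasure_compl) (auto simp: expo_gt[OF s] expo.emeasure_space_1[simplified])
  finally show ?thesis by (simp add: ennreal_minus flip: ennreal_1)
qed

lemma expo_lt: "0 \<le> s \<Longrightarrow> emeasure expo {y. y < s} = ennreal (1 - exp (- \<mu> * s))"
proof -
  assume s: "0 \<le> s"
  have "emeasure expo {y. y < s} = emeasure expo ({y. y < s} \<union> {s})"
    by (subst emeasure_Un_null_set) (auto simp: null_sets_def expo_singleton)
  also have "{y. y < s} \<union> {s} = {y. y \<le> s}" by auto
  finally show ?thesis using expo_le[OF s] by simp
qed

lemma AE_expo_pos: "AE x in expo. 0 < x"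
proof -
  have "emeasure expo {y. 0 < y} = 1" using expo_gt[of 0] by simp
  then have "AE x in expo. x \<in> {y. 0 < y}"
    by (intro expo.AE_prob_1) (simp add: expo.emeasure_eq_measure)
  then show ?thesis by simp
qed

text \<open>Joint form of memorylessness: survival beyond \<open>s\<close> and the law of the
  residual lifetime factor together. Substituting y = s + z splits the density.\<close>

lemma expo_memoryless:
  assumes s: "0 \<le> s" and [measurable]: "B \<in> sets borel"
  shows "emeasure expo {y. s < y \<and> y - s \<in> B} = ennreal (exp (- \<mu> * s)) * emeasure expo B"
proof -
  have "emeasure expo {y. s < y \<and> y - s \<in> B} =
      (\<integral>\<^sup>+y. ennreal (exponential_density \<mu> y) * indicator {y. s < y \<and> y - s \<in> B} y \<partial>lborel)"
    unfolding expo_def by (rule emeasure_density) measurable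
  also have "\<dots> = (\<integral>\<^sup>+z. ennreal (exponential_density \<mu> (s + z)) * indicator {y. s < y \<and> y - s \<in> B} (s + z) \<partial>lborel)"
    by (subst nn_integral_real_affine[where c=1 and t=s]) auto
  also have "\<dots> = (\<integral>\<^sup>+z. ennreal (exp (- \<mu> * s)) * (ennreal (exponential_density \<mu> z) * indicator B z) \<partial>lborel)"
  \<comment> \<open>At \<open>z = 0\<close> the strict comparison on the left fails although the
    density on the right is positive; this null set is set aside.\<close>
  proof (rule nn_integral_cong_AE, use AE_lborel_singleton[of 0] in eventually_elim)
    case (elim z)
    then show ?case
      using s mu_pos
      by (auto simp: exponential_density_def indicator_def ennreal_mult[symmetric] exp_add[symmetric] algebra_simps
          simp del: ennreal_mult)
  qed
  also have "\<dots> = ennreal (exp (- \<mu> * s)) * emeasure expo B"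
    unfolding expo_def by (subst emeasure_density) (auto intro!: nn_integral_cmult)
  finally show ?thesis .
qed

section \<open>The joint law of the lifetimes in one row\<close>

lemma AE_lifetimes_pos: "AE d in lifetimes. \<forall>i. 0 < d i"
proof -
  have "AE d in lifetimes. 0 < d i" for i
    unfolding lifetimes_def by (rule AE_PiM_component) (auto simp: prob_space_expo AE_expo_pos)
  then show ?thesis by (simp add: AE_all_countable)
qed

text \<open>Fubini with component \<open>j\<close> integrated last: for a fixed value of its
  lifetime the remaining factors are independent.\<close>

lemma nn_integral_lifetimes_pivot:
  fixes g :: "real \<Rightarrow> ennreal" and f :: "'c \<Rightarrow> real \<Rightarrow> real \<Rightarrow> ennreal"
  assumes [measurable]: "g \<in> borel_measurable borel"
    and f[measurable]: "\<And>i. (\<lambda>(s, y). f i s y) \<in> borel_measurable (borel \<Otimes>\<^sub>M borel)"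
  shows "(\<integral>\<^sup>+d. g (d j) * (\<Prod>i\<in>UNIV - {j}. f i (d j) (d i)) \<partial>lifetimes) =
    (\<integral>\<^sup>+s. g s * (\<Prod>i\<in>UNIV - {j}. \<integral>\<^sup>+y. f i s y \<partial>expo) \<partial>expo)"
proof -
  have UNIV: "(UNIV :: 'c set) = insert j (UNIV - {j})" by auto
  have [measurable]: "(\<lambda>y. f i s y) \<in> borel_measurable borel" for i s
    using measurable_compose[OF measurable_Pair1' f[of i]] by simp
  have "(\<integral>\<^sup>+d. g (d j) * (\<Prod>i\<in>UNIV - {j}. f i (d j) (d i)) \<partial>lifetimes) =
     (\<integral>\<^sup>+d. g (d j) * (\<Prod>i\<in>UNIV - {j}. f i (d j) (d i)) \<partial>PiM (insert j (UNIV - {j})) (\<lambda>_. expo))"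
    unfolding lifetimes_def UNIV[symmetric] ..
  also have "\<dots> = (\<integral>\<^sup>+s. \<integral>\<^sup>+d. g ((d(j := s)) j) * (\<Prod>i\<in>UNIV - {j}. f i ((d(j := s)) j) ((d(j := s)) i))
       \<partial>PiM (UNIV - {j}) (\<lambda>_. expo) \<partial>expo)"
    by (rule lifetime_product.product_nn_integral_insert_rev) (auto, measurable)
  also have "\<dots> = (\<integral>\<^sup>+s. \<integral>\<^sup>+d. g s * (\<Prod>i\<in>UNIV - {j}. f i s (d i)) \<partial>PiM (UNIV - {j}) (\<lambda>_. expo) \<partial>expo)"
    by (intro nn_integral_cong arg_cong2[where f="(*)"] prod.cong) auto
  also have "\<dots> = (\<integral>\<^sup>+s. g s * (\<integral>\<^sup>+d. (\<Prod>i\<in>UNIV - {j}. f i s (d i)) \<partial>PiM (UNIV - {j}) (\<lambda>_. expo)) \<partial>expo)"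
    by (intro nn_integral_cong nn_integral_cmult) measurable
  also have "\<dots> = (\<integral>\<^sup>+s. g s * (\<Prod>i\<in>UNIV - {j}. \<integral>\<^sup>+y. f i s y \<partial>expo) \<partial>expo)"
    by (subst lifetime_product.product_nn_integral_prod) auto
  finally show ?thesis .
qed

lemma AE_lifetimes_inj: "AE d in lifetimes. inj d"
proof -
  have "AE d in lifetimes. d i \<noteq> d j" if "i \<noteq> j" for i j
  proof -
    have "{d \<in> space lifetimes. d i = d j} \<in> sets lifetimes" by measurable
    then have [measurable]: "{d. d i = d j} \<in> sets lifetimes" by simp
    \<comment> \<open>All factors but that of \<open>i\<close> are 1, so the product is the
      indicator of a tie, and the inner integral is the mass of one point.\<close>
    define f :: "'c \<Rightarrow> real \<Rightarrow> real \<Rightarrow> ennreal"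
      where "f = (\<lambda>k s y. if k = i then (if y = s then 1 else 0) else 1)"
    have f: "(\<lambda>(s, y). f k s y) \<in> borel_measurable (borel \<Otimes>\<^sub>M borel)" for k
      unfolding f_def case_prod_beta' by (cases "k = i"; simp)
    have "emeasure lifetimes {d. d i = d j} = (\<integral>\<^sup>+d. indicator {d. d i = d j} d \<partial>lifetimes)"
      by (rule nn_integral_indicator[symmetric]) measurable
    also have "\<dots> = (\<integral>\<^sup>+d. 1 * (\<Prod>k\<in>UNIV - {j}. f k (d j) (d k)) \<partial>lifetimes)"
      using that by (intro nn_integral_cong) (simp add: prod.delta indicator_def f_def)
    also have "\<dots> = (\<integral>\<^sup>+s. 1 * (\<Prod>k\<in>UNIV - {j}. \<integral>\<^sup>+y. f k s y \<partial>expo) \<partial>expo)"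
      by (rule nn_integral_lifetimes_pivot) (simp_all add: f)
    also have "\<dots> = (\<integral>\<^sup>+s. 0 \<partial>expo)"
    proof (intro nn_integral_cong)
      fix s
      have "(\<integral>\<^sup>+y. f i s y \<partial>expo) = (\<integral>\<^sup>+y. indicator {s} y \<partial>expo)"
        by (intro nn_integral_cong) (simp add: f_def)
      then have "(\<integral>\<^sup>+y. f i s y \<partial>expo) = 0" by (simp add: expo_singleton)
      then show "1 * (\<Prod>k\<in>UNIV - {j}. \<integral>\<^sup>+y. f k s y \<partial>expo) = 0"
        using that by (auto intro!: prod_zero bexI[of _ i])
    qed
    finally have "emeasure lifetimes {d. d i = d j} = 0" by simp
    then show ?thesis by (intro AE_I[of _ _ "{d. d i = d j}"]) auto
  qed
  then have "AE d in lifetimes. \<forall>i j. i \<noteq> j \<longrightarrow> d i \<noteq> d j"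
    by (simp add: AE_all_countable)
  then show ?thesis by eventually_elim (auto simp: inj_def)
qed

section \<open>Measurability of the data of a cycle\<close>

lemma measurable_state_at[measurable (raw)]:
  assumes [measurable]: "g \<in> measurable N (PiM UNIV (\<lambda>_::'c. borel))" "f \<in> borel_measurable N"
  shows "(\<lambda>x. state_at (g x) (f x :: real)) \<in> measurable N (count_space UNIV)"
proof (rule measurable_count_space_eq2[THEN iffD2, OF finite_class.finite_UNIV], intro conjI ballI)
  fix y :: "'c \<Rightarrow> bool"
  have "(\<lambda>x. state_at (g x) (f x)) -` {y} \<inter> space N = {x \<in> space N. \<forall>i. (f x < g x i) = y i}"
    by (auto simp: state_at_def fun_eq_iff)
  also have "\<dots> \<in> sets N" by measurable
  finally show "(\<lambda>x. state_at (g x) (f x)) -` {y} \<inter> space N \<in> sets N" .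
qed auto

lemma measurable_cycle_length[measurable]:
  "cycle_length \<Phi> r \<in> borel_measurable (PiM UNIV (\<lambda>_. borel))"
proof (rule borel_measurable_iff_le[THEN iffD2], safe)
  fix a
  show "{d \<in> space (PiM UNIV (\<lambda>_. borel)). cycle_length \<Phi> r d \<le> a} \<in> sets (PiM UNIV (\<lambda>_. borel))"
    unfolding cycle_length_le_iff by measurable
qed

lemma measurable_final_state[measurable]:
  "final_state \<Phi> r \<in> measurable (PiM UNIV (\<lambda>_. borel)) (count_space UNIV)"
  unfolding final_state_def[abs_def] by measurable

lemma measurable_renew[measurable (raw)]:
  assumes [measurable]: "f \<in> measurable M (PiM UNIV (\<lambda>_. borel))" "g \<in> measurable M (PiM UNIV (\<lambda>_. borel))"
  shows "(\<lambda>x. renew \<Phi> r (f x) (g x)) \<in> measurable M (PiM UNIV (\<lambda>_. borel))"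
  unfolding renew_def final_state_def state_at_def by (intro measurable_PiM_single') auto

lemma measurable_passes[measurable]: "Measurable.pred (PiM UNIV (\<lambda>_. borel)) (passes (p :: ('c \<Rightarrow> bool) \<times> 'c))"
proof (cases p)
  fix x j assume Pair: "p = (x, j)"
  have "Measurable.pred (PiM UNIV (\<lambda>_. borel)) (\<lambda>d::'c \<Rightarrow> real. i \<noteq> j \<longrightarrow> (if x i then d j < d i else d i < d j))" for i
    by (cases "i = j"; cases "x i"; simp; measurable)
  then show ?thesis unfolding Pair passes_def[abs_def] by simp
qed

section \<open>Regeneration at the end of a cycle\<close>

text \<open>The conditional probability of \<open>passes (x, j)\<close> given that \<open>j\<close>
  fails at \<open>s > 0\<close>. The exponent is lowered by 1 because \<open>j\<close>, which works
  in \<open>x\<close>, is the pivot.\<close>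

definition pass_weight :: "('c \<Rightarrow> bool) \<Rightarrow> real \<Rightarrow> ennreal" where
  "pass_weight x s = ennreal (1 - exp (- \<mu> * s)) ^ num_failed x
      * ennreal (exp (- \<mu> * s)) ^ (CARD('c) - num_failed x - 1)"

lemma prod_if_state:
  fixes a b :: "'b::comm_monoid_mult"
  fixes x :: "'c \<Rightarrow> bool"
  assumes "x j"
  shows "(\<Prod>i\<in>UNIV - {j}. if x i then a else b) = b ^ num_failed x * a ^ (CARD('c) - num_failed x - 1)"
proof -
  have 1: "(UNIV - {j}) \<inter> {i. x i} = UNIV - {i. \<not> x i} - {j}" by auto
  have 2: "(UNIV - {j}) \<inter> - {i. x i} = {i. \<not> x i}" using assms by auto
  have "card (UNIV - {i. \<not> x i} - {j}) = CARD('c) - num_failed x - 1"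
    using assms by (subst card_Diff_singleton) (auto simp: num_failed_def card_Diff_subset)
  then show ?thesis
    by (subst prod.If_cases) (simp_all add: 1 2 num_failed_def mult.commute)
qed

text \<open>The box factor anticipates renewal: a component that keeps working is tested through its
  residual lifetime, a replaced one contributes \<open>emeasure expo (B i)\<close> directly. Using
  memorylessness for the former, both kinds integrate to a factor of \<open>pass_weight\<close>
  times the same \<open>emeasure expo (B i)\<close>.\<close>

lemma nn_integral_passes:
  assumes xj: "(x, j) \<in> transitions \<Phi> r"
    and [measurable]: "g \<in> borel_measurable borel" "\<And>i. B i \<in> sets borel"
  shows "(\<integral>\<^sup>+d. of_bool (passes (x, j) d) * (g (d j) *
        (\<Prod>i\<in>UNIV. if i \<noteq> j \<and> x i then indicator (B i) (d i - d j) else emeasure expo (B i))) \<partial>lifetimes) =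
    (\<integral>\<^sup>+s. g s * pass_weight x s \<partial>expo) * (\<Prod>i\<in>UNIV. emeasure expo (B i))"
proof -
  \<comment> \<open>\<open>f\<close> combines, for one component, the comparison with the pivot and
    the box factor.\<close>
  define f where "f i s y = (if x i then of_bool (s < y) * indicator (B i) (y - s)
      else of_bool (y < s) * emeasure expo (B i) :: ennreal)" for i s y
  have f[measurable]: "(\<lambda>(s, y). f i s y) \<in> borel_measurable (borel \<Otimes>\<^sub>M borel)" for i
    unfolding f_def case_prod_beta' by (cases "x i"; simp; measurable)
  have x: "x j" using xj by (simp add: transitions_def)
  have int_f: "(\<integral>\<^sup>+y. f i s y \<partial>expo) =
      (if x i then ennreal (exp (- \<mu> * s)) else ennreal (1 - exp (- \<mu> * s))) * emeasure expo (B i)"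
    if "0 < s" for i s
  proof (cases "x i")
    case True
    have "(\<integral>\<^sup>+y. f i s y \<partial>expo) = (\<integral>\<^sup>+y. indicator {y. s < y \<and> y - s \<in> B i} y \<partial>expo)"
      using True by (intro nn_integral_cong) (auto simp: f_def indicator_def)
    also have "\<dots> = emeasure expo {y. s < y \<and> y - s \<in> B i}"
      by (intro nn_integral_indicator) measurable
    finally show ?thesis using True that by (simp add: expo_memoryless)
  next
    case False
    have "(\<integral>\<^sup>+y. f i s y \<partial>expo) = (\<integral>\<^sup>+y. emeasure expo (B i) * indicator {y. y < s} y \<partial>expo)"
      using False by (intro nn_integral_cong) (auto simp: f_def indicator_def)
    also have "\<dots> = emeasure expo (B i) * emeasure expo {y. y < s}"
      by (subst nn_integral_cmult_indicator) auto
    finally show ?thesis using False that by (simp add: expo_lt mult.commute)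
  qed
  have split: "(\<Prod>i\<in>UNIV. h i) = h j * (\<Prod>i\<in>UNIV - {j}. h i)" for h :: "'c \<Rightarrow> ennreal"
    by (rule prod.remove) auto
  have "(\<integral>\<^sup>+d. of_bool (passes (x, j) d) * (g (d j) *
        (\<Prod>i\<in>UNIV. if i \<noteq> j \<and> x i then indicator (B i) (d i - d j) else emeasure expo (B i))) \<partial>lifetimes) =
      (\<integral>\<^sup>+d. (g (d j) * emeasure expo (B j)) * (\<Prod>i\<in>UNIV - {j}. f i (d j) (d i)) \<partial>lifetimes)"
  proof (rule nn_integral_cong)
    fix d
    have "(\<Prod>i\<in>UNIV - {j}. f i (d j) (d i)) =
        (\<Prod>i\<in>UNIV - {j}. of_bool (if x i then d j < d i else d i < d j) *
          (if i \<noteq> j \<and> x i then indicator (B i) (d i - d j) else emeasure expo (B i)))"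
      by (intro prod.cong) (auto simp: f_def)
    also have "\<dots> = (\<Prod>i\<in>UNIV - {j}. of_bool (if x i then d j < d i else d i < d j)) *
       (\<Prod>i\<in>UNIV - {j}. if i \<noteq> j \<and> x i then indicator (B i) (d i - d j) else emeasure expo (B i))"
      by (rule prod.distrib)
    also have "(\<Prod>i\<in>UNIV - {j}. of_bool (if x i then d j < d i else d i < d j)) = (of_bool (passes (x, j) d) :: ennreal)"
    proof (cases "passes (x, j) d")
      case True
      then show ?thesis by (auto simp: passes_def intro!: prod.neutral)
    next
      case False
      then obtain i where "i \<noteq> j" "\<not> (if x i then d j < d i else d i < d j)" by (auto simp: passes_def)
      then show ?thesis using False by (auto intro!: prod_zero bexI[of _ i])
    qed
    finally show "of_bool (passes (x, j) d) * (g (d j) *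
        (\<Prod>i\<in>UNIV. if i \<noteq> j \<and> x i then indicator (B i) (d i - d j) else emeasure expo (B i))) =
        (g (d j) * emeasure expo (B j)) * (\<Prod>i\<in>UNIV - {j}. f i (d j) (d i))"
      by (subst split) (simp add: ac_simps)
  qed
  also have "\<dots> = (\<integral>\<^sup>+s. (g s * emeasure expo (B j)) * (\<Prod>i\<in>UNIV - {j}. \<integral>\<^sup>+y. f i s y \<partial>expo) \<partial>expo)"
    by (rule nn_integral_lifetimes_pivot) measurable
  also have "\<dots> = (\<integral>\<^sup>+s. (g s * pass_weight x s) * (\<Prod>i\<in>UNIV. emeasure expo (B i)) \<partial>expo)"
  proof (rule nn_integral_cong_AE, use AE_expo_pos in eventually_elim)
    case (elim s)
    have "(\<Prod>i\<in>UNIV - {j}. \<integral>\<^sup>+y. f i s y \<partial>expo) = pass_weight x s * (\<Prod>i\<in>UNIV - {j}. emeasure expo (B i))"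
      unfolding int_f[OF elim] prod.distrib prod_if_state[of x, OF x] pass_weight_def ..
    then show ?case by (subst split) (simp add: ac_simps)
  qed
  also have "\<dots> = (\<integral>\<^sup>+s. g s * pass_weight x s \<partial>expo) * (\<Prod>i\<in>UNIV. emeasure expo (B i))"
    unfolding pass_weight_def by (rule nn_integral_multc) measurable
  finally show ?thesis .
qed

text \<open>The box probability is the same for every transition and leaves the sum. This product
  form on boxes is the independence of cycle data and renewed lifetimes; \<open>h\<close> keeps the
  dependence on the cycle data arbitrary.\<close>

lemma nn_integral_final_renew:
  fixes h :: "real \<times> ('c \<Rightarrow> bool) \<Rightarrow> ennreal"
  assumes h[measurable]: "h \<in> borel_measurable (borel \<Otimes>\<^sub>M count_space UNIV)"
    and B[measurable]: "\<And>i. B i \<in> sets borel"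
  shows "(\<integral>\<^sup>+d. h (cycle_length \<Phi> r d, final_state \<Phi> r d) *
      (\<Prod>i\<in>UNIV. if final_state \<Phi> r d i then indicator (B i) (d i - cycle_length \<Phi> r d) else emeasure expo (B i))
      \<partial>lifetimes) =
    (\<Sum>(x, j)\<in>transitions \<Phi> r. \<integral>\<^sup>+s. h (s, x(j := False)) * pass_weight x s \<partial>expo) *
      (\<Prod>i\<in>UNIV. emeasure expo (B i))"
proof -
  define F where "F = (\<lambda>(x, j) d. h (d j, x(j := False)) *
      (\<Prod>i\<in>UNIV. if i \<noteq> j \<and> x i then indicator (B i) (d i - d j) else emeasure expo (B i)))"
  have hx[measurable]: "(\<lambda>s. h (s, x)) \<in> borel_measurable borel" for x
    by measurable
  have "(\<integral>\<^sup>+d. h (cycle_length \<Phi> r d, final_state \<Phi> r d) *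
      (\<Prod>i\<in>UNIV. if final_state \<Phi> r d i then indicator (B i) (d i - cycle_length \<Phi> r d) else emeasure expo (B i))
      \<partial>lifetimes) = (\<integral>\<^sup>+d. (\<Sum>p\<in>transitions \<Phi> r. of_bool (passes p d) * F p d) \<partial>lifetimes)"
  proof (rule nn_integral_cong_AE, use AE_lifetimes_pos AE_lifetimes_inj in eventually_elim)
    case (elim d)
    show ?case
    proof (rule sum_over_transitions[symmetric])
      show "0 < d i" for i using elim by simp
      show "inj d" by fact
      fix x j assume p: "(x, j) \<in> transitions \<Phi> r" "passes (x, j) d"
      show "F (x, j) d = h (cycle_length \<Phi> r d, final_state \<Phi> r d) *
        (\<Prod>i\<in>UNIV. if final_state \<Phi> r d i then indicator (B i) (d i - cycle_length \<Phi> r d) else emeasure expo (B i))"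
        using passes_imp[OF p] elim by (auto simp: F_def intro!: prod.cong arg_cong2[where f="(*)"])
    qed
  qed
  also have "\<dots> = (\<Sum>p\<in>transitions \<Phi> r. \<integral>\<^sup>+d. of_bool (passes p d) * F p d \<partial>lifetimes)"
  proof (rule nn_integral_sum)
    fix p :: "('c \<Rightarrow> bool) \<times> 'c"
    obtain x j where p: "p = (x, j)" by (cases p)
    have "(\<lambda>d. if i \<noteq> j \<and> x i then indicator (B i) (d i - d j) else emeasure expo (B i))
        \<in> borel_measurable (PiM UNIV (\<lambda>_. borel))" for i
      by (cases "i \<noteq> j \<and> x i"; simp; measurable)
    then show "(\<lambda>d. of_bool (passes p d) * F p d) \<in> borel_measurable lifetimes"
      unfolding p F_def by simp
  qed
  also have "\<dots> = (\<Sum>p\<in>transitions \<Phi> r. (case p of (x, j) \<Rightarrow> \<integral>\<^sup>+s. h (s, x(j := False)) * pass_weight x s \<partial>expo) *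
      (\<Prod>i\<in>UNIV. emeasure expo (B i)))"
  proof (rule sum.cong[OF refl])
    fix p assume p: "p \<in> transitions \<Phi> r"
    show "(\<integral>\<^sup>+d. of_bool (passes p d) * F p d \<partial>lifetimes) =
        (case p of (x, j) \<Rightarrow> \<integral>\<^sup>+s. h (s, x(j := False)) * pass_weight x s \<partial>expo) * (\<Prod>i\<in>UNIV. emeasure expo (B i))"
      using p nn_integral_passes[of _ _ "\<lambda>s. h (s, _)" B] by (cases p) (simp add: F_def)
  qed
  finally show ?thesis by (simp add: sum_distrib_right)
qed

text \<open>The trivial boxes \<open>UNIV\<close> leave the joint law of length and final
  state.\<close>

lemma nn_integral_final:
  fixes h :: "real \<times> ('c \<Rightarrow> bool) \<Rightarrow> ennreal"
  assumes "h \<in> borel_measurable (borel \<Otimes>\<^sub>M count_space UNIV)"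
  shows "(\<integral>\<^sup>+d. h (cycle_length \<Phi> r d, final_state \<Phi> r d) \<partial>lifetimes) =
    (\<Sum>(x, j)\<in>transitions \<Phi> r. \<integral>\<^sup>+s. h (s, x(j := False)) * pass_weight x s \<partial>expo)"
  using nn_integral_final_renew[OF assms, of "\<lambda>_. UNIV"] by (simp add: expo.emeasure_space_1[simplified] cong: if_cong)

text \<open>A renewed array is distributed like a fresh one and independent of the cycle before it.\<close>

lemma nn_integral_renew:
  fixes \<phi> :: "('c \<Rightarrow> real) \<Rightarrow> ennreal"
  assumes C[measurable]: "C \<in> sets (borel \<Otimes>\<^sub>M count_space UNIV)"
    and phi: "\<phi> \<in> borel_measurable (PiM UNIV (\<lambda>_. borel))"
  shows "(\<integral>\<^sup>+d. \<integral>\<^sup>+l. indicator C (cycle_length \<Phi> r d, final_state \<Phi> r d) * \<phi> (renew \<Phi> r d l) \<partial>lifetimes \<partial>lifetimes) =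
    (\<integral>\<^sup>+d. indicator C (cycle_length \<Phi> r d, final_state \<Phi> r d) \<partial>lifetimes) * (\<integral>\<^sup>+d. \<phi> d \<partial>lifetimes)"
proof -
  define w where "w = (\<integral>\<^sup>+d. indicator C (cycle_length \<Phi> r d, final_state \<Phi> r d) \<partial>lifetimes)"
  \<comment> \<open>\<open>D\<close> restricts the joint law to the event \<open>C\<close>, and
    \<open>N\<close> is its image under \<open>renew\<close>; the claim is that \<open>N\<close> is
    a multiple of the fresh law. For finite measures on the product it suffices to compare
    boxes.\<close>
  define D where "D = density (lifetimes \<Otimes>\<^sub>M lifetimes)
      (\<lambda>(d, l). indicator C (cycle_length \<Phi> r d, final_state \<Phi> r d))"
  define N where "N = distr D lifetimes (\<lambda>(d, l). renew \<Phi> r d l)"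
  have sD[measurable_cong]: "sets D = sets (PiM UNIV (\<lambda>_. borel) \<Otimes>\<^sub>M PiM UNIV (\<lambda>_. borel))"
    unfolding D_def by (simp add: sets_lifetimes cong: sets_pair_measure_cong)
  have N: "(\<integral>\<^sup>+z. f z \<partial>N) = (\<integral>\<^sup>+d. \<integral>\<^sup>+l. indicator C (cycle_length \<Phi> r d, final_state \<Phi> r d) * f (renew \<Phi> r d l) \<partial>lifetimes \<partial>lifetimes)"
    if [measurable]: "f \<in> borel_measurable (PiM UNIV (\<lambda>_. borel))" for f :: "('c \<Rightarrow> real) \<Rightarrow> ennreal"
  proof -
    have "(\<integral>\<^sup>+z. f z \<partial>N) = (\<integral>\<^sup>+x. f (case x of (d, l) \<Rightarrow> renew \<Phi> r d l) \<partial>D)"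
      unfolding N_def by (rule nn_integral_distr) measurable
    also have "\<dots> = (\<integral>\<^sup>+x. (case x of (d, l) \<Rightarrow> indicator C (cycle_length \<Phi> r d, final_state \<Phi> r d)) *
        f (case x of (d, l) \<Rightarrow> renew \<Phi> r d l) \<partial>(lifetimes \<Otimes>\<^sub>M lifetimes))"
      unfolding D_def by (rule nn_integral_density) measurable
    also have "\<dots> = (\<integral>\<^sup>+d. \<integral>\<^sup>+l. indicator C (cycle_length \<Phi> r d, final_state \<Phi> r d) * f (renew \<Phi> r d l) \<partial>lifetimes \<partial>lifetimes)"
      by (subst lifetimes.nn_integral_fst[symmetric]) simp_all
    finally show ?thesis .
  qed
  have "N = scale_measure w lifetimes"
  proof (rule measure_eqI_PiM_finite[where I=UNIV and M="\<lambda>_. expo" and A="\<lambda>_. UNIV"])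
    show "sets N = sets (PiM UNIV (\<lambda>_::'c. expo))" "sets (scale_measure w lifetimes) = sets (PiM UNIV (\<lambda>_::'c. expo))"
      by (simp_all add: N_def lifetimes_def)
    fix B :: "'c \<Rightarrow> real set" assume "\<And>i. i \<in> UNIV \<Longrightarrow> B i \<in> sets expo"
    then have B[measurable]: "B i \<in> sets borel" for i by simp
    have PB[measurable]: "Pi\<^sub>E UNIV B \<in> sets (PiM UNIV (\<lambda>_. borel))" by (rule sets_PiM_I_finite) auto
    have "emeasure N (Pi\<^sub>E UNIV B) = (\<integral>\<^sup>+z. indicator (Pi\<^sub>E UNIV B) z \<partial>N)"
      by (rule nn_integral_indicator[symmetric]) (simp add: N_def sets_lifetimes)
    also have "\<dots> = (\<integral>\<^sup>+d. \<integral>\<^sup>+l. indicator C (cycle_length \<Phi> r d, final_state \<Phi> r d) *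
        indicator (Pi\<^sub>E UNIV B) (renew \<Phi> r d l) \<partial>lifetimes \<partial>lifetimes)"
      by (rule N) measurable
    also have "\<dots> = (\<integral>\<^sup>+d. indicator C (cycle_length \<Phi> r d, final_state \<Phi> r d) *
      (\<Prod>i\<in>UNIV. if final_state \<Phi> r d i then indicator (B i) (d i - cycle_length \<Phi> r d) else emeasure expo (B i))
      \<partial>lifetimes)"
    proof (rule nn_integral_cong)
      fix d
      define f where "f i y = (if final_state \<Phi> r d i then indicator (B i) (d i - cycle_length \<Phi> r d) else indicator (B i) y :: ennreal)" for i y
      have mr: "renew \<Phi> r d \<in> measurable lifetimes (PiM UNIV (\<lambda>_. borel))"
        by (intro measurable_renew[of "\<lambda>_. d" _ "\<lambda>l. l"] measurable_const measurable_ident_sets sets_lifetimes)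
          (simp add: space_PiM)
      have [measurable]: "f i \<in> borel_measurable borel" for i
        unfolding f_def[abs_def] by (cases "final_state \<Phi> r d i") simp_all
      \<comment> \<open>Membership in the box splits over the components, and integrating out
        \<open>l\<close> leaves the factors of \<open>nn_integral_final_renew\<close>.\<close>
      have "indicator (Pi\<^sub>E UNIV B) (renew \<Phi> r d l) = (\<Prod>i\<in>UNIV. f i (l i))" for l
      proof (cases "renew \<Phi> r d l \<in> Pi\<^sub>E UNIV B")
        case True
        then have "f i (l i) = 1" for i by (auto simp: f_def renew_def PiE_iff dest!: spec[of _ i] split: if_splits)
        then show ?thesis using True by simp
      next
        case False
        then obtain i where "renew \<Phi> r d l i \<notin> B i" by (auto simp: PiE_iff)
        then have "f i (l i) = 0" by (auto simp: f_def renew_def)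
        then show ?thesis using False by (auto intro!: prod_zero[symmetric])
      qed
      then have "(\<integral>\<^sup>+l. indicator (Pi\<^sub>E UNIV B) (renew \<Phi> r d l) \<partial>lifetimes) = (\<Prod>i\<in>UNIV. \<integral>\<^sup>+y. f i y \<partial>expo)"
        unfolding lifetimes_def by (simp add: lifetime_product.product_nn_integral_prod)
      moreover have "(\<integral>\<^sup>+y. f i y \<partial>expo) = (if final_state \<Phi> r d i then indicator (B i) (d i - cycle_length \<Phi> r d) else emeasure expo (B i))" for i
        by (auto simp: f_def expo.emeasure_space_1[simplified])
      ultimately show "(\<integral>\<^sup>+l. indicator C (cycle_length \<Phi> r d, final_state \<Phi> r d) *
        indicator (Pi\<^sub>E UNIV B) (renew \<Phi> r d l) \<partial>lifetimes) =
        indicator C (cycle_length \<Phi> r d, final_state \<Phi> r d) *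
      (\<Prod>i\<in>UNIV. if final_state \<Phi> r d i then indicator (B i) (d i - cycle_length \<Phi> r d) else emeasure expo (B i))"
        using nn_integral_cmult[OF measurable_compose[OF mr borel_measurable_indicator[OF PB]]]
        by simp
    qed
    also have "\<dots> = w * (\<Prod>i\<in>UNIV. emeasure expo (B i))"
      unfolding w_def by (subst nn_integral_final_renew, simp_all add: nn_integral_final)
    also have "\<dots> = emeasure (scale_measure w lifetimes) (Pi\<^sub>E UNIV B)"
      by (simp add: lifetimes_def lifetime_product.emeasure_PiM)
    finally show "emeasure N (Pi\<^sub>E UNIV B) = emeasure (scale_measure w lifetimes) (Pi\<^sub>E UNIV B)" .
  next
    show "range (\<lambda>_::nat. UNIV) \<subseteq> prod_algebra UNIV (\<lambda>_::'c. expo)"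
      using prod_algebraI_finite[of UNIV "\<lambda>_. UNIV" "\<lambda>_::'c. expo"] by (auto simp: PiE_UNIV_domain)
    show "(\<Union>i::nat. UNIV) = space (PiM UNIV (\<lambda>_::'c. expo))" by (simp add: space_PiM)
    have "emeasure N UNIV = (\<integral>\<^sup>+z. 1 \<partial>N)" by (simp add: N_def)
    also have "\<dots> = w" unfolding w_def by (subst N) (simp_all add: lifetimes.emeasure_space_1[simplified])
    also have "w \<le> (\<integral>\<^sup>+d. 1 \<partial>lifetimes)"
      unfolding w_def by (intro nn_integral_mono) (simp split: split_indicator)
    finally show "emeasure N UNIV \<noteq> \<infinity>" by (auto simp: lifetimes.emeasure_space_1[simplified] top_unique)
  qed simp
  then have "(\<integral>\<^sup>+z. \<phi> z \<partial>N) = w * (\<integral>\<^sup>+z. \<phi> z \<partial>lifetimes)"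
    using phi by (simp add: nn_integral_scale_measure measurable_cong_sets[OF sets_lifetimes])
  then show ?thesis unfolding w_def using N[OF phi] by simp
qed

section \<open>Independence of the cycles under the product law of the array\<close>

definition cycle_data :: "('c \<Rightarrow> real) \<Rightarrow> real \<times> ('c \<Rightarrow> bool)" where
  "cycle_data d = (cycle_length \<Phi> r d, final_state \<Phi> r d)"

abbreviation cycle_space :: "(real \<times> ('c \<Rightarrow> bool)) measure" where
  "cycle_space \<equiv> borel \<Otimes>\<^sub>M count_space UNIV"

definition cycle_law :: "(real \<times> ('c \<Rightarrow> bool)) measure" where
  "cycle_law = distr lifetimes cycle_space cycle_data"

lemma measurable_cycle_data[measurable]: "cycle_data \<in> measurable (PiM UNIV (\<lambda>_. borel)) cycle_space"
  unfolding cycle_data_def[abs_def] by measurable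

lemma sets_cycle_law[measurable_cong, simp]: "sets cycle_law = sets cycle_space"
  by (simp add: cycle_law_def)

sublocale cycle_law: prob_space cycle_law
  unfolding cycle_law_def by (rule lifetimes.prob_space_distr) measurable

lemma emeasure_cycle_law:
  assumes [measurable]: "C \<in> sets cycle_space"
  shows "emeasure cycle_law C = (\<integral>\<^sup>+d. indicator C (cycle_data d) \<partial>lifetimes)"
proof -
  have "emeasure cycle_law C = (\<integral>\<^sup>+z. indicator C z \<partial>cycle_law)" by simp
  also have "\<dots> = (\<integral>\<^sup>+d. indicator C (cycle_data d) \<partial>lifetimes)"
    unfolding cycle_law_def by (rule nn_integral_distr) measurable
  finally show ?thesis .
qed

sublocale lifetime_seq: sequence_space lifetimes by standard

abbreviation arrays :: "(nat \<Rightarrow> 'c \<Rightarrow> real) measure" where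
  "arrays \<equiv> PiM UNIV (\<lambda>_. PiM UNIV (\<lambda>_. borel))"

lemma sets_lifetime_seq[measurable_cong]: "sets lifetime_seq.S = sets arrays"
  by (intro sets_PiM_cong) (auto simp: sets_lifetimes)

lemma measurable_residual[measurable]:
  "(\<lambda>L. residual \<Phi> r L k) \<in> measurable arrays (PiM UNIV (\<lambda>_. borel))"
  by (induction k) auto

text \<open>The array as seen from the first repair. Row 1 is used up in renewing row 0, so the tail
  restarts with row 2.\<close>

definition next_array :: "(nat \<Rightarrow> 'c \<Rightarrow> real) \<Rightarrow> nat \<Rightarrow> 'c \<Rightarrow> real" where
  "next_array L = case_nat (renew \<Phi> r (L 0) (L 1)) (\<lambda>k. L (Suc (Suc k)))"

lemma residual_next_array: "residual \<Phi> r (next_array L) k = residual \<Phi> r L (Suc k)"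
  by (induction k) (simp_all add: next_array_def)

lemma nn_integral_case_nat:
  assumes [measurable]: "f \<in> borel_measurable arrays"
  shows "(\<integral>\<^sup>+L. f L \<partial>lifetime_seq.S) = (\<integral>\<^sup>+d. \<integral>\<^sup>+L. f (case_nat d L) \<partial>lifetime_seq.S \<partial>lifetimes)"
proof -
  have "(\<integral>\<^sup>+L. f L \<partial>lifetime_seq.S) =
      (\<integral>\<^sup>+L. f L \<partial>distr (lifetimes \<Otimes>\<^sub>M lifetime_seq.S) lifetime_seq.S (\<lambda>(d, L). case_nat d L))"
    by (simp only: lifetime_seq.PiM_iter)
  also have "\<dots> = (\<integral>\<^sup>+x. f (case x of (d, L) \<Rightarrow> case_nat d L) \<partial>(lifetimes \<Otimes>\<^sub>M lifetime_seq.S))"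
    by (rule nn_integral_distr) measurable
  also have "\<dots> = (\<integral>\<^sup>+d. \<integral>\<^sup>+L. f (case_nat d L) \<partial>lifetime_seq.S \<partial>lifetimes)"
    by (subst lifetime_seq.nn_integral_fst[symmetric]) simp_all
  finally show ?thesis .
qed

text \<open>The regeneration step: integrate first over the rows from 2 on, then apply the renewal
  of rows 0 and 1; what remains has the law of a fresh array.\<close>

lemma nn_integral_next_array:
  assumes [measurable]: "C \<in> sets cycle_space" "f \<in> borel_measurable arrays"
  shows "(\<integral>\<^sup>+L. indicator C (cycle_data (L 0)) * f (next_array L) \<partial>lifetime_seq.S) =
    emeasure cycle_law C * (\<integral>\<^sup>+L. f L \<partial>lifetime_seq.S)"
proof -
  define g where "g d = (\<integral>\<^sup>+L. f (case_nat d L) \<partial>lifetime_seq.S)" for d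
  have g[measurable]: "g \<in> borel_measurable (PiM UNIV (\<lambda>_. borel))"
    unfolding g_def[abs_def] by measurable
  have shift: "(\<lambda>L. case_nat d L) \<in> measurable arrays arrays" for d
    by (rule measurable_case_nat') (auto simp: space_PiM)
  have next_m[measurable]: "next_array \<in> measurable arrays arrays"
  proof -
    have "(\<lambda>L k. L (Suc (Suc k))) \<in> measurable arrays arrays"
      by (rule measurable_PiM_single') (auto simp: space_PiM)
    then show ?thesis
      unfolding next_array_def[abs_def] by (rule measurable_case_nat'[rotated]) measurable
  qed
  have "(\<integral>\<^sup>+L. indicator C (cycle_data (L 0)) * f (next_array L) \<partial>lifetime_seq.S) =
    (\<integral>\<^sup>+d. \<integral>\<^sup>+L. indicator C (cycle_data d) * f (next_array (case_nat d L)) \<partial>lifetime_seq.S \<partial>lifetimes)"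
    by (subst nn_integral_case_nat) simp_all
  also have "\<dots> = (\<integral>\<^sup>+d. \<integral>\<^sup>+l. \<integral>\<^sup>+L. indicator C (cycle_data d) * f (case_nat (renew \<Phi> r d l) L) \<partial>lifetime_seq.S \<partial>lifetimes \<partial>lifetimes)"
  proof (rule nn_integral_cong)
    fix d
    have "(\<lambda>L. indicator C (cycle_data d) * f (next_array (case_nat d L))) \<in> borel_measurable arrays"
      by (intro borel_measurable_times_ennreal borel_measurable_const
        measurable_compose[OF measurable_compose[OF shift next_m] assms(2)])
    from nn_integral_case_nat[OF this]
    show "(\<integral>\<^sup>+L. indicator C (cycle_data d) * f (next_array (case_nat d L)) \<partial>lifetime_seq.S) =
      (\<integral>\<^sup>+l. \<integral>\<^sup>+L. indicator C (cycle_data d) * f (case_nat (renew \<Phi> r d l) L) \<partial>lifetime_seq.S \<partial>lifetimes)"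
      by (simp add: next_array_def)
  qed
  also have "\<dots> = (\<integral>\<^sup>+d. \<integral>\<^sup>+l. indicator C (cycle_data d) * g (renew \<Phi> r d l) \<partial>lifetimes \<partial>lifetimes)"
    unfolding g_def using shift measurable_cong_sets[OF sets_lifetime_seq refl]
    by (intro nn_integral_cong nn_integral_cmult measurable_compose[OF _ assms(2)]) auto
  also have "\<dots> = emeasure cycle_law C * (\<integral>\<^sup>+d. g d \<partial>lifetimes)"
    unfolding emeasure_cycle_law[OF assms(1)] unfolding cycle_data_def by (rule nn_integral_renew) measurable
  also have "(\<integral>\<^sup>+d. g d \<partial>lifetimes) = (\<integral>\<^sup>+L. f L \<partial>lifetime_seq.S)"
    unfolding g_def by (rule nn_integral_case_nat[symmetric]) measurable
  finally show ?thesis .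
qed

text \<open>Peeling off the first cycle turns the remaining ones into the cycles of
  \<open>next_array\<close>; the sets \<open>B\<close> shift by one, so they are general in the
  induction.\<close>

lemma nn_integral_cycles:
  assumes "\<And>k. B k \<in> sets cycle_space"
  shows "(\<integral>\<^sup>+L. (\<Prod>k<m. indicator (B k) (cycle_data (residual \<Phi> r L k))) \<partial>lifetime_seq.S) =
    (\<Prod>k<m. emeasure cycle_law (B k))"
  using assms
proof (induction m arbitrary: B)
  case 0
  then show ?case by (simp add: lifetime_seq.emeasure_space_1)
next
  case (Suc m)
  note [measurable] = Suc.prems
  have "(\<integral>\<^sup>+L. (\<Prod>k<Suc m. indicator (B k) (cycle_data (residual \<Phi> r L k))) \<partial>lifetime_seq.S) =
    (\<integral>\<^sup>+L. indicator (B 0) (cycle_data (L 0)) *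
      (\<Prod>k<m. indicator (B (Suc k)) (cycle_data (residual \<Phi> r (next_array L) k))) \<partial>lifetime_seq.S)"
    by (simp only: prod.lessThan_Suc_shift residual_next_array residual.simps(1))
  also have "\<dots> = emeasure cycle_law (B 0) *
      (\<integral>\<^sup>+L. (\<Prod>k<m. indicator (B (Suc k)) (cycle_data (residual \<Phi> r L k))) \<partial>lifetime_seq.S)"
    by (rule nn_integral_next_array) measurable
  also have "\<dots> = (\<Prod>k<Suc m. emeasure cycle_law (B k))"
    by (simp only: Suc prod.lessThan_Suc_shift)
  finally show ?case .
qed

section \<open>Final state and mean length of one cycle\<close>

text \<open>The exponential density supplies one more factor \<open>exp (- \<mu> * s)\<close>, which
  raises the exponent to the number of working components and gives the Beta integral.\<close>

lemma nn_integral_pass_weight: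
  assumes "x j"
  shows "(\<integral>\<^sup>+s. pass_weight x s \<partial>expo) = ennreal (occupancy CARD('c) (num_failed x))"
proof -
  define a where "a = num_failed x"
  define b where "b = CARD('c) - a"
  have b: "1 \<le> b" "a + b = CARD('c)"
    using num_failed_less[of x, OF assms] by (auto simp: a_def b_def)
  have "(\<integral>\<^sup>+s. pass_weight x s \<partial>expo) =
      (\<integral>\<^sup>+s. ennreal (exponential_density \<mu> s) * pass_weight x s \<partial>lborel)"
    unfolding expo_def pass_weight_def by (rule nn_integral_density) measurable
  also have "\<dots> = (\<integral>\<^sup>+s. ennreal (\<mu> * exp (- \<mu> * s) ^ b * (1 - exp (- \<mu> * s)) ^ a) * indicator {0..} s \<partial>lborel)"
  proof (rule nn_integral_cong)
    fix s :: real
    show "ennreal (exponential_density \<mu> s) * pass_weight x s =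
        ennreal (\<mu> * exp (- \<mu> * s) ^ b * (1 - exp (- \<mu> * s)) ^ a) * indicator {0..} s"
    proof (cases "0 \<le> s")
      case True
      have e: "0 \<le> 1 - exp (- \<mu> * s)" using True mu_pos by simp
      have "ennreal (exponential_density \<mu> s) * pass_weight x s =
          ennreal (\<mu> * exp (- \<mu> * s) * ((1 - exp (- \<mu> * s)) ^ a * exp (- \<mu> * s) ^ (b - 1)))"
        using True e mu_pos
        by (simp add: exponential_density_def pass_weight_def ennreal_power ennreal_mult[symmetric] a_def b_def mult.commute)
      also have "\<mu> * exp (- \<mu> * s) * ((1 - exp (- \<mu> * s)) ^ a * exp (- \<mu> * s) ^ (b - 1)) =
          \<mu> * (exp (- \<mu> * s) * exp (- \<mu> * s) ^ (b - 1)) * (1 - exp (- \<mu> * s)) ^ a"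
        by (simp only: ac_simps)
      also have "exp (- \<mu> * s) * exp (- \<mu> * s) ^ (b - 1) = exp (- \<mu> * s) ^ b"
        using b(1) by (cases b) simp_all
      finally show ?thesis using True by simp
    qed (simp add: exponential_density_def)
  qed
  also have "\<dots> = ennreal (1 / (real b * real ((a + b) choose a)))"
    by (rule nn_integral_exp_beta[OF mu_pos b(1)])
  finally have "(\<integral>\<^sup>+s. pass_weight x s \<partial>expo) = ennreal (1 / (real b * real (CARD('c) choose a)))"
    by (simp only: b(2))
  then show ?thesis by (simp only: occupancy_def a_def b_def)
qed

lemma occupancy_nonneg: "0 \<le> occupancy m a"
  by (simp add: occupancy_def)

text \<open>There are only finitely many final states, so a function of the final state is a finite
  combination of indicators; this admits costs of any sign and gives integrability at once.\<close>

lemma has_bochner_integral_final_state: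
  fixes c :: "('c \<Rightarrow> bool) \<Rightarrow> real"
  shows "has_bochner_integral lifetimes (\<lambda>d. c (final_state \<Phi> r d))
    (\<Sum>(x, j)\<in>transitions \<Phi> r. c (x(j := False)) * occupancy CARD('c) (num_failed x))"
proof -
  define q where "q y = (\<Sum>(x, j)\<in>transitions \<Phi> r. of_bool (x(j := False) = y) * occupancy CARD('c) (num_failed x))" for y
  have E[measurable]: "{d. final_state \<Phi> r d = y} \<in> sets lifetimes" for y
  proof -
    have "{d \<in> space lifetimes. final_state \<Phi> r d = y} \<in> sets lifetimes" by measurable
    then show ?thesis by simp
  qed
  have "emeasure lifetimes {d. final_state \<Phi> r d = y} = ennreal (q y)" for y
  proof -
    have "emeasure lifetimes {d. final_state \<Phi> r d = y} =
        (\<integral>\<^sup>+d. indicator {y} (snd (cycle_length \<Phi> r d, final_state \<Phi> r d)) \<partial>lifetimes)"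
    proof -
      have "emeasure lifetimes {d. final_state \<Phi> r d = y} = (\<integral>\<^sup>+d. indicator {d. final_state \<Phi> r d = y} d \<partial>lifetimes)"
        by (rule nn_integral_indicator[symmetric, OF E])
      also have "\<dots> = (\<integral>\<^sup>+d. indicator {y} (snd (cycle_length \<Phi> r d, final_state \<Phi> r d)) \<partial>lifetimes)"
        by (rule nn_integral_cong) (simp add: indicator_def)
      finally show ?thesis .
    qed
    also have "\<dots> = (\<Sum>(x, j)\<in>transitions \<Phi> r. \<integral>\<^sup>+s. indicator {y} (snd (s, x(j := False))) * pass_weight x s \<partial>expo)"
      by (rule nn_integral_final[where h = "\<lambda>z. indicator {y} (snd z)"]) measurable
    also have "\<dots> = (\<Sum>(x, j)\<in>transitions \<Phi> r. ennreal (of_bool (x(j := False) = y) * occupancy CARD('c) (num_failed x)))"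
      by (intro sum.cong refl) (auto simp: transitions_def indicator_def nn_integral_pass_weight)
    also have "\<dots> = ennreal (q y)"
      unfolding q_def case_prod_beta' by (rule sum_ennreal) (simp add: occupancy_nonneg)
    finally show ?thesis .
  qed
  moreover have "0 \<le> q y" for y
    unfolding q_def by (auto intro!: sum_nonneg simp: occupancy_nonneg)
  ultimately have m: "measure lifetimes {d. final_state \<Phi> r d = y} = q y" for y
    by (simp add: measure_def)
  have "has_bochner_integral lifetimes (\<lambda>d. \<Sum>y\<in>UNIV. indicator {d. final_state \<Phi> r d = y} d * c y) (\<Sum>y\<in>UNIV. q y * c y)"
    by (intro has_bochner_integral_sum has_bochner_integral_mult_left)
      (auto simp: m[symmetric] intro!: has_bochner_integral_real_indicator lifetimes.emeasure_finite[THEN less_top[THEN iffD1]])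
  moreover have "(\<Sum>y\<in>UNIV. indicator {d. final_state \<Phi> r d = y} d * c y) = c (final_state \<Phi> r d)" for d
  proof -
    have "(\<Sum>y\<in>UNIV. indicator {d. final_state \<Phi> r d = y} d * c y) = (\<Sum>y\<in>UNIV. if y = final_state \<Phi> r d then c y else 0)"
      by (rule sum.cong) (auto simp: indicator_def)
    then show ?thesis by simp
  qed
  moreover have "(\<Sum>y\<in>UNIV. q y * c y) = (\<Sum>(x, j)\<in>transitions \<Phi> r. c (x(j := False)) * occupancy CARD('c) (num_failed x))"
  proof -
    have "(\<Sum>y\<in>UNIV. q y * c y) = (\<Sum>p\<in>transitions \<Phi> r. \<Sum>y\<in>UNIV. (case p of (x, j) \<Rightarrow> of_bool (x(j := False) = y) * occupancy CARD('c) (num_failed x)) * c y)"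
      unfolding q_def sum_distrib_right by (rule sum.swap)
    also have "\<dots> = (\<Sum>(x, j)\<in>transitions \<Phi> r. c (x(j := False)) * occupancy CARD('c) (num_failed x))"
    proof (intro sum.cong refl, clarify)
      fix x and j :: 'c
      have "(\<Sum>y\<in>UNIV. of_bool (x(j := False) = y) * occupancy CARD('c) (num_failed x) * c y) =
          (\<Sum>y\<in>UNIV. if y = x(j := False) then c y * occupancy CARD('c) (num_failed x) else 0)"
        by (rule sum.cong) auto
      then show "(\<Sum>y\<in>UNIV. of_bool (x(j := False) = y) * occupancy CARD('c) (num_failed x) * c y) =
          c (x(j := False)) * occupancy CARD('c) (num_failed x)"
        by simp
    qed
    finally show ?thesis .
  qed
  ultimately show ?thesis by simp
qed

lemma emeasure_state_at:
  assumes t: "0 \<le> t"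
  shows "emeasure lifetimes {d. state_at d t = x} =
    ennreal (1 - exp (- \<mu> * t)) ^ num_failed x * ennreal (exp (- \<mu> * t)) ^ (CARD('c) - num_failed x)"
proof -
  define B where "B i = (if x i then {y. t < y} else {y. y \<le> t})" for i
  have B: "B i \<in> sets expo" for i by (simp add: B_def)
  have "{d. state_at d t = x} = Pi\<^sub>E UNIV B"
    by (auto simp: B_def state_at_def PiE_iff fun_eq_iff split: if_splits) (metis not_le)+
  then have "emeasure lifetimes {d. state_at d t = x} = (\<Prod>i\<in>UNIV. emeasure expo (B i))"
    using B by (simp add: lifetimes_def lifetime_product.emeasure_PiM)
  also have "\<dots> = (\<Prod>i\<in>UNIV. if x i then ennreal (exp (- \<mu> * t)) else ennreal (1 - exp (- \<mu> * t)))"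
    using t by (intro prod.cong) (auto simp: B_def expo_gt expo_le)
  also have "\<dots> = ennreal (1 - exp (- \<mu> * t)) ^ num_failed x * ennreal (exp (- \<mu> * t)) ^ (CARD('c) - num_failed x)"
  proof -
    have "UNIV \<inter> - {i. x i} = {i. \<not> x i}" by auto
    then have "card (UNIV \<inter> - {i. x i}) = num_failed x" by (simp add: num_failed_def)
    moreover have "card (UNIV \<inter> {i. x i}) = CARD('c) - num_failed x" by (simp add: card_working)
    ultimately show ?thesis by (subst prod.If_cases) (simp_all only: finite_class.finite_UNIV prod_constant mult.commute)
  qed
  finally show ?thesis .
qed

text \<open>The same Beta integral as for transitions; here no density contributes a factor
  \<open>\<mu>\<close>, hence the quotient.\<close>

lemma nn_integral_state_at:
  assumes "num_failed x < CARD('c)"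
  shows "(\<integral>\<^sup>+t. emeasure lifetimes {d. state_at d t = x} * indicator {0..} t \<partial>lborel) =
    ennreal (occupancy CARD('c) (num_failed x) / \<mu>)"
proof -
  define a where "a = num_failed x"
  define b where "b = CARD('c) - a"
  have b: "1 \<le> b" "a + b = CARD('c)" using assms by (auto simp: a_def b_def)
  have "(\<integral>\<^sup>+t. emeasure lifetimes {d. state_at d t = x} * indicator {0..} t \<partial>lborel) =
      (\<integral>\<^sup>+t. ennreal (1 / \<mu>) * (ennreal (\<mu> * exp (- \<mu> * t) ^ b * (1 - exp (- \<mu> * t)) ^ a) * indicator {0..} t) \<partial>lborel)"
  proof (rule nn_integral_cong)
    fix t :: real
    show "emeasure lifetimes {d. state_at d t = x} * indicator {0..} t =
      ennreal (1 / \<mu>) * (ennreal (\<mu> * exp (- \<mu> * t) ^ b * (1 - exp (- \<mu> * t)) ^ a) * indicator {0..} t)"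
    proof (cases "0 \<le> t")
      case True
      have e: "0 \<le> 1 - exp (- \<mu> * t)" using True mu_pos by simp
      have "ennreal (1 / \<mu>) * ennreal (\<mu> * exp (- \<mu> * t) ^ b * (1 - exp (- \<mu> * t)) ^ a) =
          ennreal ((1 - exp (- \<mu> * t)) ^ a * exp (- \<mu> * t) ^ b)"
        using mu_pos e by (subst ennreal_mult[symmetric]) (auto simp: mult.commute)
      then show ?thesis
        using True e by (simp add: emeasure_state_at a_def b_def ennreal_power ennreal_mult[symmetric])
    qed simp
  qed
  also have "\<dots> = ennreal (1 / \<mu>) *
      (\<integral>\<^sup>+t. ennreal (\<mu> * exp (- \<mu> * t) ^ b * (1 - exp (- \<mu> * t)) ^ a) * indicator {0..} t \<partial>lborel)"
    by (rule nn_integral_cmult) measurable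
  also have "\<dots> = ennreal (1 / \<mu>) * ennreal (1 / (real b * real ((a + b) choose a)))"
    by (simp only: nn_integral_exp_beta[OF mu_pos b(1)])
  also have "\<dots> = ennreal (occupancy CARD('c) a / \<mu>)"
    unfolding b(2) using mu_pos by (simp add: ennreal_mult[symmetric] occupancy_def b_def)
  finally show ?thesis by (simp add: a_def)
qed

text \<open>The length is the total time that unrepaired components spend in states where no repair
  is due. Fubini and the law of the state at a fixed time turn its mean into a sum over
  states.\<close>

lemma nn_integral_cycle_length:
  "(\<integral>\<^sup>+d. ennreal (cycle_length \<Phi> r d) \<partial>lifetimes) =
    ennreal (1 / \<mu> * (\<Sum>a<r. S_bar \<Phi> a / real (CARD('c) - a)))"
proof -
  interpret pair_sigma_finite lborel lifetimes ..
  have len: "ennreal (cycle_length \<Phi> r d) = (\<integral>\<^sup>+t. indicator {0..} t * indicator {x. \<not> due x} (state_at d t) \<partial>lborel)" for d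
  proof -
    have "ennreal (cycle_length \<Phi> r d) = (\<integral>\<^sup>+t. indicator {0..<cycle_length \<Phi> r d} t \<partial>lborel)"
      using cycle_length_nonneg[of d] by simp
    \<comment> \<open>Along unrepaired components \<open>due\<close> is permanent once reached, so
      the times without it form exactly this interval.\<close>
    also have "\<dots> = (\<integral>\<^sup>+t. indicator {0..} t * indicator {x. \<not> due x} (state_at d t) \<partial>lborel)"
      using cycle_length_le_iff[of d] by (intro nn_integral_cong) (auto simp: indicator_def not_le[symmetric])
    finally show ?thesis .
  qed
  have S[measurable]: "(\<lambda>(t, d). state_at d t) \<in> measurable (borel \<Otimes>\<^sub>M PiM UNIV (\<lambda>_::'c. borel)) (count_space UNIV)"
    by measurable
  have E: "{d. state_at d t = x} \<in> sets lifetimes" for t x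
  proof -
    have "{d \<in> space lifetimes. state_at d t = x} \<in> sets lifetimes" by measurable
    then show ?thesis by simp
  qed
  have "(\<integral>\<^sup>+d. ennreal (cycle_length \<Phi> r d) \<partial>lifetimes) =
      (\<integral>\<^sup>+d. \<integral>\<^sup>+t. indicator {0..} t * indicator {x. \<not> due x} (state_at d t) \<partial>lborel \<partial>lifetimes)"
    by (simp add: len)
  also have "\<dots> = (\<integral>\<^sup>+t. \<integral>\<^sup>+d. indicator {0..} t * indicator {x. \<not> due x} (state_at d t) \<partial>lifetimes \<partial>lborel)"
    by (rule Fubini') measurable
  also have "\<dots> = (\<integral>\<^sup>+t. (\<Sum>x | \<not> due x. emeasure lifetimes {d. state_at d t = x} * indicator {0..} t) \<partial>lborel)"
  proof (rule nn_integral_cong)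
    fix t
    have "indicator {0..} t * indicator {x. \<not> due x} (state_at d t) =
        (\<Sum>x | \<not> due x. indicator {0..} t * indicator {d. state_at d t = x} d :: ennreal)" for d
    proof -
      have "(\<Sum>x | \<not> due x. indicator {0..} t * indicator {d. state_at d t = x} d :: ennreal) =
          (\<Sum>x | \<not> due x. if x = state_at d t then indicator {0..} t else 0)"
        by (rule sum.cong) (auto simp: indicator_def)
      also have "\<dots> = (if state_at d t \<in> {x. \<not> due x} then indicator {0..} t else 0)"
        by (rule sum.delta) simp
      finally show ?thesis by (simp add: indicator_def)
    qed
    then have "(\<integral>\<^sup>+d. indicator {0..} t * indicator {x. \<not> due x} (state_at d t) \<partial>lifetimes) =
        (\<integral>\<^sup>+d. (\<Sum>x | \<not> due x. indicator {0..} t * indicator {d. state_at d t = x} d) \<partial>lifetimes)"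
      by simp
    also have "\<dots> = (\<Sum>x | \<not> due x. indicator {0..} t * emeasure lifetimes {d. state_at d t = x})"
      using E by (subst nn_integral_sum) (auto simp: nn_integral_cmult)
    finally show "(\<integral>\<^sup>+d. indicator {0..} t * indicator {x. \<not> due x} (state_at d t) \<partial>lifetimes) =
        (\<Sum>x | \<not> due x. emeasure lifetimes {d. state_at d t = x} * indicator {0..} t)"
      by (simp add: mult.commute)
  qed
  also have "\<dots> = (\<Sum>x | \<not> due x. \<integral>\<^sup>+t. emeasure lifetimes {d. state_at d t = x} * indicator {0..} t \<partial>lborel)"
  proof (rule nn_integral_sum)
    fix x :: "'c \<Rightarrow> bool"
    \<comment> \<open>Measurability in \<open>t\<close> is read off the explicit formula, valid for
      \<open>t \<ge> 0\<close>; elsewhere the indicator is 0.\<close>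
    have "(\<lambda>t. emeasure lifetimes {d. state_at d t = x} * indicator {0..} t) =
      (\<lambda>t. ennreal (1 - exp (- \<mu> * t)) ^ num_failed x * ennreal (exp (- \<mu> * t)) ^ (CARD('c) - num_failed x) * indicator {0..} t)"
    proof
      fix t :: real
      show "emeasure lifetimes {d. state_at d t = x} * indicator {0..} t =
        ennreal (1 - exp (- \<mu> * t)) ^ num_failed x * ennreal (exp (- \<mu> * t)) ^ (CARD('c) - num_failed x) * indicator {0..} t"
        using emeasure_state_at[of t x] by (cases "0 \<le> t") simp_all
    qed
    then show "(\<lambda>t. emeasure lifetimes {d. state_at d t = x} * indicator {0..} t) \<in> borel_measurable lborel"
      by simp
  qed
  also have "\<dots> = (\<Sum>x | \<not> due x. ennreal (occupancy CARD('c) (num_failed x) / \<mu>))"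
    using r_le_n by (intro sum.cong refl nn_integral_state_at) (auto simp: repair_due_def)
  also have "\<dots> = ennreal (\<Sum>x | \<not> due x. occupancy CARD('c) (num_failed x) / \<mu>)"
    using mu_pos by (intro sum_ennreal) (simp add: occupancy_nonneg)
  also have "(\<Sum>x | \<not> due x. occupancy CARD('c) (num_failed x) / \<mu>) =
      (\<Sum>a<r. real (card (working_states a)) * (occupancy CARD('c) a / \<mu>))"
    by (rule sum_not_due)
  also have "\<dots> = (\<Sum>a<r. 1 / \<mu> * (S_bar \<Phi> a / real (CARD('c) - a)))"
  proof (rule sum.cong[OF refl])
    fix a assume "a \<in> {..<r}"
    then have "a < CARD('c)" using r_le_n by simp
    from occupancy_working_states[OF this]
    show "real (card (working_states a)) * (occupancy CARD('c) a / \<mu>) = 1 / \<mu> * (S_bar \<Phi> a / real (CARD('c) - a))"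
      by (simp add: mult.commute)
  qed
  also have "\<dots> = 1 / \<mu> * (\<Sum>a<r. S_bar \<Phi> a / real (CARD('c) - a))"
    by (rule sum_distrib_left[symmetric])
  finally show ?thesis .
qed

lemma cycle_length_le_Max:
  assumes "\<And>i. 0 < d i"
  shows "\<exists>j. cycle_length \<Phi> r d \<le> d j"
proof -
  have "Max (range d) \<in> range d" by (rule Max_in) auto
  then obtain j where j: "Max (range d) = d j" by (rule imageE)
  have "state_at d (d j) = (\<lambda>_. False)"
    unfolding j[symmetric] by (auto simp: state_at_def not_less)
  then have "cycle_length \<Phi> r d \<le> d j"
    using due_all_failed less_imp_le[OF assms] by (simp add: cycle_length_le_iff)
  then show ?thesis ..
qed

text \<open>The length is at most the largest lifetime, whose powers are dominated by the sum of
  all; the strong law uses \<open>m = 4\<close>.\<close>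

lemma integrable_cycle_length_power: "integrable lifetimes (\<lambda>d. cycle_length \<Phi> r d ^ m)"
proof (rule Bochner_Integration.integrable_bound)
  have "distributed expo lborel (\<lambda>x. x) (exponential_density \<mu>)"
    unfolding distributed_def by (auto simp: expo_def[symmetric] distr_id2)
  then have "integrable expo (\<lambda>x. x ^ m)"
    by (rule expo.erlang_ith_moment_integrable[OF mu_pos])
  then have "integrable (distr lifetimes expo (\<lambda>d. d i)) (\<lambda>x. x ^ m)" for i
    unfolding lifetimes_def by (subst distr_PiM_component) (auto intro: prob_space_expo)
  then have "integrable lifetimes (\<lambda>d. d i ^ m)" for i
    by (rule integrable_distr[rotated]) (simp add: lifetimes_def)
  then show "integrable lifetimes (\<lambda>d. \<Sum>i\<in>UNIV. d i ^ m)" by simp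
  show "AE d in lifetimes. norm (cycle_length \<Phi> r d ^ m) \<le> norm (\<Sum>i\<in>UNIV. d i ^ m)"
    using AE_lifetimes_pos
  proof eventually_elim
    case (elim d)
    then obtain j where "cycle_length \<Phi> r d \<le> d j" using cycle_length_le_Max[of d] by auto
    then have "cycle_length \<Phi> r d ^ m \<le> d j ^ m" by (rule power_mono) (rule cycle_length_nonneg)
    also have "\<dots> \<le> (\<Sum>i\<in>UNIV. d i ^ m)"
      using elim by (intro member_le_sum) (auto intro: less_imp_le)
    finally show ?case using cycle_length_nonneg[of d] by (simp add: power_abs)
  qed
qed measurable

lemma has_bochner_integral_cycle_length:
  "has_bochner_integral lifetimes (cycle_length \<Phi> r) (1 / \<mu> * (\<Sum>a<r. S_bar \<Phi> a / real (CARD('c) - a)))"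
proof (rule has_bochner_integral_nn_integral)
  have "0 \<le> S_bar \<Phi> a" for a by (auto simp: S_bar_def intro!: divide_nonneg_nonneg sum_nonneg)
  then show "0 \<le> 1 / \<mu> * (\<Sum>a<r. S_bar \<Phi> a / real (CARD('c) - a))"
    using mu_pos by (auto intro!: mult_nonneg_nonneg sum_nonneg divide_nonneg_nonneg)
qed (use nn_integral_cycle_length cycle_length_nonneg in auto)

end

section \<open>The repair process\<close>

locale repair_model = exponential_repair \<Phi> r \<mu> + prob_space M
  for \<Phi> :: "('c::finite \<Rightarrow> bool) \<Rightarrow> bool" and r \<mu> and M :: "'a measure" +
  fixes X :: "nat \<Rightarrow> 'c \<Rightarrow> 'a \<Rightarrow> real"
  assumes indep_X: "indep_vars (\<lambda>_. borel) (\<lambda>(k, i). X k i) UNIV"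
    and distr_X: "\<And>k i. distributed M lborel (X k i) (exponential_density \<mu>)"
begin

definition array :: "'a \<Rightarrow> nat \<Rightarrow> 'c \<Rightarrow> real" where
  "array \<omega> = (\<lambda>k i. X k i \<omega>)"

definition cycle_at :: "nat \<Rightarrow> 'a \<Rightarrow> real \<times> ('c \<Rightarrow> bool)" where
  "cycle_at k \<omega> = cycle_data (residual \<Phi> r (array \<omega>) k)"

lemma measurable_X[measurable]: "X k i \<in> borel_measurable M"
  using distributed_measurable[OF distr_X] by simp

lemma measurable_array[measurable]: "array \<in> measurable M arrays"
  unfolding array_def[abs_def] by (intro measurable_PiM_single') (auto simp: space_PiM)

lemma measurable_cycle_at[measurable]: "cycle_at k \<in> measurable M cycle_space"
  unfolding cycle_at_def[abs_def] by measurable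

lemma law_X: "distr M borel (X k i) = expo"
proof -
  have "distr M borel (X k i) = distr M lborel (X k i)" by (rule distr_cong) auto
  then show ?thesis using distr_X[of k i] by (simp add: expo_def distributed_def)
qed

lemma law_row: "distr M (PiM UNIV (\<lambda>_. borel)) (\<lambda>\<omega> i. X k i \<omega>) = lifetimes"
proof -
  have "indep_vars (\<lambda>i. PiM {(k, i)} (\<lambda>_. borel))
      (\<lambda>i \<omega>. \<lambda>p\<in>{(k, i)}. (case p of (k, i) \<Rightarrow> X k i) \<omega>) (UNIV :: 'c set)"
    by (rule indep_vars_restrict[OF indep_X]) (auto simp: disjoint_family_on_def)
  then have "indep_vars (\<lambda>_. borel)
      (\<lambda>i \<omega>. (\<lambda>f. f (k, i)) (\<lambda>p\<in>{(k, i)}. (case p of (k, i) \<Rightarrow> X k i) \<omega>)) (UNIV :: 'c set)"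
    by (rule indep_vars_compose2) auto
  then have "indep_vars (\<lambda>_. borel) (X k) (UNIV :: 'c set)" by simp
  then show ?thesis
    by (subst (asm) indep_vars_iff_distr_eq_PiM) (auto simp: law_X lifetimes_def restrict_UNIV)
qed

text \<open>The independent family is grouped by rows; this carries results about the product
  measure over to \<open>M\<close>.\<close>

lemma law_array: "distr M arrays array = lifetime_seq.S"
proof -
  have "indep_vars (\<lambda>k. PiM ({k} \<times> UNIV) (\<lambda>_. borel))
      (\<lambda>k \<omega>. \<lambda>p\<in>{k} \<times> UNIV. (case p of (k, i) \<Rightarrow> X k i) \<omega>) (UNIV :: nat set)"
    by (rule indep_vars_restrict[OF indep_X]) (auto simp: disjoint_family_on_def)
  then have "indep_vars (\<lambda>_. PiM UNIV (\<lambda>_. borel))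
      (\<lambda>k \<omega>. (\<lambda>f i. f (k, i)) (\<lambda>p\<in>{k} \<times> UNIV. (case p of (k, i) \<Rightarrow> X k i) \<omega>)) (UNIV :: nat set)"
    by (rule indep_vars_compose2) (auto intro!: measurable_PiM_single' simp: space_PiM)
  then have "indep_vars (\<lambda>_. PiM UNIV (\<lambda>_. borel)) (\<lambda>k \<omega> i. X k i \<omega>) (UNIV :: nat set)"
    by simp
  then show ?thesis
    by (subst (asm) indep_vars_iff_distr_eq_PiM)
      (auto simp: law_row array_def[abs_def] restrict_UNIV intro!: measurable_PiM_single')
qed

lemma emeasure_cycles:
  assumes J: "finite J" and B[measurable]: "\<And>k. B k \<in> sets cycle_space"
  shows "emeasure M {\<omega>\<in>space M. \<forall>k\<in>J. cycle_at k \<omega> \<in> B k} = (\<Prod>k\<in>J. emeasure cycle_law (B k))"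
proof -
  obtain m where m: "J \<subseteq> {..<m}" using J by (meson finite_nat_iff_bounded)
  \<comment> \<open>The indices below \<open>m\<close> missing from \<open>J\<close> are filled with
    the whole space, which has probability 1.\<close>
  define B' where "B' k = (if k \<in> J then B k else UNIV)" for k
  have B'[measurable]: "B' k \<in> sets cycle_space" for k
    using sets.top[of cycle_space] by (auto simp: B'_def space_pair_measure)
  have "emeasure M {\<omega>\<in>space M. \<forall>k\<in>J. cycle_at k \<omega> \<in> B k} =
      (\<integral>\<^sup>+\<omega>. indicator {\<omega>\<in>space M. \<forall>k\<in>J. cycle_at k \<omega> \<in> B k} \<omega> \<partial>M)"
    by (rule nn_integral_indicator[symmetric]) (use J in measurable)
  also have "\<dots> = (\<integral>\<^sup>+\<omega>. (\<Prod>k<m. indicator (B' k) (cycle_data (residual \<Phi> r (array \<omega>) k))) \<partial>M)"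
  proof (rule nn_integral_cong)
    fix \<omega> assume \<omega>: "\<omega> \<in> space M"
    show "indicator {\<omega>\<in>space M. \<forall>k\<in>J. cycle_at k \<omega> \<in> B k} \<omega> =
        (\<Prod>k<m. indicator (B' k) (cycle_data (residual \<Phi> r (array \<omega>) k)) :: ennreal)"
    proof (cases "\<forall>k\<in>J. cycle_at k \<omega> \<in> B k")
      case True
      then show ?thesis using \<omega> by (auto simp: B'_def cycle_at_def intro!: prod.neutral[symmetric])
    next
      case False
      then obtain k where "k \<in> J" "cycle_at k \<omega> \<notin> B k" by auto
      then have "(\<Prod>k<m. indicator (B' k) (cycle_data (residual \<Phi> r (array \<omega>) k)) :: ennreal) = 0"
        using m by (intro prod_zero bexI[of _ k]) (auto simp: B'_def cycle_at_def)
      then show ?thesis using False by (auto simp: indicator_def)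
    qed
  qed
  also have "\<dots> = (\<integral>\<^sup>+L. (\<Prod>k<m. indicator (B' k) (cycle_data (residual \<Phi> r L k))) \<partial>distr M arrays array)"
    by (rule nn_integral_distr[symmetric]) measurable
  also have "\<dots> = (\<Prod>k<m. emeasure cycle_law (B' k))"
    unfolding law_array by (rule nn_integral_cycles) measurable
  also have "\<dots> = (\<Prod>k\<in>J. emeasure cycle_law (B k))"
  proof (rule prod.mono_neutral_cong_right)
    have "emeasure cycle_law UNIV = 1"
      using cycle_law.emeasure_space_1 by (simp add: cycle_law_def space_pair_measure)
    then show "\<forall>k\<in>{..<m} - J. emeasure cycle_law (B' k) = 1" by (simp add: B'_def)
  qed (use m in \<open>auto simp: B'_def\<close>)
  finally show ?thesis .
qed

lemma law_cycle_at: "distr M cycle_space (cycle_at k) = cycle_law"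
proof (rule measure_eqI)
  fix A assume "A \<in> sets (distr M cycle_space (cycle_at k))"
  then have A[measurable]: "A \<in> sets cycle_space" by simp
  have "emeasure (distr M cycle_space (cycle_at k)) A = emeasure M {\<omega>\<in>space M. \<forall>j\<in>{k}. cycle_at j \<omega> \<in> A}"
    by (subst emeasure_distr) (auto intro!: arg_cong[where f="emeasure M"])
  also have "\<dots> = emeasure cycle_law A"
    by (subst emeasure_cycles[where B = "\<lambda>_. A"]) auto
  finally show "emeasure (distr M cycle_space (cycle_at k)) A = emeasure cycle_law A" .
qed simp

text \<open>\<open>emeasure_cycles\<close> yields the joint probabilities and, for singletons
  \<open>J\<close>, the marginal ones.\<close>

lemma indep_cycle_at: "indep_vars (\<lambda>_. cycle_space) cycle_at UNIV"
  unfolding indep_vars_def2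
proof (intro conjI ballI indep_setsI)
  fix A :: "nat \<Rightarrow> 'a set" and J :: "nat set"
  assume J: "J \<noteq> {}" "finite J" and "\<forall>j\<in>J. A j \<in> {cycle_at j -` A \<inter> space M |A. A \<in> sets cycle_space}"
  then have "\<forall>j\<in>J. \<exists>B. B \<in> sets cycle_space \<and> A j = cycle_at j -` B \<inter> space M" by auto
  then obtain B0 where B0: "\<And>j. j \<in> J \<Longrightarrow> B0 j \<in> sets cycle_space" "\<And>j. j \<in> J \<Longrightarrow> A j = cycle_at j -` B0 j \<inter> space M"
    by metis
  define B where "B j = (if j \<in> J then B0 j else {})" for j
  have B[measurable]: "B j \<in> sets cycle_space" for j using B0 by (auto simp: B_def)
  have AB: "A j = {\<omega>\<in>space M. \<forall>k\<in>{j}. cycle_at k \<omega> \<in> B k}" if "j \<in> J" for j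
    using B0(2)[OF that] that by (auto simp: B_def)
  have "(\<Inter>j\<in>J. A j) = {\<omega>\<in>space M. \<forall>k\<in>J. cycle_at k \<omega> \<in> B k}"
    using J AB by auto
  then have "emeasure M (\<Inter>j\<in>J. A j) = (\<Prod>j\<in>J. emeasure cycle_law (B j))"
    using emeasure_cycles[OF J(2) B] by simp
  also have "\<dots> = (\<Prod>j\<in>J. emeasure M (A j))"
    by (intro prod.cong refl) (subst AB, assumption, subst emeasure_cycles, auto)
  finally show "prob (\<Inter>j\<in>J. A j) = (\<Prod>j\<in>J. prob (A j))"
    by (simp add: emeasure_eq_measure prod_ennreal prod_nonneg)
qed auto

lemma AE_array_pos: "AE \<omega> in M. \<forall>k i. 0 < array \<omega> k i"
proof -
  have "AE \<omega> in M. 0 < X k i \<omega>" for k i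
    using AE_expo_pos unfolding law_X[of k i, symmetric] by (subst (asm) AE_distr_iff) auto
  then show ?thesis unfolding array_def by (simp add: AE_all_countable)
qed

text \<open>Every cycle has the law of one started from fresh lifetimes, so its expectations are
  computed under \<open>lifetimes\<close>.\<close>

lemma has_bochner_integral_cycle_at:
  fixes g :: "real \<times> ('c \<Rightarrow> bool) \<Rightarrow> real"
  assumes [measurable]: "g \<in> borel_measurable cycle_space"
  shows "has_bochner_integral M (\<lambda>\<omega>. g (cycle_at k \<omega>)) x \<longleftrightarrow>
    has_bochner_integral lifetimes (\<lambda>d. g (cycle_data d)) x"
proof -
  have "distr M cycle_space (cycle_at k) = distr lifetimes cycle_space cycle_data"
    unfolding law_cycle_at cycle_law_def ..
  then have "has_bochner_integral (distr M cycle_space (cycle_at k)) g x \<longleftrightarrow>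
      has_bochner_integral (distr lifetimes cycle_space cycle_data) g x" by (simp only:)
  then show ?thesis
    by (simp add: has_bochner_integral_iff integrable_distr_eq integral_distr)
qed

section \<open>Means per cycle and the geometric weights\<close>

definition mean_length :: real where
  "mean_length = 1 / \<mu> * (\<Sum>a<r. S_bar \<Phi> a / real (CARD('c) - a))"

definition mean_cost :: "(nat \<Rightarrow> real) \<Rightarrow> real \<Rightarrow> real" where
  "mean_cost c_cmp c_sys = (\<Sum>k=1..r. struct_signature \<Phi> k * (c_sys + c_cmp k))
      + (\<Sum>k=r+1..CARD('c). struct_signature \<Phi> k) * c_cmp r"

definition failure_prob :: real where
  "failure_prob = (\<Sum>k=1..r. struct_signature \<Phi> k)"

lemma has_bochner_integral_length: "has_bochner_integral M (\<lambda>\<omega>. fst (cycle_at k \<omega>)) mean_length"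
  using has_bochner_integral_cycle_at[of fst k] has_bochner_integral_cycle_length
  by (simp add: mean_length_def cycle_data_def)

lemma has_bochner_integral_cost:
  "has_bochner_integral M (\<lambda>\<omega>. repair_cost \<Phi> c_cmp c_sys (snd (cycle_at k \<omega>))) (mean_cost c_cmp c_sys)"
  using has_bochner_integral_cycle_at[of "\<lambda>z. repair_cost \<Phi> c_cmp c_sys (snd z)" k]
    has_bochner_integral_final_state[of "repair_cost \<Phi> c_cmp c_sys"]
  by (simp add: mean_cost_def sum_transitions cycle_data_def)

text \<open>With zero component costs and \<open>c_sys = 1\<close> a repair costs the indicator of
  system failure, so the cost formula already contains this probability.\<close>

lemma has_bochner_integral_failure:
  "has_bochner_integral M (\<lambda>\<omega>. of_bool (\<not> \<Phi> (snd (cycle_at k \<omega>)))) failure_prob"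
proof -
  have "mean_cost (\<lambda>_. 0) 1 = failure_prob" by (simp add: mean_cost_def failure_prob_def)
  moreover have "repair_cost \<Phi> (\<lambda>_. 0) 1 x = of_bool (\<not> \<Phi> x)" for x
    by (simp add: repair_cost_def)
  ultimately show ?thesis using has_bochner_integral_cost[of "\<lambda>_. 0" 1 k] by simp
qed

lemma failure_prob_bounds: "0 \<le> failure_prob" "failure_prob \<le> 1"
proof -
  have "failure_prob = expectation (\<lambda>\<omega>. of_bool (\<not> \<Phi> (snd (cycle_at 0 \<omega>))))"
    using has_bochner_integral_failure[of 0] by (simp add: has_bochner_integral_iff)
  moreover have "expectation (\<lambda>\<omega>. of_bool (\<not> \<Phi> (snd (cycle_at 0 \<omega>)))) \<le> expectation (\<lambda>_. 1 :: real)"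
    using has_bochner_integral_failure[of 0]
    by (intro Bochner_Integration.integral_mono) (auto simp: has_bochner_integral_iff)
  ultimately show "0 \<le> failure_prob" "failure_prob \<le> 1" by (simp_all add: prob_space)
qed

text \<open>A vanishing mean would make the nonnegative length vanish almost surely, against
  positive lifetimes. Positivity is needed for the divisor in the renewal limit.\<close>

lemma mean_length_pos: "0 < mean_length"
proof -
  have l: "integrable M (\<lambda>\<omega>. fst (cycle_at 0 \<omega>))" "expectation (\<lambda>\<omega>. fst (cycle_at 0 \<omega>)) = mean_length"
    using has_bochner_integral_length[of 0] by (auto simp: has_bochner_integral_iff)
  have nn: "0 \<le> fst (cycle_at 0 \<omega>)" for \<omega> by (simp add: cycle_at_def cycle_data_def cycle_length_nonneg)
  have "0 \<le> mean_length" unfolding l(2)[symmetric] using nn by (intro Bochner_Integration.integral_nonneg) auto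
  moreover have "mean_length \<noteq> 0"
  proof
    assume "mean_length = 0"
    then have "AE \<omega> in M. fst (cycle_at 0 \<omega>) = 0"
      using integral_nonneg_eq_0_iff_AE[OF l(1)] nn l(2) by simp
    with AE_array_pos have "AE \<omega> in M. False"
    proof eventually_elim
      case (elim \<omega>)
      then show False using cycle_length_pos[of "array \<omega> 0"] by (simp add: cycle_at_def cycle_data_def)
    qed
    then show False by simp
  qed
  ultimately show ?thesis by simp
qed

lemma before_failure_iff: "before_failure (array \<omega>) k \<longleftrightarrow> (\<forall>j<k. \<Phi> (snd (cycle_at j \<omega>)))"
  by (simp add: before_failure_def cycle_at_def cycle_data_def)

text \<open>Cycle \<open>k\<close> is independent of the survival of the \<open>k\<close> cycles
  before it; this makes the termwise expectations geometric.\<close>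

lemma has_bochner_integral_before_failure:
  fixes g :: "real \<times> ('c \<Rightarrow> bool) \<Rightarrow> real"
  assumes [measurable]: "g \<in> borel_measurable cycle_space"
    and g: "has_bochner_integral M (\<lambda>\<omega>. g (cycle_at k \<omega>)) x"
  shows "has_bochner_integral M (\<lambda>\<omega>. of_bool (before_failure (array \<omega>) k) * g (cycle_at k \<omega>))
    ((1 - failure_prob) ^ k * x)"
proof -
  \<comment> \<open>One family of independent factors covers both parts: survival for
    \<open>j < k\<close>, the quantity itself at \<open>j = k\<close>.\<close>
  define h where "h j z = (if j < k then of_bool (\<Phi> (snd z)) else g z)" for j and z :: "real \<times> ('c \<Rightarrow> bool)"
  have h[measurable]: "h j \<in> borel_measurable cycle_space" for j
    unfolding h_def[abs_def] by (cases "j < k") simp_all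
  have "indep_vars (\<lambda>_. borel) (\<lambda>j \<omega>. h j (cycle_at j \<omega>)) UNIV"
    by (rule indep_vars_compose2[OF indep_cycle_at]) (rule h)
  then have ind: "indep_vars (\<lambda>_. borel) (\<lambda>j \<omega>. h j (cycle_at j \<omega>)) {..<Suc k}"
    by (rule indep_vars_subset) simp
  have hb: "has_bochner_integral M (\<lambda>\<omega>. h j (cycle_at j \<omega>)) (if j < k then 1 - failure_prob else x)"
    if "j < Suc k" for j
  proof (cases "j < k")
    case True
    have "has_bochner_integral M (\<lambda>\<omega>. 1 - of_bool (\<not> \<Phi> (snd (cycle_at j \<omega>)))) (1 - failure_prob)"
      using has_bochner_integral_diff[OF _ has_bochner_integral_failure[of j], of "\<lambda>_. 1" 1]
      by (simp add: has_bochner_integral_iff prob_space)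
    moreover have "1 - of_bool (\<not> \<Phi> (snd (cycle_at j \<omega>))) = h j (cycle_at j \<omega>)" for \<omega>
      using True by (simp add: h_def)
    ultimately show ?thesis using True by simp
  next
    case False
    then have "j = k" using that by simp
    then show ?thesis using g by (simp add: h_def)
  qed
  have int: "integrable M (\<lambda>\<omega>. h j (cycle_at j \<omega>))" if "j \<in> {..<Suc k}" for j
    using hb[of j] that by (simp add: has_bochner_integral_iff)
  have "has_bochner_integral M (\<lambda>\<omega>. \<Prod>j\<in>{..<Suc k}. h j (cycle_at j \<omega>))
      (\<Prod>j\<in>{..<Suc k}. expectation (\<lambda>\<omega>. h j (cycle_at j \<omega>)))"
    unfolding has_bochner_integral_iff
    using indep_vars_integrable[OF _ ind int] indep_vars_lebesgue_integral[OF _ ind int] by simp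
  also have "(\<Prod>j\<in>{..<Suc k}. expectation (\<lambda>\<omega>. h j (cycle_at j \<omega>))) = (1 - failure_prob) ^ k * x"
    using hb by (simp add: has_bochner_integral_iff)
  also have "(\<lambda>\<omega>. \<Prod>j\<in>{..<Suc k}. h j (cycle_at j \<omega>)) = (\<lambda>\<omega>. of_bool (before_failure (array \<omega>) k) * g (cycle_at k \<omega>))"
  proof
    fix \<omega>
    have "(\<Prod>j<k. h j (cycle_at j \<omega>)) = of_bool (before_failure (array \<omega>) k)"
    proof (cases "before_failure (array \<omega>) k")
      case True
      then show ?thesis by (simp add: h_def before_failure_iff)
    next
      case False
      then obtain j where "j < k" "\<not> \<Phi> (snd (cycle_at j \<omega>))" by (auto simp: before_failure_iff)
      then have "(\<Prod>j<k. h j (cycle_at j \<omega>)) = 0" by (intro prod_zero) (auto simp: h_def)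
      then show ?thesis using False by simp
    qed
    then show "(\<Prod>j\<in>{..<Suc k}. h j (cycle_at j \<omega>)) = of_bool (before_failure (array \<omega>) k) * g (cycle_at k \<omega>)"
      by (simp add: h_def)
  qed
  finally show ?thesis .
qed

lemma measurable_repair_time[measurable]: "(\<lambda>\<omega>. repair_time \<Phi> r (array \<omega>) k) \<in> borel_measurable M"
  unfolding repair_time_eq by measurable

text \<open>The index set of the infimum depends on \<open>\<omega>\<close>; giving the value
  infinity to cycles without failure makes it an infimum over all \<open>k\<close>.\<close>

lemma measurable_fail_time[measurable]: "(\<lambda>\<omega>. fail_time \<Phi> r (array \<omega>)) \<in> borel_measurable M"
proof -
  have "fail_time \<Phi> r (array \<omega>) = (INF k. if \<Phi> (snd (cycle_at k \<omega>)) then \<infinity> else ennreal (repair_time \<Phi> r (array \<omega>) (Suc k)))" for \<omega>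
    unfolding fail_time_eq cycle_at_def cycle_data_def snd_conv
  proof (rule antisym)
    let ?K = "{k. \<not> \<Phi> (final_state \<Phi> r (residual \<Phi> r (array \<omega>) k))}"
    let ?R = "\<lambda>k. ennreal (repair_time \<Phi> r (array \<omega>) (Suc k))"
    let ?f = "\<lambda>k. if \<Phi> (final_state \<Phi> r (residual \<Phi> r (array \<omega>) k)) then \<infinity> else ?R k"
    show "(INF k\<in>?K. ?R k) \<le> (INF k. ?f k)"
    proof (rule INF_greatest)
      fix k
      show "(INF k\<in>?K. ?R k) \<le> ?f k"
      proof (cases "k \<in> ?K")
        case True
        then have "?f k = ?R k" by simp
        with INF_lower[OF True, of ?R] show ?thesis by (simp only:)
      next
        case False
        then have "?f k = \<infinity>" by simp
        then show ?thesis by (simp only: infinity_ennreal_def top_greatest)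
      qed
    qed
    show "(INF k. ?f k) \<le> (INF k\<in>?K. ?R k)"
    proof (rule INF_greatest)
      fix k assume "k \<in> ?K"
      then have "?f k = ?R k" by simp
      moreover have "(INF k. ?f k) \<le> ?f k" by (rule INF_lower) simp
      ultimately show "(INF k. ?f k) \<le> ?R k" by (simp only:)
    qed
  qed
  moreover have "(\<lambda>\<omega>. INF k. if \<Phi> (snd (cycle_at k \<omega>)) then \<infinity> else ennreal (repair_time \<Phi> r (array \<omega>) (Suc k)))
      \<in> borel_measurable M"
    by measurable
  ultimately show ?thesis by (simp only:)
qed

text \<open>The set of repairs up to a random time is random, but it is either the initial segment
  before the first repair later than \<open>T\<close> or everything.\<close>

lemma measurable_total_cost:
  assumes [measurable]: "T \<in> borel_measurable M"
  shows "(\<lambda>\<omega>. total_cost \<Phi> r c_cmp c_sys (array \<omega>) (T \<omega>)) \<in> borel_measurable M"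
proof -
  define P where "P k \<omega> \<longleftrightarrow> \<not> ennreal (repair_time \<Phi> r (array \<omega>) (Suc k)) \<le> T \<omega>" for k \<omega>
  have [measurable]: "Measurable.pred M (P k)" for k unfolding P_def[abs_def] by measurable
  define N where "N \<omega> = (LEAST k. P k \<omega>)" for \<omega>
  have N[measurable]: "N \<in> measurable M (count_space UNIV)" unfolding N_def[abs_def] by measurable
  define c where "c k \<omega> = repair_cost \<Phi> c_cmp c_sys (snd (cycle_at k \<omega>))" for k \<omega>
  have [measurable]: "c k \<in> borel_measurable M" for k
    using has_bochner_integral_cost[of c_cmp c_sys k] unfolding c_def[abs_def] by (auto simp: has_bochner_integral_iff)
  have "total_cost \<Phi> r c_cmp c_sys (array \<omega>) (T \<omega>) = (if \<exists>k. P k \<omega> then \<Sum>k<N \<omega>. c k \<omega> else 0)" for \<omega>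
  proof -
    have tc: "total_cost \<Phi> r c_cmp c_sys (array \<omega>) (T \<omega>) = (\<Sum>k | \<not> P k \<omega>. c k \<omega>)"
      by (simp add: total_cost_def P_def c_def state_before_repair cycle_at_def cycle_data_def)
    show ?thesis
    proof (cases "\<exists>k. P k \<omega>")
      case True
      then have "P (N \<omega>) \<omega>" unfolding N_def by (rule LeastI_ex)
      have mono: "P k \<omega>" if "N \<omega> \<le> k" for k
        using \<open>P (N \<omega>) \<omega>\<close> ennreal_leI[OF incseqD[OF incseq_repair_time, of "Suc (N \<omega>)" "Suc k"], of "array \<omega>"] that
        unfolding P_def by (meson Suc_le_mono order_trans)
      have "{k. \<not> P k \<omega>} = {..<N \<omega>}"
        using mono not_less_Least[of _ "\<lambda>k. P k \<omega>"] by (auto simp: N_def[symmetric] not_le[symmetric])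
      then show ?thesis using True tc by simp
    next
      \<comment> \<open>A sum over an infinite set is 0 by convention, matching the
        \<open>else\<close> branch.\<close>
      case False
      then have "{k. \<not> P k \<omega>} = UNIV" by auto
      then show ?thesis using False tc by simp
    qed
  qed
  moreover have "(\<lambda>\<omega>. \<Sum>k<N \<omega>. c k \<omega>) \<in> borel_measurable M"
    by (rule measurable_compose_countable[OF _ N]) measurable
  ultimately show ?thesis by simp
qed

section \<open>First repair, first failure and long-run cost\<close>

lemma prob_first_repair_failure:
  "measure M {\<omega> \<in> space M. ennreal (first_repair_time \<Phi> r (array \<omega>)) = fail_time \<Phi> r (array \<omega>)} = failure_prob"
proof -
  have fr: "first_repair_time \<Phi> r (array \<omega>) = repair_time \<Phi> r (array \<omega>) 1" for \<omega>
    by (simp add: first_repair_time_def)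
  have "measure M {\<omega> \<in> space M. ennreal (first_repair_time \<Phi> r (array \<omega>)) = fail_time \<Phi> r (array \<omega>)} =
      measure M {\<omega> \<in> space M. \<not> \<Phi> (snd (cycle_at 0 \<omega>))}"
  proof (rule finite_measure_eq_AE)
    show "AE \<omega> in M. (\<omega> \<in> {\<omega> \<in> space M. ennreal (first_repair_time \<Phi> r (array \<omega>)) = fail_time \<Phi> r (array \<omega>)}) \<longleftrightarrow>
        (\<omega> \<in> {\<omega> \<in> space M. \<not> \<Phi> (snd (cycle_at 0 \<omega>))})"
      using AE_array_pos
      by eventually_elim (auto simp: first_repair_eq_fail_time_iff cycle_at_def cycle_data_def)
  qed (unfold fr, measurable)
  also have "\<dots> = expectation (\<lambda>\<omega>. indicator {\<omega> \<in> space M. \<not> \<Phi> (snd (cycle_at 0 \<omega>))} \<omega>)"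
    by simp
  also have "\<dots> = expectation (\<lambda>\<omega>. of_bool (\<not> \<Phi> (snd (cycle_at 0 \<omega>))))"
    by (rule Bochner_Integration.integral_cong) (auto simp: indicator_def)
  finally show ?thesis
    using has_bochner_integral_failure[of 0] by (simp add: has_bochner_integral_iff)
qed

lemma has_bochner_integral_first_repair_time:
  "has_bochner_integral M (\<lambda>\<omega>. first_repair_time \<Phi> r (array \<omega>)) mean_length"
  using has_bochner_integral_length[of 0] by (simp add: first_repair_time_eq cycle_at_def cycle_data_def)

lemma has_bochner_integral_cost_first_repair:
  "has_bochner_integral M (\<lambda>\<omega>. total_cost \<Phi> r c_cmp c_sys (array \<omega>) (ennreal (first_repair_time \<Phi> r (array \<omega>))))
    (mean_cost c_cmp c_sys)"
proof (subst has_bochner_integral_cong_AE)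
  show "(\<lambda>\<omega>. total_cost \<Phi> r c_cmp c_sys (array \<omega>) (ennreal (first_repair_time \<Phi> r (array \<omega>)))) \<in> borel_measurable M"
    by (intro measurable_total_cost) (simp add: first_repair_time_def)
  show "AE \<omega> in M. total_cost \<Phi> r c_cmp c_sys (array \<omega>) (ennreal (first_repair_time \<Phi> r (array \<omega>))) =
      repair_cost \<Phi> c_cmp c_sys (snd (cycle_at 0 \<omega>))"
    using AE_array_pos by eventually_elim (simp add: total_cost_first_repair cycle_at_def cycle_data_def)
qed (use has_bochner_integral_cost[of c_cmp c_sys 0] in \<open>auto simp: has_bochner_integral_iff\<close>)

text \<open>Survival of \<open>k\<close> cycles has probability
  \<open>(1 - failure_prob) ^ k\<close>, which tends to 0.\<close>

lemma AE_failure: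
  assumes p: "0 < failure_prob"
  shows "AE \<omega> in M. \<exists>k. \<not> \<Phi> (final_state \<Phi> r (residual \<Phi> r (array \<omega>) k))"
proof -
  define A where "A = {\<omega> \<in> space M. \<forall>k. \<Phi> (snd (cycle_at k \<omega>))}"
  have A[measurable]: "A \<in> sets M" unfolding A_def by measurable
  have "prob A \<le> (1 - failure_prob) ^ k" for k
  proof -
    have hb: "has_bochner_integral M (\<lambda>\<omega>. of_bool (before_failure (array \<omega>) k)) ((1 - failure_prob) ^ k)"
    proof -
      have "has_bochner_integral M (\<lambda>\<omega>. 1 :: real) 1"
        by (simp add: has_bochner_integral_iff prob_space)
      from has_bochner_integral_before_failure[where g = "\<lambda>_. 1" and k = k, OF _ this]
      show ?thesis by simp
    qed
    have "prob A = expectation (indicator A)" by simp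
    also have "\<dots> \<le> expectation (\<lambda>\<omega>. of_bool (before_failure (array \<omega>) k))"
      using hb integrable_real_indicator[OF A]
      by (intro Bochner_Integration.integral_mono)
        (auto simp: has_bochner_integral_iff A_def before_failure_iff indicator_def emeasure_eq_measure)
    also have "\<dots> = (1 - failure_prob) ^ k" using hb by (simp add: has_bochner_integral_iff)
    finally show ?thesis .
  qed
  moreover have "(\<lambda>k. (1 - failure_prob) ^ k) \<longlonglongrightarrow> 0"
    using p failure_prob_bounds by (intro LIMSEQ_power_zero) simp
  ultimately have "prob A \<le> 0" by (meson LIMSEQ_le_const)
  then have "prob A = 0" by (simp add: measure_le_0_iff)
  then have "AE \<omega> in M. \<omega> \<notin> A" by (simp add: AE_iff_measurable[OF A] emeasure_eq_measure A_def)
  with AE_space show ?thesis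
    by eventually_elim (auto simp: A_def cycle_at_def cycle_data_def)
qed

lemma failure_prob_sums:
  assumes "0 < failure_prob"
  shows "(\<lambda>k. (1 - failure_prob) ^ k * x) sums (x / failure_prob)"
  using sums_mult2[OF geometric_sums[of "1 - failure_prob"], of x] assms failure_prob_bounds
  by simp

text \<open>Wald's identity by monotone convergence: cycle \<open>k\<close> counts with weight
  \<open>(1 - failure_prob) ^ k\<close>, and the geometric series gives the division by
  \<open>failure_prob\<close>.\<close>

lemma nn_integral_fail_time:
  assumes p: "0 < failure_prob"
  shows "(\<integral>\<^sup>+\<omega>. fail_time \<Phi> r (array \<omega>) \<partial>M) = ennreal (mean_length / failure_prob)"
proof -
  have nn: "0 \<le> fst (cycle_at k \<omega>)" for k \<omega> by (simp add: cycle_at_def cycle_data_def cycle_length_nonneg)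
  have "(\<integral>\<^sup>+\<omega>. fail_time \<Phi> r (array \<omega>) \<partial>M) =
      (\<integral>\<^sup>+\<omega>. (\<Sum>k. ennreal (of_bool (before_failure (array \<omega>) k) * fst (cycle_at k \<omega>))) \<partial>M)"
  proof (rule nn_integral_cong_AE, use AE_failure[OF p] AE_array_pos in eventually_elim)
    case (elim \<omega>)
    then have "fail_time \<Phi> r (array \<omega>) = (\<Sum>k. of_bool (before_failure (array \<omega>) k) *
        ennreal (cycle_length \<Phi> r (residual \<Phi> r (array \<omega>) k)))"
      by (intro fail_time_suminf) auto
    also have "\<dots> = (\<Sum>k. ennreal (of_bool (before_failure (array \<omega>) k) * fst (cycle_at k \<omega>)))"
      by (intro suminf_cong) (simp add: cycle_at_def cycle_data_def of_bool_def)
    finally show ?case .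
  qed
  also have "\<dots> = (\<Sum>k. \<integral>\<^sup>+\<omega>. ennreal (of_bool (before_failure (array \<omega>) k) * fst (cycle_at k \<omega>)) \<partial>M)"
    unfolding before_failure_iff by (rule nn_integral_suminf) measurable
  also have "\<dots> = (\<Sum>k. ennreal ((1 - failure_prob) ^ k * mean_length))"
  proof (rule suminf_cong)
    fix k
    have "has_bochner_integral M (\<lambda>\<omega>. of_bool (before_failure (array \<omega>) k) * fst (cycle_at k \<omega>)) ((1 - failure_prob) ^ k * mean_length)"
      by (rule has_bochner_integral_before_failure[OF _ has_bochner_integral_length]) measurable
    then show "(\<integral>\<^sup>+\<omega>. ennreal (of_bool (before_failure (array \<omega>) k) * fst (cycle_at k \<omega>)) \<partial>M) =
        ennreal ((1 - failure_prob) ^ k * mean_length)"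
      using nn by (subst nn_integral_eq_integral) (auto simp: has_bochner_integral_iff)
  qed
  also have "\<dots> = ennreal (mean_length / failure_prob)"
    using failure_prob_sums[OF p, of mean_length] mean_length_pos failure_prob_bounds
    by (intro suminf_ennreal_eq) auto
  finally show ?thesis .
qed

text \<open>Costs may be negative, so sum and expectation are exchanged by absolute instead of
  monotone convergence.\<close>

lemma has_bochner_integral_cost_fail_time:
  assumes p: "0 < failure_prob"
  shows "has_bochner_integral M (\<lambda>\<omega>. total_cost \<Phi> r c_cmp c_sys (array \<omega>) (fail_time \<Phi> r (array \<omega>)))
    (mean_cost c_cmp c_sys / failure_prob)"
proof -
  define g where "g z = repair_cost \<Phi> c_cmp c_sys (snd z)" for z :: "real \<times> ('c \<Rightarrow> bool)"
  have [measurable]: "g \<in> borel_measurable cycle_space" unfolding g_def[abs_def] by measurable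
  define f where "f k \<omega> = of_bool (before_failure (array \<omega>) k) * g (cycle_at k \<omega>)" for k \<omega>
  have f: "has_bochner_integral M (f k) ((1 - failure_prob) ^ k * mean_cost c_cmp c_sys)" for k
    unfolding f_def[abs_def]
    by (rule has_bochner_integral_before_failure) (simp_all add: has_bochner_integral_cost g_def)
  \<comment> \<open>\<open>m\<close> is the mean absolute cost, the same for all cycles; it makes
    the series of mean norms geometric.\<close>
  obtain m where m: "\<And>k. has_bochner_integral M (\<lambda>\<omega>. norm (g (cycle_at k \<omega>))) m"
  proof
    fix k
    show "has_bochner_integral M (\<lambda>\<omega>. norm (g (cycle_at k \<omega>))) (integral\<^sup>L lifetimes (\<lambda>d. norm (g (cycle_data d))))"
      using has_bochner_integral_final_state[of "\<lambda>x. norm (repair_cost \<Phi> c_cmp c_sys x)"]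
      by (subst has_bochner_integral_cycle_at) (auto simp: g_def cycle_data_def has_bochner_integral_iff)
  qed
  have nf: "has_bochner_integral M (\<lambda>\<omega>. norm (f k \<omega>)) ((1 - failure_prob) ^ k * m)" for k
    using has_bochner_integral_before_failure[OF _ m, of k] by (simp add: f_def abs_mult)
  have AE_f: "AE \<omega> in M. total_cost \<Phi> r c_cmp c_sys (array \<omega>) (fail_time \<Phi> r (array \<omega>)) = (\<Sum>k. f k \<omega>) \<and>
      summable (\<lambda>k. norm (f k \<omega>))"
    using AE_failure[OF p] AE_array_pos
  proof eventually_elim
    case (elim \<omega>)
    then show ?case
      using total_cost_fail_time[of "array \<omega>" c_cmp c_sys] unfolding f_def g_def cycle_at_def cycle_data_def by simp
  qed
  have int: "integrable M (f k)" for k using f[of k] by (simp add: has_bochner_integral_iff)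
  have summ: "AE \<omega> in M. summable (\<lambda>k. norm (f k \<omega>))" using AE_f by eventually_elim simp
  have summ': "summable (\<lambda>k. \<integral>\<omega>. norm (f k \<omega>) \<partial>M)"
    using nf failure_prob_sums[OF p, of m] by (simp add: has_bochner_integral_iff sums_iff)
  have "has_bochner_integral M (\<lambda>\<omega>. \<Sum>k. f k \<omega>) (mean_cost c_cmp c_sys / failure_prob)"
    unfolding has_bochner_integral_iff
    using integrable_suminf[OF int summ summ'] integral_suminf[OF int summ summ'] f
      failure_prob_sums[OF p, of "mean_cost c_cmp c_sys"]
    by (simp add: has_bochner_integral_iff sums_iff)
  moreover have "(\<lambda>\<omega>. \<Sum>k. f k \<omega>) \<in> borel_measurable M"
    using int by measurable
  ultimately show ?thesis
    using AE_f by (subst has_bochner_integral_cong_AE) (auto intro: measurable_total_cost elim: AE_mp)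
qed

text \<open>The strong laws for lengths and costs hold on a common event of probability 1, where the
  deterministic renewal lemma applies.\<close>

lemma long_run_cost:
  "AE \<omega> in M. ((\<lambda>t. total_cost \<Phi> r c_cmp c_sys (array \<omega>) (ennreal t) / t) \<longlongrightarrow>
    mean_cost c_cmp c_sys / mean_length) at_top"
proof -
  have law: "distr M borel (\<lambda>\<omega>. g (cycle_at k \<omega>)) = distr M borel (\<lambda>\<omega>. g (cycle_at 0 \<omega>))"
    if [measurable]: "g \<in> borel_measurable cycle_space" for g :: "real \<times> ('c \<Rightarrow> bool) \<Rightarrow> real" and k
    using distr_distr[of g cycle_space borel "cycle_at k" M] distr_distr[of g cycle_space borel "cycle_at 0" M]
    by (simp add: law_cycle_at comp_def)
  have 1: "AE \<omega> in M. (\<lambda>m. (\<Sum>k<m. fst (cycle_at k \<omega>)) / real m) \<longlonglongrightarrow> expectation (\<lambda>\<omega>. fst (cycle_at 0 \<omega>))"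
  proof (rule strong_law_fourth_moment_iid)
    show "indep_vars (\<lambda>_. borel) (\<lambda>k \<omega>. fst (cycle_at k \<omega>)) UNIV"
      by (rule indep_vars_compose2[OF indep_cycle_at]) measurable
    show "integrable M (\<lambda>\<omega>. fst (cycle_at 0 \<omega>) ^ 4)"
      using has_bochner_integral_cycle_at[of "\<lambda>z. fst z ^ 4" 0] integrable_cycle_length_power[of 4]
      by (auto simp: cycle_data_def has_bochner_integral_iff)
  qed (rule law, measurable)
  have 2: "AE \<omega> in M. (\<lambda>m. (\<Sum>k<m. repair_cost \<Phi> c_cmp c_sys (snd (cycle_at k \<omega>))) / real m) \<longlonglongrightarrow>
      expectation (\<lambda>\<omega>. repair_cost \<Phi> c_cmp c_sys (snd (cycle_at 0 \<omega>)))"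
  proof (rule strong_law_fourth_moment_iid)
    show "indep_vars (\<lambda>_. borel) (\<lambda>k \<omega>. repair_cost \<Phi> c_cmp c_sys (snd (cycle_at k \<omega>))) UNIV"
      by (rule indep_vars_compose2[OF indep_cycle_at]) measurable
    show "integrable M (\<lambda>\<omega>. repair_cost \<Phi> c_cmp c_sys (snd (cycle_at 0 \<omega>)) ^ 4)"
      using has_bochner_integral_cycle_at[of "\<lambda>z. repair_cost \<Phi> c_cmp c_sys (snd z) ^ 4" 0]
        has_bochner_integral_final_state[of "\<lambda>x. repair_cost \<Phi> c_cmp c_sys x ^ 4"]
      by (auto simp: cycle_data_def has_bochner_integral_iff)
    show "distr M borel (\<lambda>\<omega>. repair_cost \<Phi> c_cmp c_sys (snd (cycle_at k \<omega>))) =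
        distr M borel (\<lambda>\<omega>. repair_cost \<Phi> c_cmp c_sys (snd (cycle_at 0 \<omega>)))" for k
      by (rule law) measurable
  qed
  have e: "expectation (\<lambda>\<omega>. fst (cycle_at 0 \<omega>)) = mean_length"
    "expectation (\<lambda>\<omega>. repair_cost \<Phi> c_cmp c_sys (snd (cycle_at 0 \<omega>))) = mean_cost c_cmp c_sys"
    using has_bochner_integral_length[of 0] has_bochner_integral_cost[of c_cmp c_sys 0]
    by (auto simp: has_bochner_integral_iff)
  show ?thesis
    using 1 2
  proof eventually_elim
    case (elim \<omega>)
    have R: "repair_time \<Phi> r (array \<omega>) m = (\<Sum>k<m. fst (cycle_at k \<omega>))" for m
      by (simp add: repair_time_eq cycle_at_def cycle_data_def)
    have "((\<lambda>t. (\<Sum>k | repair_time \<Phi> r (array \<omega>) (Suc k) \<le> t. repair_cost \<Phi> c_cmp c_sys (snd (cycle_at k \<omega>))) / t)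
        \<longlongrightarrow> mean_cost c_cmp c_sys / mean_length) at_top"
      using elim by (intro renewal_reward_limit incseq_repair_time mean_length_pos) (simp_all add: R e)
    then show ?case
    proof (rule Lim_transform_eventually)
      show "\<forall>\<^sub>F t in at_top. (\<Sum>k | repair_time \<Phi> r (array \<omega>) (Suc k) \<le> t. repair_cost \<Phi> c_cmp c_sys (snd (cycle_at k \<omega>))) / t =
          total_cost \<Phi> r c_cmp c_sys (array \<omega>) (ennreal t) / t"
        \<comment> \<open>For negative \<open>t\<close> the coercion \<open>ennreal t\<close> is 0,
          so the comparison is transferred for \<open>t \<ge> 0\<close>.\<close>
        using eventually_ge_at_top[of 0]
        by eventually_elim (simp add: total_cost_def state_before_repair cycle_at_def cycle_data_def ennreal_le_iff)
    qed
  qed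
qed

end

text \<open>\<open>T_fail\<close> is infinite if the system never fails, so its mean is a
  nonnegative integral in \<open>ennreal\<close>. The other means are stated through
  \<open>has_bochner_integral\<close>, which includes integrability.\<close>

theorem corollary3p1:
  fixes M :: "'a measure"
    and X :: "nat \<Rightarrow> 'c::finite \<Rightarrow> 'a \<Rightarrow> real"
    and \<Phi> :: "('c \<Rightarrow> bool) \<Rightarrow> bool"
    and \<mu> c_sys :: real
    and c_cmp :: "nat \<Rightarrow> real"
    and n r :: nat
  assumes "n = CARD('c)" and "n > 1"
    and "semi_coherent \<Phi>"
    and "\<mu> > 0"
    and "r \<in> {1..n}"
    and "prob_space M"
    and "prob_space.indep_vars M (\<lambda>_. borel) (\<lambda>(k, i). X k i) UNIV"
    and "\<And>k i. distributed M lborel (X k i) (exponential_density \<mu>)"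
  shows
    "let L = (\<lambda>\<omega> k i. X k i \<omega>);
         T_rep = (\<lambda>\<omega>. first_repair_time \<Phi> r (L \<omega>));
         T_fail = (\<lambda>\<omega>. fail_time \<Phi> r (L \<omega>));
         C = (\<lambda>\<omega> t. total_cost \<Phi> r c_cmp c_sys (L \<omega>) t);
         p = measure M {\<omega> \<in> space M. ennreal (T_rep \<omega>) = T_fail \<omega>};
         s = struct_signature \<Phi>;
         cost = (\<Sum>k=1..r. s k * (c_sys + c_cmp k)) + (\<Sum>k=r+1..n. s k) * c_cmp r;
         time = (\<Sum>k=1..r. s k * (\<Sum>i=n-k+1..n. 1 / real i))
                + (\<Sum>k=r+1..n. s k) * (\<Sum>i=n-r+1..n. 1 / real i)
     in T_rep \<in> borel_measurable M \<and> T_fail \<in> borel_measurable M \<and>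
        p = (\<Sum>k=1..r. s k) \<and>
        has_bochner_integral M (\<lambda>\<omega>. C \<omega> (ennreal (T_rep \<omega>))) cost \<and>
        has_bochner_integral M T_rep (1 / \<mu> * time) \<and>
        (p > 0 \<longrightarrow>
           has_bochner_integral M (\<lambda>\<omega>. C \<omega> (T_fail \<omega>))
             ((\<integral>\<omega>. C \<omega> (ennreal (T_rep \<omega>)) \<partial>M) / p) \<and>
           (\<integral>\<^sup>+\<omega>. T_fail \<omega> \<partial>M) = ennreal ((\<integral>\<omega>. T_rep \<omega> \<partial>M) / p)) \<and>
        (AE \<omega> in M. ((\<lambda>t::real. C \<omega> (ennreal t) / t) \<longlongrightarrow> \<mu> * (cost / time)) at_top)"
proof -
  interpret prob_space M by fact
  interpret repair_model \<Phi> r \<mu> M X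
    by unfold_locales (use assms in auto)
  define time where "time = (\<Sum>k=1..r. struct_signature \<Phi> k * (\<Sum>i=n-k+1..n. 1 / real i))
                + (\<Sum>k=r+1..n. struct_signature \<Phi> k) * (\<Sum>i=n-r+1..n. 1 / real i)"
  have L: "(\<lambda>k i. X k i \<omega>) = array \<omega>" for \<omega> by (simp add: array_def)
  \<comment> \<open>Here the mean length, so far kept in terms of \<open>S_bar\<close>, is converted
    to the harmonic sums weighted by the signature.\<close>
  have length: "mean_length = 1 / \<mu> * time"
    unfolding mean_length_def sum_S_bar time_def assms(1) ..
  have cost: "(\<Sum>k=1..r. struct_signature \<Phi> k * (c_sys + c_cmp k)) + (\<Sum>k=r+1..n. struct_signature \<Phi> k) * c_cmp r
      = mean_cost c_cmp c_sys"
    unfolding mean_cost_def assms(1) ..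
  have ratio: "\<mu> * (mean_cost c_cmp c_sys / time) = mean_cost c_cmp c_sys / mean_length"
    unfolding length by simp
  have first: "expectation (\<lambda>\<omega>. first_repair_time \<Phi> r (array \<omega>)) = mean_length"
    "(\<lambda>\<omega>. first_repair_time \<Phi> r (array \<omega>)) \<in> borel_measurable M"
    using has_bochner_integral_first_repair_time by (auto simp: has_bochner_integral_iff)
  have first_cost: "expectation (\<lambda>\<omega>. total_cost \<Phi> r c_cmp c_sys (array \<omega>) (ennreal (first_repair_time \<Phi> r (array \<omega>)))) =
      mean_cost c_cmp c_sys"
    using has_bochner_integral_cost_first_repair[of c_cmp c_sys] by (simp add: has_bochner_integral_iff)
  show ?thesis
    unfolding Let_def L prob_first_repair_failure cost time_def[symmetric] ratio first first_cost length[symmetric]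
    using first(2) measurable_fail_time has_bochner_integral_cost_first_repair[of c_cmp c_sys]
      has_bochner_integral_first_repair_time has_bochner_integral_cost_fail_time[of c_cmp c_sys]
      nn_integral_fail_time long_run_cost[of c_cmp c_sys]
    by (simp add: failure_prob_def)
qed

end
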